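(* Let $n\ge 1$. As a left or as a right ${}^{B}\Lambda_n^-$-module, $\mathrm{Pol}_n^-$ is free of graded rank $q^{n^2}[2n]!!$, with a homogeneous basis given by the spin type B Schubert polynomials $\{{}^{B}\mathfrak{s}_w\}_{w\in B_n}$.
   Context: $\mathrm{Pol}_n^-$ is the unital $\mathbb{Z}$-algebra generated by $x_1,\dots,x_n$ subject to $x_ix_j+x_jx_i=0$ for all $i\ne j$, $\mathbb{Z}$-graded with $|x_i|=2$. For $1\le i\le n-1$ let $s_i$ be the algebra endomorphism of $\mathrm{Pol}_n^-$ with $s_i(x_i)=-x_{i+1}$, $s_i(x_{i+1})=-x_i$, $s_i(x_j)=-x_j$ for $j\ne i,i+1$, and let $s_n^B$ be the algebra endomorphism with $s_n^B(x_j)=-x_j$ for all $j$. The type B odd Demazure operators are the $\mathbb{Z}$-linear operators $\partial_i^-$ ($1\le i\le n-1$) and $\partial_n^B$ on $\mathrm{Pol}_n^-$ that kill $1$ and satisfy: $\partial_i^-(x_j)=1$ if $j\in\{i,i+1\}$ and $0$ otherwise; $\partial_n^B(x_j)=1$ if $j=n$ and $0$ otherwise; and $\partial_i^-(fg)=\partial_i^-(f)g+s_i(f)\partial_i^-(g)$, $\partial_n^B(fg)=\partial_n^B(f)g+s_n^B(f)\partial_n^B(g)$ for all $f,g$. The ring of spin type B symmetric polynomials is the subalgebra ${}^{B}\Lambda_n^-=\bigcap_{i=1}^{n-1}\ker(\partial_i^-)\cap\ker(\partial_n^B)$. $B_n=\langle s_1,\dots,s_n\rangle$ is the Weyl group of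 type $B_n$ with simple reflections $s_1,\dots,s_{n-1}$ (generating $S_n$) and $s_n$, where $(s_{n-1}s_n)^4=1$ and $s_n$ commutes with $s_i$ for $i\le n-2$; $w_n$ is its longest element. Write $\partial_i:=\partial_i^-$ for $i<n$ and $\partial_n:=\partial_n^B$. For each $w\in B_n$ a reduced expression $w=s_{i_1}\cdots s_{i_\ell}$ is chosen and $\partial_w^B:=\partial_{i_1}\cdots\partial_{i_\ell}$ (well defined up to sign). The spin type B Schubert polynomials are ${}^{B}\mathfrak{s}_w=\partial^B_{w^{-1}w_n}(x_1^{2n-1}x_2^{2n-3}\cdots x_n)$, $w\in B_n$. The graded rank of a free graded module with homogeneous basis $\{b\}$ is $\sum_b q^{|b|}$. Here $[m]=\frac{q^m-q^{-m}}{q-q^{-1}}$ and $[2n]!!=[2n][2n-2]\cdots[4][2]$. *)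

theory Defs
  imports
    "HOL-Library.Cardinality"
    "HOL-Combinatorics.Permutations"
    "HOL-Computational_Algebra.Polynomial"
    "HOL-Computational_Algebra.Fraction_Field"
begin

section \<open>The skew polynomial algebra\<close>

text \<open>
  The unital ring (that is, unital \<open>\<int>\<close>-algebra) presented by generators \<open>x\<^sub>1, \<dots>, x\<^sub>n\<close> and relations
  \<open>x\<^sub>i x\<^sub>j + x\<^sub>j x\<^sub>i = 0\<close> for \<open>i \<noteq> j\<close>: ring expressions in the generators, modulo the least
  congruence containing the ring axioms and these relations. The relation is a partial
  equivalence, whose domain consists of the expressions in which only \<open>x\<^sub>1, \<dots>, x\<^sub>n\<close> occur. The
  phantom type parameter \<open>'n\<close> carries the number of variables \<open>n = CARD('n)\<close>, an arbitrary
  \<open>n \<ge> 1\<close>.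
\<close>

datatype (dead 'n) skew_term =
  Var nat | Zero | One | Neg "'n skew_term" | Add "'n skew_term" "'n skew_term"
  | Mul "'n skew_term" "'n skew_term"

inductive skew_eq :: "'n::finite skew_term \<Rightarrow> 'n skew_term \<Rightarrow> bool" where
  var: "i \<in> {1..CARD('n)} \<Longrightarrow> skew_eq (Var i :: 'n skew_term) (Var i)"
| zero: "skew_eq Zero Zero"
| one: "skew_eq One One"
| neg: "skew_eq a a' \<Longrightarrow> skew_eq (Neg a) (Neg a')"
| add: "skew_eq a a' \<Longrightarrow> skew_eq b b' \<Longrightarrow> skew_eq (Add a b) (Add a' b')"
| mul: "skew_eq a a' \<Longrightarrow> skew_eq b b' \<Longrightarrow> skew_eq (Mul a b) (Mul a' b')"
| sym: "skew_eq a b \<Longrightarrow> skew_eq b a"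
| trans: "skew_eq a b \<Longrightarrow> skew_eq b c \<Longrightarrow> skew_eq a c"
| add_assoc: "skew_eq a a \<Longrightarrow> skew_eq b b \<Longrightarrow> skew_eq c c \<Longrightarrow>
    skew_eq (Add (Add a b) c) (Add a (Add b c))"
| add_comm: "skew_eq a a \<Longrightarrow> skew_eq b b \<Longrightarrow> skew_eq (Add a b) (Add b a)"
| add_zero: "skew_eq a a \<Longrightarrow> skew_eq (Add Zero a) a"
| add_neg: "skew_eq a a \<Longrightarrow> skew_eq (Add (Neg a) a) Zero"
| mul_assoc: "skew_eq a a \<Longrightarrow> skew_eq b b \<Longrightarrow> skew_eq c c \<Longrightarrow>
    skew_eq (Mul (Mul a b) c) (Mul a (Mul b c))"
| one_mul: "skew_eq a a \<Longrightarrow> skew_eq (Mul One a) a"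
| mul_one: "skew_eq a a \<Longrightarrow> skew_eq (Mul a One) a"
| distrib_right: "skew_eq a a \<Longrightarrow> skew_eq b b \<Longrightarrow> skew_eq c c \<Longrightarrow>
    skew_eq (Mul (Add a b) c) (Add (Mul a c) (Mul b c))"
| distrib_left: "skew_eq a a \<Longrightarrow> skew_eq b b \<Longrightarrow> skew_eq c c \<Longrightarrow>
    skew_eq (Mul a (Add b c)) (Add (Mul a b) (Mul a c))"
| skew: "i \<in> {1..CARD('n)} \<Longrightarrow> j \<in> {1..CARD('n)} \<Longrightarrow> i \<noteq> j \<Longrightarrow>
    skew_eq (Add (Mul (Var i :: 'n skew_term) (Var j)) (Mul (Var j) (Var i))) Zero"

lemma part_equivp_skew_eq: "part_equivp skew_eq"
  by (rule part_equivpI)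
    (auto intro!: exI[of _ Zero] sympI transpI intro: skew_eq.zero skew_eq.sym skew_eq.trans)

quotient_type 'n skew_pol = "'n::finite skew_term" / partial: skew_eq
  by (rule part_equivp_skew_eq)

primrec const_coeff :: "'n skew_term \<Rightarrow> int" where
  "const_coeff (Var i) = 0"
| "const_coeff Zero = 0"
| "const_coeff One = 1"
| "const_coeff (Neg a) = - const_coeff a"
| "const_coeff (Add a b) = const_coeff a + const_coeff b"
| "const_coeff (Mul a b) = const_coeff a * const_coeff b"

lemma skew_eq_const_coeff: "skew_eq a b \<Longrightarrow> const_coeff a = const_coeff b"
  by (induction rule: skew_eq.induct) (auto simp: algebra_simps)

instantiation skew_pol :: (finite) ring_1
begin

lift_definition zero_skew_pol :: "'a skew_pol" is Zero by (rule skew_eq.zero)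
lift_definition one_skew_pol :: "'a skew_pol" is One by (rule skew_eq.one)
lift_definition uminus_skew_pol :: "'a skew_pol \<Rightarrow> 'a skew_pol" is Neg by (rule skew_eq.neg)
lift_definition plus_skew_pol :: "'a skew_pol \<Rightarrow> 'a skew_pol \<Rightarrow> 'a skew_pol" is Add
  by (rule skew_eq.add)
lift_definition times_skew_pol :: "'a skew_pol \<Rightarrow> 'a skew_pol \<Rightarrow> 'a skew_pol" is Mul
  by (rule skew_eq.mul)
definition minus_skew_pol :: "'a skew_pol \<Rightarrow> 'a skew_pol \<Rightarrow> 'a skew_pol" where
  "minus_skew_pol f g = f + - g"

instance
proof
  fix a b c :: "'a skew_pol"
  show "a + b + c = a + (b + c)" by transfer (rule skew_eq.add_assoc)
  show "a + b = b + a" by transfer (rule skew_eq.add_comm)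
  show "0 + a = a" by transfer (rule skew_eq.add_zero)
  show "- a + a = 0" by transfer (rule skew_eq.add_neg)
  show "a - b = a + - b" by (rule minus_skew_pol_def)
  show "a * b * c = a * (b * c)" by transfer (rule skew_eq.mul_assoc)
  show "1 * a = a" by transfer (rule skew_eq.one_mul)
  show "a * 1 = a" by transfer (rule skew_eq.mul_one)
  show "(a + b) * c = a * c + b * c" by transfer (rule skew_eq.distrib_right)
  show "a * (b + c) = a * b + a * c" by transfer (rule skew_eq.distrib_left)
  show "(0::'a skew_pol) \<noteq> 1" by transfer (auto dest: skew_eq_const_coeff)
qed

end

text \<open>\<open>X i\<close> is the generator \<open>x\<^sub>i\<close> for \<open>1 \<le> i \<le> n\<close>; the value outside this range is never used.\<close>

lift_definition X :: "nat \<Rightarrow> 'n::finite skew_pol" is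
  "\<lambda>i. if i \<in> {1..CARD('n)} then Var i else Zero"
  by (auto intro: skew_eq.var skew_eq.zero)

text \<open>The homogeneous component of degree \<open>d\<close> for the grading with \<open>\<bar>x\<^sub>i\<bar> = 2\<close>.\<close>

inductive_set homog :: "nat \<Rightarrow> 'n::finite skew_pol set" for d where
  monom: "set js \<subseteq> {1..CARD('n)} \<Longrightarrow> d = 2 * length js \<Longrightarrow>
    (prod_list (map X js) :: 'n skew_pol) \<in> homog d"
| zero: "0 \<in> homog d"
| add: "f \<in> homog d \<Longrightarrow> g \<in> homog d \<Longrightarrow> f + g \<in> homog d"
| uminus: "f \<in> homog d \<Longrightarrow> - f \<in> homog d"

text \<open>Meaningful for nonzero homogeneous elements only.\<close>

definition hdeg :: "'n::finite skew_pol \<Rightarrow> nat" where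
  "hdeg f = (THE d. f \<in> homog d)"


section \<open>Odd Demazure operators of type B\<close>

definition alg_endo :: "('n::finite skew_pol \<Rightarrow> 'n skew_pol) \<Rightarrow> bool" where
  "alg_endo h \<longleftrightarrow> h 1 = 1 \<and> (\<forall>f g. h (f + g) = h f + h g) \<and> (\<forall>f g. h (f * g) = h f * h g)"

definition endo_A :: "nat \<Rightarrow> 'n::finite skew_pol \<Rightarrow> 'n skew_pol" where
  "endo_A i = (THE h. alg_endo h \<and> (\<forall>j\<in>{1..CARD('n)}.
     h (X j) = (if j = i then - X (i + 1) else if j = i + 1 then - X i else - X j)))"

definition endo_B :: "'n::finite skew_pol \<Rightarrow> 'n skew_pol" where
  "endo_B = (THE h. alg_endo h \<and> (\<forall>j\<in>{1..CARD('n)}. h (X j) = - X j))"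

definition twisted_derivation ::
  "('n::finite skew_pol \<Rightarrow> 'n skew_pol) \<Rightarrow> ('n skew_pol \<Rightarrow> 'n skew_pol) \<Rightarrow> bool" where
  "twisted_derivation s D \<longleftrightarrow> D 1 = 0 \<and> (\<forall>f g. D (f + g) = D f + D g) \<and>
     (\<forall>f g. D (f * g) = D f * g + s f * D g)"

definition demazure_A :: "nat \<Rightarrow> 'n::finite skew_pol \<Rightarrow> 'n skew_pol" where
  "demazure_A i = (THE D. twisted_derivation (endo_A i) D \<and> (\<forall>j\<in>{1..CARD('n)}.
     D (X j) = (if j \<in> {i, i + 1} then 1 else 0)))"

definition demazure_B :: "'n::finite skew_pol \<Rightarrow> 'n skew_pol" where
  "demazure_B = (THE D. twisted_derivation endo_B D \<and> (\<forall>j\<in>{1..CARD('n)}.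
     D (X j) = (if j = CARD('n) then 1 else 0)))"

definition demazure :: "nat \<Rightarrow> 'n::finite skew_pol \<Rightarrow> 'n skew_pol" where
  "demazure i = (if i < CARD('n) then demazure_A i else demazure_B)"

definition sym_B :: "'n::finite skew_pol set" where
  "sym_B = {f. (\<forall>i\<in>{1..<CARD('n)}. demazure_A i f = 0) \<and> demazure_B f = 0}"


section \<open>The Weyl group of type B\<close>

text \<open>Realised as the group of signed permutations of \<open>{-n, \<dots>, n}\<close> under composition.\<close>

definition weyl_B :: "nat \<Rightarrow> (int \<Rightarrow> int) set" where
  "weyl_B n = {w. w permutes {- int n..int n} \<and> (\<forall>k. w (- k) = - w k)}"

definition simple_refl :: "nat \<Rightarrow> nat \<Rightarrow> int \<Rightarrow> int" where
  "simple_refl n i = (if i < n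
     then transpose (int i) (int i + 1) \<circ> transpose (- int i) (- int i - 1)
     else transpose (int n) (- int n))"

definition expression :: "nat \<Rightarrow> (int \<Rightarrow> int) \<Rightarrow> nat list \<Rightarrow> bool" where
  "expression n w js \<longleftrightarrow> set js \<subseteq> {1..n} \<and> w = foldr (\<lambda>i v. simple_refl n i \<circ> v) js id"

definition weyl_length :: "nat \<Rightarrow> (int \<Rightarrow> int) \<Rightarrow> nat" where
  "weyl_length n w = (LEAST l. \<exists>js. expression n w js \<and> length js = l)"

definition reduced_expression :: "nat \<Rightarrow> (int \<Rightarrow> int) \<Rightarrow> nat list \<Rightarrow> bool" where
  "reduced_expression n w js \<longleftrightarrow> expression n w js \<and> length js = weyl_length n w"

definition longest :: "nat \<Rightarrow> int \<Rightarrow> int" where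
  "longest n = (THE w. w \<in> weyl_B n \<and> (\<forall>v\<in>weyl_B n. weyl_length n v \<le> weyl_length n w))"


section \<open>Spin Schubert polynomials of type B\<close>

text \<open>The parameter \<open>red\<close> is the choice of a reduced expression for every group element.\<close>

definition demazure_elt ::
  "((int \<Rightarrow> int) \<Rightarrow> nat list) \<Rightarrow> (int \<Rightarrow> int) \<Rightarrow> 'n::finite skew_pol \<Rightarrow> 'n skew_pol" where
  "demazure_elt red w = foldr (\<lambda>i D. demazure i \<circ> D) (red w) id"

definition schubert_B :: "((int \<Rightarrow> int) \<Rightarrow> nat list) \<Rightarrow> (int \<Rightarrow> int) \<Rightarrow> 'n::finite skew_pol" where
  "schubert_B red w = demazure_elt red (inv w \<circ> longest CARD('n))
     (\<Prod>i\<leftarrow>[1..<CARD('n) + 1]. X i ^ (2 * (CARD('n) - i) + 1))"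


section \<open>Free modules and graded ranks\<close>

text \<open>Bases of a ring as a left or right module over a subring \<open>L\<close>. The library's modules are over
  commutative rings only.\<close>

definition left_basis :: "'a::ring_1 set \<Rightarrow> 'i set \<Rightarrow> ('i \<Rightarrow> 'a) \<Rightarrow> bool" where
  "left_basis L I b \<longleftrightarrow> finite I \<and>
     (\<forall>f. \<exists>c. (\<forall>i\<in>I. c i \<in> L) \<and> f = (\<Sum>i\<in>I. c i * b i)) \<and>
     (\<forall>c. (\<forall>i\<in>I. c i \<in> L) \<and> (\<Sum>i\<in>I. c i * b i) = 0 \<longrightarrow> (\<forall>i\<in>I. c i = 0))"

definition right_basis :: "'a::ring_1 set \<Rightarrow> 'i set \<Rightarrow> ('i \<Rightarrow> 'a) \<Rightarrow> bool" where
  "right_basis L I b \<longleftrightarrow> finite I \<and>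
     (\<forall>f. \<exists>c. (\<forall>i\<in>I. c i \<in> L) \<and> f = (\<Sum>i\<in>I. b i * c i)) \<and>
     (\<forall>c. (\<forall>i\<in>I. c i \<in> L) \<and> (\<Sum>i\<in>I. b i * c i) = 0 \<longrightarrow> (\<forall>i\<in>I. c i = 0))"

text \<open>Graded ranks are taken in the field \<open>\<rat>(q)\<close>, as the fraction field of \<open>\<int>[q]\<close>.\<close>

definition q_var :: "int poly fract" where
  "q_var = Fract [:0, 1:] 1"

definition quantum_int :: "nat \<Rightarrow> int poly fract" where
  "quantum_int m = (q_var ^ m - inverse q_var ^ m) / (q_var - inverse q_var)"

definition even_quantum_dfact :: "nat \<Rightarrow> int poly fract" where
  "even_quantum_dfact n = (\<Prod>k\<in>{1..n}. quantum_int (2 * k))"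

definition graded_rank :: "'i set \<Rightarrow> ('i \<Rightarrow> 'n::finite skew_pol) \<Rightarrow> int poly fract" where
  "graded_rank I b = (\<Sum>i\<in>I. q_var ^ hdeg (b i))"

end

theory Submission
  imports Defs "HOL-Library.Function_Algebras" "HOL-Library.Product_Plus"
begin

text \<open>
  Write \<open>\<partial>\<^sub>u\<close> for the product of Demazure operators along the chosen reduced word of \<open>u\<close>, \<open>\<ss>\<^sub>w\<close> for the
  Schubert polynomials, \<open>\<Lambda>\<close> for the ring of symmetric polynomials and \<open>l\<close> for the length. The proof is
  a triangularity argument that rests on two facts about the operators.

  First, they satisfy the nilHecke relations of type B up to sign. By the word property of the Weyl
  group, a product of operators along a word therefore vanishes if the word is not reduced, and
  otherwise depends up to sign only on the group element (\<open>demazure_word_nonreduced\<close>,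
  \<open>demazure_word_same_value\<close>). Second, the product along a reduced word of the longest element sends
  the monomial \<open>x\<^sub>1\<^bsup>2n-1\<^esup> x\<^sub>2\<^bsup>2n-3\<^esup> \<cdots> x\<^sub>n\<close> to \<open>\<plusminus>1\<close> (\<open>longest_demazure_staircase\<close>). Since
  \<open>\<partial>\<^sub>u \<ss>\<^sub>w\<close> is itself a product along a word applied to this monomial, comparing lengths gives
  \<open>\<partial>\<^sub>w \<ss>\<^sub>w = \<plusminus>1\<close> and \<open>\<partial>\<^sub>u \<ss>\<^sub>w = 0\<close> whenever \<open>u \<noteq> w\<close> and \<open>l w \<le> l u\<close> (\<open>schubert_pairing\<close>).

  The operators are linear over \<open>\<Lambda>\<close> acting on the right, so the pairing makes the \<open>\<ss>\<^sub>w\<close> independent over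
  \<open>\<Lambda>\<close>. They also span: if \<open>\<partial>\<^sub>v f = 0\<close> for all \<open>v\<close> longer than \<open>u\<close>, then \<open>\<partial>\<^sub>u f\<close> is killed by every
  Demazure operator, so that it lies in \<open>\<Lambda>\<close>, and subtracting \<open>\<plusminus> \<ss>\<^sub>u \<partial>\<^sub>u f\<close> for all \<open>u\<close> of one length removes that layer
  of \<open>f\<close>; after the layer of length \<open>0\<close> nothing is left.

  The Leibniz rule is twisted on the left, and this argument has no direct left-handed analogue.
  Left modules are covered because \<open>\<Lambda>\<close> is central (\<open>sym_B_central\<close>): an element killed by the last
  operator is even in \<open>x\<^sub>n\<close>, being killed by the \<open>i\<close>-th one transports evenness from \<open>x\<^sub>i\<^sub>+\<^sub>1\<close> to \<open>x\<^sub>i\<close>,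
  and an element that is even in every variable commutes with every variable.

  Finally \<open>\<ss>\<^sub>w\<close> has degree \<open>2 l w\<close>, so that the graded rank is the length generating function of
  the Weyl group at \<open>q\<^sup>2\<close>. It is computed by writing a signed permutation as the list of its signed values
  and splitting off the first one.
\<close>

section \<open>Modules over the skew polynomial algebra\<close>

text \<open>
  An additive group with additive endomorphisms \<open>T 1, \<dots>, T n\<close> that anticommute pairwise is a left
  module over the presented algebra. This is the form in which its universal property is used:
  endomorphisms, twisted derivations and coefficient functions all arise from suitable modules.
\<close>

primrec act_term :: "(nat \<Rightarrow> 'v \<Rightarrow> 'v) \<Rightarrow> 'n skew_term \<Rightarrow> 'v \<Rightarrow> 'v::ab_group_add" where
  "act_term T (Var i) v = T i v"
| "act_term T Zero v = 0"
| "act_term T One v = v"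
| "act_term T (Neg a) v = - act_term T a v"
| "act_term T (Add a b) v = act_term T a v + act_term T b v"
| "act_term T (Mul a b) v = act_term T a (act_term T b v)"

definition skew_family :: "'n::finite itself \<Rightarrow> (nat \<Rightarrow> 'v \<Rightarrow> 'v::ab_group_add) \<Rightarrow> bool" where
  "skew_family _ T \<longleftrightarrow> (\<forall>i\<in>{1..CARD('n)}. \<forall>u v. T i (u + v) = T i u + T i v) \<and>
     (\<forall>i\<in>{1..CARD('n)}. \<forall>j\<in>{1..CARD('n)}. i \<noteq> j \<longrightarrow> (\<forall>v. T i (T j v) + T j (T i v) = 0))"

definition skew_act :: "(nat \<Rightarrow> 'v \<Rightarrow> 'v) \<Rightarrow> 'n::finite skew_pol \<Rightarrow> 'v \<Rightarrow> 'v::ab_group_add" where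
  "skew_act T f = act_term T (rep_skew_pol f)"

text \<open>
  Additivity has to be carried through the induction, because the left distributive law is
  respected only by additive operators.
\<close>

lemma act_term_cong:
  assumes T: "skew_family TYPE('n::finite) T" and "skew_eq a (b :: 'n skew_term)"
  shows "act_term T a = act_term T b \<and> (\<forall>u v. act_term T a (u + v) = act_term T a u + act_term T a v)"
  using assms(2)
proof (induction rule: skew_eq.induct)
  case (var i)
  then show ?case using T by (auto simp: skew_family_def fun_eq_iff)
next
  case (skew i j)
  then have "T i (T j v) + T j (T i v) = 0" for v
    using T by (auto simp: skew_family_def)
  moreover have "T i (u + v) = T i u + T i v" "T j (u + v) = T j u + T j v" for u v
    using T skew by (auto simp: skew_family_def)
  moreover have "T i (T j u) + T i (T j v) + (T j (T i u) + T j (T i v)) =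
      (T i (T j u) + T j (T i u)) + (T i (T j v) + T j (T i v))" for u v
    by simp
  ultimately show ?case by (auto simp: fun_eq_iff)
qed (auto simp: fun_eq_iff add_ac)

lemma skew_eq_rep_abs: "skew_eq a a \<Longrightarrow> skew_eq (rep_skew_pol (abs_skew_pol a)) a"
  by (rule Quotient3_rep_abs[OF Quotient3_skew_pol])

lemma skew_act_abs:
  assumes "skew_family TYPE('n::finite) T" "skew_eq a (a :: 'n skew_term)"
  shows "skew_act T (abs_skew_pol a) = act_term T a"
  unfolding skew_act_def using act_term_cong[OF assms(1) skew_eq_rep_abs[OF assms(2)]] by simp

context
  fixes T :: "nat \<Rightarrow> 'v \<Rightarrow> 'v::ab_group_add"
  assumes T: "skew_family TYPE('n::finite) T"
begin

lemma skew_act_X: "i \<in> {1..CARD('n)} \<Longrightarrow> skew_act T (X i :: 'n skew_pol) v = T i v"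
  using skew_act_abs[OF T skew_eq.var[of i]] by (simp add: X.abs_eq)

lemma skew_act_0: "skew_act T (0 :: 'n skew_pol) v = 0"
  using skew_act_abs[OF T skew_eq.zero] by (simp add: zero_skew_pol.abs_eq)

lemma skew_act_1: "skew_act T (1 :: 'n skew_pol) v = v"
  using skew_act_abs[OF T skew_eq.one] by (simp add: one_skew_pol.abs_eq)

lemma skew_act_uminus: "skew_act T (- f :: 'n skew_pol) v = - skew_act T f v"
proof (induction f rule: skew_pol.abs_induct)
  case (1 a)
  then show ?case using skew_act_abs[OF T 1] skew_act_abs[OF T skew_eq.neg[OF 1]]
    by (simp add: uminus_skew_pol.abs_eq)
qed

lemma skew_act_plus: "skew_act T (f + g :: 'n skew_pol) v = skew_act T f v + skew_act T g v"
proof (induction f rule: skew_pol.abs_induct)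
  case (1 a)
  show ?case
  proof (induction g rule: skew_pol.abs_induct)
    case (1 b)
    note a = \<open>skew_eq a a\<close> and b = \<open>skew_eq b b\<close>
    show ?case using skew_act_abs[OF T a] skew_act_abs[OF T b] skew_act_abs[OF T skew_eq.add[OF a b]]
      by (simp add: plus_skew_pol.abs_eq a b)
  qed
qed

lemma skew_act_times: "skew_act T (f * g :: 'n skew_pol) v = skew_act T f (skew_act T g v)"
proof (induction f rule: skew_pol.abs_induct)
  case (1 a)
  show ?case
  proof (induction g rule: skew_pol.abs_induct)
    case (1 b)
    note a = \<open>skew_eq a a\<close> and b = \<open>skew_eq b b\<close>
    show ?case using skew_act_abs[OF T a] skew_act_abs[OF T b] skew_act_abs[OF T skew_eq.mul[OF a b]]
      by (simp add: times_skew_pol.abs_eq a b)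
  qed
qed

lemma skew_act_add: "skew_act T (f :: 'n skew_pol) (u + v) = skew_act T f u + skew_act T f v"
proof (induction f rule: skew_pol.abs_induct)
  case (1 a)
  then show ?case using skew_act_abs[OF T 1] act_term_cong[OF T 1] by simp
qed

lemmas skew_act_simps = skew_act_X skew_act_0 skew_act_1 skew_act_uminus skew_act_plus
  skew_act_times skew_act_add

end

primrec term_vars :: "'n skew_term \<Rightarrow> nat set" where
  "term_vars (Var i) = {i}"
| "term_vars Zero = {}"
| "term_vars One = {}"
| "term_vars (Neg a) = term_vars a"
| "term_vars (Add a b) = term_vars a \<union> term_vars b"
| "term_vars (Mul a b) = term_vars a \<union> term_vars b"

lemma skew_eq_term_vars:
  "skew_eq a (b :: 'n::finite skew_term) \<Longrightarrow>
    term_vars a \<subseteq> {1..CARD('n)} \<and> term_vars b \<subseteq> {1..CARD('n)}"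
  by (induction rule: skew_eq.induct) auto

lemma skew_eq_refl: "term_vars (a :: 'n::finite skew_term) \<subseteq> {1..CARD('n)} \<Longrightarrow> skew_eq a a"
  by (induction a) (auto intro: skew_eq.intros(1-6))

lemma skew_pol_ring_induct:
  fixes f :: "'n::finite skew_pol"
  assumes X: "\<And>i. i \<in> {1..CARD('n)} \<Longrightarrow> P (X i :: 'n skew_pol)"
    and zero: "P 0" and one: "P 1" and uminus: "\<And>f. P f \<Longrightarrow> P (- f)"
    and add: "\<And>f g. P f \<Longrightarrow> P g \<Longrightarrow> P (f + g)" and mult: "\<And>f g. P f \<Longrightarrow> P g \<Longrightarrow> P (f * g)"
  shows "P f"
proof -
  have "P (abs_skew_pol a)" if "term_vars a \<subseteq> {1..CARD('n)}" for a :: "'n skew_term"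
    using that
  proof (induction a)
    case (Var i) then show ?case using X[of i] by (simp add: X.abs_eq)
  next
    case Zero show ?case using zero by (simp add: zero_skew_pol.abs_eq)
  next
    case One show ?case using one by (simp add: one_skew_pol.abs_eq)
  next
    case (Neg a) then show ?case using uminus by (simp add: uminus_skew_pol.abs_eq[symmetric] skew_eq_refl)
  next
    case (Add a b) then show ?case using add by (simp add: plus_skew_pol.abs_eq[symmetric] skew_eq_refl)
  next
    case (Mul a b) then show ?case using mult by (simp add: times_skew_pol.abs_eq[symmetric] skew_eq_refl)
  qed
  then show ?thesis
    by (induction f rule: skew_pol.abs_induct) (auto dest: skew_eq_term_vars)
qed

text \<open>
  Products can be peeled off one generator at a time. A statement about a map that is semilinear
  under left multiplication by the generators thus reduces to its value at \<open>1\<close>.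
\<close>

lemma skew_pol_induct [case_names zero one uminus add X_mult]:
  fixes f :: "'n::finite skew_pol"
  assumes zero: "P 0" and one: "P 1" and uminus: "\<And>f. P f \<Longrightarrow> P (- f)"
    and add: "\<And>f g. P f \<Longrightarrow> P g \<Longrightarrow> P (f + g)"
    and X: "\<And>i f. i \<in> {1..CARD('n)} \<Longrightarrow> P f \<Longrightarrow> P (X i * f)"
  shows "P (f :: 'n skew_pol)"
proof -
  have "\<forall>g. P g \<longrightarrow> P (f * g)"
  proof (induction f rule: skew_pol_ring_induct)
    case (4 f) then show ?case using uminus by simp
  next
    case (5 f g) then show ?case using add by (simp add: semiring_class.distrib_right)
  next
    case (6 f g) then show ?case by (simp add: mult.assoc)
  qed (use X zero in auto)
  then show ?thesis using one by fastforce
qed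

lemma X_anticommute:
  assumes "i \<in> {1..CARD('n)}" "j \<in> {1..CARD('n)}" "i \<noteq> j"
  shows "X i * X j = - (X j * X i :: 'n::finite skew_pol)"
proof -
  have "X i * X j + X j * X i = (0 :: 'n skew_pol)"
    using assms by transfer (auto intro: skew_eq.skew)
  then show ?thesis by (simp add: eq_neg_iff_add_eq_0)
qed

section \<open>Endomorphisms and twisted derivations\<close>

lemma alg_endoD:
  assumes "alg_endo h"
  shows "h 1 = 1" "h (f + g) = h f + h g" "h (f * g) = h f * h g" "h 0 = 0" "h (- f) = - h f"
    "h (f - g) = h f - h g"
proof -
  show h: "h 1 = 1" "h (f + g) = h f + h g" "h (f * g) = h f * h g" for f g
    using assms by (auto simp: alg_endo_def)
  show "h 0 = 0" using h(2)[of 0 0] by simp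
  then show minus: "h (- f) = - h f" for f using h(2)[of f "- f"] by (simp add: eq_neg_iff_add_eq_0 add.commute)
  show "h (f - g) = h f - h g" using h(2)[of f "- g"] minus by simp
qed

lemma alg_endo_unique:
  assumes h: "alg_endo h" and k: "alg_endo k"
    and eq: "\<And>j. j \<in> {1..CARD('n)} \<Longrightarrow> h (X j) = k (X j)"
  shows "h = (k :: 'n::finite skew_pol \<Rightarrow> 'n skew_pol)"
proof
  show "h f = k f" for f
    by (induction f rule: skew_pol_induct) (simp_all add: alg_endoD[OF h] alg_endoD[OF k] eq)
qed

text \<open>
  The elements \<open>y i\<close> act on the algebra by left multiplication; the endomorphism sends \<open>f\<close> to the result
  of its action on \<open>1\<close>.
\<close>

lemma alg_endo_ex1:
  fixes y :: "nat \<Rightarrow> 'n::finite skew_pol"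
  assumes "\<And>i j. i \<in> {1..CARD('n)} \<Longrightarrow> j \<in> {1..CARD('n)} \<Longrightarrow> i \<noteq> j \<Longrightarrow> y i * y j + y j * y i = 0"
  shows "\<exists>!h. alg_endo h \<and> (\<forall>j\<in>{1..CARD('n)}. h (X j) = y j)"
proof -
  define T where "T = (\<lambda>i v. y i * v)"
  have "T i (T j v) + T j (T i v) = (y i * y j + y j * y i) * v" for i j v
    by (simp add: T_def algebra_simps)
  moreover have "T i (u + v) = T i u + T i v" for i u v
    by (simp add: T_def algebra_simps)
  ultimately have T: "skew_family TYPE('n) T"
    using assms by (simp add: skew_family_def)
  note act = skew_act_simps[OF T]
  define h where "h f = skew_act T f 1" for f :: "'n skew_pol"
  have right: "skew_act T f (u * v) = skew_act T f u * v" for f :: "'n skew_pol" and u v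
  proof (induction f arbitrary: u v rule: skew_pol_induct)
    case (X_mult i f)
    then show ?case by (simp add: act) (simp add: T_def mult.assoc)
  qed (simp_all add: act semiring_class.distrib_right)
  have "h (f * g) = h f * h g" for f g
    using right[of f 1 "h g"] by (simp add: h_def act)
  then have "alg_endo h"
    by (simp add: alg_endo_def) (simp add: h_def act)
  moreover have "h (X j) = y j" if "j \<in> {1..CARD('n)}" for j
    using that by (simp add: h_def act) (simp add: T_def)
  ultimately have h: "alg_endo h \<and> (\<forall>j\<in>{1..CARD('n)}. h (X j) = y j)" by blast
  show ?thesis
  proof (rule ex1I, rule h)
    fix k assume "alg_endo k \<and> (\<forall>j\<in>{1..CARD('n)}. k (X j) = y j)"
    with h show "k = h" by (intro alg_endo_unique) auto
  qed
qed

lemma twisted_derivationD: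
  assumes "twisted_derivation s D"
  shows "D 1 = 0" "D (f + g) = D f + D g" "D (f * g) = D f * g + s f * D g" "D 0 = 0"
    "D (- f) = - D f" "D (f - g) = D f - D g"
proof -
  show h: "D 1 = 0" "D (f + g) = D f + D g" "D (f * g) = D f * g + s f * D g" for f g
    using assms by (auto simp: twisted_derivation_def)
  show "D 0 = 0" using h(2)[of 0 0] by simp
  then show minus: "D (- f) = - D f" for f using h(2)[of f "- f"] by (simp add: eq_neg_iff_add_eq_0 add.commute)
  show "D (f - g) = D f - D g" using h(2)[of f "- g"] minus by simp
qed

lemma twisted_derivation_unique:
  assumes D: "twisted_derivation s D" and E: "twisted_derivation s E"
    and eq: "\<And>j. j \<in> {1..CARD('n)} \<Longrightarrow> D (X j) = E (X j)"
  shows "D = (E :: 'n::finite skew_pol \<Rightarrow> 'n skew_pol)"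
proof
  show "D f = E f" for f
    by (induction f rule: skew_pol_induct)
      (simp_all add: twisted_derivationD[OF D] twisted_derivationD[OF E] eq)
qed

text \<open>
  The twisted Leibniz rule says that \<open>f \<mapsto> (s f, D f; 0, f)\<close> is a homomorphism into upper triangular
  matrices. Hence \<open>D\<close> is read off from the module of column vectors, on which \<open>x\<^sub>i\<close> acts by the matrix
  \<open>(s x\<^sub>i, d i; 0, x\<^sub>i)\<close>; the hypothesis on \<open>d\<close> is the anticommutation of the corner entries.
\<close>

lemma twisted_derivation_ex1:
  fixes d :: "nat \<Rightarrow> 'n::finite skew_pol"
  assumes s: "alg_endo s"
    and d: "\<And>i j. i \<in> {1..CARD('n)} \<Longrightarrow> j \<in> {1..CARD('n)} \<Longrightarrow> i \<noteq> j \<Longrightarrow>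
      d i * X j + s (X i) * d j + (d j * X i + s (X j) * d i) = 0"
  shows "\<exists>!D. twisted_derivation s D \<and> (\<forall>j\<in>{1..CARD('n)}. D (X j) = d j)"
proof -
  note s = alg_endoD[OF s]
  define T where "T = (\<lambda>i (u, v). (s (X i) * u + d i * v, X i * v))"
  have sX: "s (X i) * s (X j) + s (X j) * s (X i) = 0"
    if "i \<in> {1..CARD('n)}" "j \<in> {1..CARD('n)}" "i \<noteq> j" for i j
    using X_anticommute[OF that] by (metis s(2-4) add.left_inverse)
  have "T i (T j p) + T j (T i p) = 0"
    if ij: "i \<in> {1..CARD('n)}" "j \<in> {1..CARD('n)}" "i \<noteq> j" for i j p
  proof -
    obtain u v where p: "p = (u, v)" by (cases p)
    have "fst (T i (T j p) + T j (T i p)) = (s (X i) * s (X j) + s (X j) * s (X i)) * u +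
        (d i * X j + s (X i) * d j + (d j * X i + s (X j) * d i)) * v"
      by (simp add: T_def p algebra_simps)
    moreover have "snd (T i (T j p) + T j (T i p)) = 0"
      using X_anticommute[OF ij] by (simp add: T_def p mult.assoc[symmetric])
    ultimately show ?thesis using sX[OF ij] d[OF ij] by (simp add: prod_eq_iff)
  qed
  moreover have "T i (p + q) = T i p + T i q" for i p q
    by (cases p; cases q) (simp add: T_def algebra_simps)
  ultimately have T: "skew_family TYPE('n) T"
    by (simp add: skew_family_def)
  note act = skew_act_simps[OF T]
  define D where "D f = fst (skew_act T f (0, 1))" for f :: "'n skew_pol"
  have D: "D 0 = 0" "D 1 = 0" "D (- f) = - D f" "D (f + g) = D f + D g" for f g
    by (simp_all add: D_def act)
  have T_fst: "fst (T i p) = s (X i) * fst p + d i * snd p"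
    and T_snd: "snd (T i p) = X i * snd p" for i p
    by (simp_all add: T_def case_prod_unfold)
  have act_snd: "snd (skew_act T f p) = f * snd p" for f :: "'n skew_pol" and p
    by (induction f arbitrary: p rule: skew_pol_induct)
      (auto simp: act semiring_class.distrib_right mult.assoc T_snd)
  have act_eq: "skew_act T f (u, v) = (s f * u + D f * v, f * v)" for f :: "'n skew_pol" and u v
  proof (induction f arbitrary: u v rule: skew_pol_induct)
    case zero then show ?case by (simp add: D act s zero_prod_def)
  next
    case one then show ?case by (simp add: D act s)
  next
    case (uminus f) then show ?case by (simp add: D act s)
  next
    case (add f g) then show ?case by (simp add: D act s algebra_simps)
  next
    case (X_mult i f)
    have "D (X i * f) = s (X i) * D f + d i * f"
      using X_mult(1) by (simp add: D_def act T_fst act_snd)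
    with X_mult show ?case by (simp add: act s) (simp add: T_def algebra_simps)
  qed
  have "twisted_derivation s D"
    unfolding twisted_derivation_def
  proof (intro conjI allI)
    show "D 1 = 0" "D (f + g) = D f + D g" for f g by (simp_all add: D)
    show "D (f * g) = D f * g + s f * D g" for f g
      using skew_act_times[OF T, of f g "(0, 1)"] by (simp add: act_eq add.commute)
  qed
  moreover have "D (X j) = d j" if "j \<in> {1..CARD('n)}" for j
    using that by (simp add: D_def act) (simp add: T_def)
  ultimately have D: "twisted_derivation s D \<and> (\<forall>j\<in>{1..CARD('n)}. D (X j) = d j)" by blast
  show ?thesis
  proof (rule ex1I, rule D)
    fix E assume "twisted_derivation s E \<and> (\<forall>j\<in>{1..CARD('n)}. E (X j) = d j)"
    with D show "E = D" by (intro twisted_derivation_unique[of s]) auto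
  qed
qed

section \<open>Coefficients\<close>

text \<open>
  All cancellation laws used later come from the fact that the ordered monomials
  \<open>x\<^sub>1\<^bsup>e 1\<^esup> \<cdots> x\<^sub>n\<^bsup>e n\<^esup>\<close> form a basis. The coefficients are obtained from the module of all functions
  on exponents, where \<open>x\<^sub>j\<close> shifts the exponent of \<open>j\<close> and contributes the sign of moving past the
  variables with smaller index.
\<close>

definition koszul_sign :: "nat \<Rightarrow> (nat \<Rightarrow> nat) \<Rightarrow> int" where
  "koszul_sign j e = (- 1) ^ (\<Sum>i\<in>{1..<j}. e i)"

lemma koszul_sign_upd_ge: "j \<le> i \<Longrightarrow> koszul_sign j (e(i := m)) = koszul_sign j e"
  unfolding koszul_sign_def by (intro arg_cong[where f = "\<lambda>k. (- 1) ^ k"] sum.cong) auto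

lemma koszul_sign_upd_Suc:
  assumes "1 \<le> i" "i < j"
  shows "koszul_sign j (e(i := Suc m)) = - koszul_sign j (e(i := m))"
proof -
  have "(\<Sum>l\<in>{1..<j}. (e(i := k)) l) = k + (\<Sum>l\<in>{1..<j} - {i}. e l)" for k
    using assms by (subst sum.remove[of _ i]) (auto intro!: sum.cong)
  then show ?thesis by (simp add: koszul_sign_def)
qed

lemma koszul_sign_square [simp]: "koszul_sign j e * koszul_sign j e = 1"
  by (simp add: koszul_sign_def flip: power_add mult_2)

definition monomial_shift :: "nat \<Rightarrow> ((nat \<Rightarrow> nat) \<Rightarrow> int) \<Rightarrow> (nat \<Rightarrow> nat) \<Rightarrow> int" where
  "monomial_shift j \<phi> e = (if e j = 0 then 0 else koszul_sign j e * \<phi> (e(j := e j - 1)))"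

lemma monomial_shift_anticommute:
  assumes "1 \<le> i" "i < j"
  shows "monomial_shift i (monomial_shift j \<phi>) e + monomial_shift j (monomial_shift i \<phi>) e = 0"
proof (cases "e i = 0 \<or> e j = 0")
  case True
  then show ?thesis using assms by (auto simp: monomial_shift_def)
next
  case False
  then have ei: "e i \<noteq> 0" and ej: "e j \<noteq> 0" by auto
  have "koszul_sign j e = - koszul_sign j (e(i := e i - 1))"
    using koszul_sign_upd_Suc[OF assms, of e "e i - 1"] ei by simp
  then show ?thesis
    using assms ei ej by (simp add: monomial_shift_def koszul_sign_upd_ge fun_upd_twist)
qed

lemma skew_family_monomial_shift: "skew_family TYPE('n::finite) monomial_shift"
  unfolding skew_family_def
proof (intro conjI ballI allI impI)
  fix i :: nat and u v
  show "monomial_shift i (u + v) = monomial_shift i u + monomial_shift i v"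
    by (simp add: monomial_shift_def fun_eq_iff algebra_simps)
next
  fix i j :: nat and v
  assume "i \<in> {1..CARD('n)}" "j \<in> {1..CARD('n)}" "i \<noteq> j"
  then show "monomial_shift i (monomial_shift j v) + monomial_shift j (monomial_shift i v) = 0"
    using monomial_shift_anticommute[of i j v] monomial_shift_anticommute[of j i v]
    by (cases "i < j") (auto simp: fun_eq_iff add.commute)
qed

definition mono_coeff :: "'n::finite skew_pol \<Rightarrow> (nat \<Rightarrow> nat) \<Rightarrow> int" where
  "mono_coeff f = skew_act monomial_shift f (\<lambda>e. if e = (\<lambda>_. 0) then 1 else 0)"

lemma mono_coeff_simps:
  fixes f g :: "'n::finite skew_pol"
  shows "mono_coeff (0 :: 'n skew_pol) e = 0"
    "mono_coeff (1 :: 'n skew_pol) e = (if e = (\<lambda>_. 0) then 1 else 0)"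
    "mono_coeff (- f) e = - mono_coeff f e"
    "mono_coeff (f + g) e = mono_coeff f e + mono_coeff g e"
    "j \<in> {1..CARD('n)} \<Longrightarrow> mono_coeff (X j * f) e = monomial_shift j (mono_coeff f) e"
  unfolding mono_coeff_def by (simp_all add: skew_act_simps[OF skew_family_monomial_shift])

definition monomial :: "(nat \<Rightarrow> nat) \<Rightarrow> 'n::finite skew_pol" where
  "monomial e = (\<Prod>i\<leftarrow>[1..<CARD('n) + 1]. X i ^ e i)"

lemma minus_one_power_commute: "x * (- 1) ^ k = (- 1) ^ k * (x :: 'a::ring_1)"
  by (cases "even k") simp_all

lemma X_mult_power:
  assumes "i \<in> {1..CARD('n)}" "j \<in> {1..CARD('n)}" "i \<noteq> j"
  shows "X j * X i ^ k = (- 1) ^ k * (X i ^ k * X j :: 'n::finite skew_pol)"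
proof (induction k)
  case (Suc k)
  have "X j * X i ^ Suc k = (X j * X i) * X i ^ k"
    by (simp add: mult.assoc)
  also have "(X j * X i :: 'n skew_pol) = - (X i * X j)"
    using X_anticommute[OF assms(2,1)] assms(3) by simp
  also have "- (X i * X j) * X i ^ k = - (X i * (X j * X i ^ k :: 'n skew_pol))"
    by (simp add: mult.assoc)
  also have "\<dots> = - (X i * (- 1) ^ k * (X i ^ k * X j))"
    by (simp only: Suc mult.assoc)
  also have "\<dots> = (- 1) ^ Suc k * (X i ^ Suc k * X j)"
    unfolding minus_one_power_commute by (simp add: mult.assoc)
  finally show ?case .
qed simp

lemma X_mult_prod_list:
  assumes "j \<in> {1..CARD('n)}" "set is \<subseteq> {1..CARD('n)} - {j}"
  shows "X j * (\<Prod>i\<leftarrow>is. X i ^ e i) =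
    (- 1) ^ (\<Sum>i\<leftarrow>is. e i) * ((\<Prod>i\<leftarrow>is. X i ^ e i) * X j :: 'n::finite skew_pol)"
  using assms(2)
proof (induction "is")
  case (Cons i "is")
  have IH: "X j * (\<Prod>i\<leftarrow>is. X i ^ e i) =
      (- 1) ^ (\<Sum>i\<leftarrow>is. e i) * ((\<Prod>i\<leftarrow>is. X i ^ e i) * X j :: 'n skew_pol)"
    using Cons by auto
  have "X j * (\<Prod>i\<leftarrow>i # is. X i ^ e i) = X j * X i ^ e i * (\<Prod>i\<leftarrow>is. X i ^ e i)"
    by (simp add: mult.assoc)
  also have "X j * X i ^ e i = (- 1) ^ e i * (X i ^ e i * X j :: 'n skew_pol)"
    using Cons.prems assms(1) by (intro X_mult_power) auto
  also have "(- 1) ^ e i * (X i ^ e i * X j) * (\<Prod>i\<leftarrow>is. X i ^ e i) =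
      (- 1) ^ e i * X i ^ e i * (X j * (\<Prod>i\<leftarrow>is. X i ^ e i) :: 'n skew_pol)"
    by (simp add: mult.assoc)
  also have "\<dots> = (- 1) ^ e i * (X i ^ e i * (- 1) ^ (\<Sum>i\<leftarrow>is. e i)) *
      ((\<Prod>i\<leftarrow>is. X i ^ e i) * X j)"
    by (simp only: IH mult.assoc)
  also have "\<dots> = (- 1) ^ (\<Sum>i\<leftarrow>i # is. e i) * ((\<Prod>i\<leftarrow>i # is. X i ^ e i) * X j)"
    unfolding minus_one_power_commute[of "X i ^ e i"] by (simp add: mult.assoc power_add)
  finally show ?case .
qed simp

lemma upt_split3: "1 \<le> j \<Longrightarrow> j \<le> n \<Longrightarrow> [1..<n + 1] = [1..<j] @ j # [j + 1..<n + 1]"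
  using upt_add_eq_append[of 1 j "n + 1 - j"] by (simp add: upt_conv_Cons)

lemma X_mult_monomial:
  assumes "j \<in> {1..CARD('n)}"
  shows "X j * monomial e = of_int (koszul_sign j e) * (monomial (e(j := Suc (e j))) :: 'n::finite skew_pol)"
proof -
  let ?A = "\<Prod>i\<leftarrow>[1..<j]. X i ^ e i :: 'n skew_pol"
  let ?B = "\<Prod>i\<leftarrow>[j + 1..<CARD('n) + 1]. X i ^ e i :: 'n skew_pol"
  have s: "[1..<CARD('n) + 1] = [1..<j] @ j # [j + 1..<CARD('n) + 1]"
    using assms by (intro upt_split3) auto
  have "monomial (e(j := Suc (e j))) = (\<Prod>i\<leftarrow>[1..<j]. X i ^ (e(j := Suc (e j))) i) * (X j ^ Suc (e j) *
      (\<Prod>i\<leftarrow>[j + 1..<CARD('n) + 1]. X i ^ (e(j := Suc (e j))) i) :: 'n skew_pol)"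
    unfolding monomial_def s by simp
  also have "(\<Prod>i\<leftarrow>[1..<j]. X i ^ (e(j := Suc (e j))) i :: 'n skew_pol) = ?A"
    by (intro arg_cong[where f = prod_list] map_cong) auto
  also have "(\<Prod>i\<leftarrow>[j + 1..<CARD('n) + 1]. X i ^ (e(j := Suc (e j))) i :: 'n skew_pol) = ?B"
    by (intro arg_cong[where f = prod_list] map_cong) auto
  finally have eq: "monomial (e(j := Suc (e j))) = ?A * (X j ^ Suc (e j) * ?B)" .
  have "X j * monomial e = (X j * ?A) * (X j ^ e j * ?B)"
    unfolding monomial_def s by (simp add: mult.assoc)
  also have "X j * ?A = (- 1) ^ (\<Sum>i\<leftarrow>[1..<j]. e i) * (?A * X j)"
    using assms by (intro X_mult_prod_list) auto
  also have "(- 1) ^ (\<Sum>i\<leftarrow>[1..<j]. e i) = (of_int (koszul_sign j e) :: 'n skew_pol)"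
    by (simp add: koszul_sign_def interv_sum_list_conv_sum_set_nat)
  finally show ?thesis unfolding eq by (simp add: mult.assoc)
qed

text \<open>
  The set of \<open>f\<close> with this property is closed under left multiplication by \<open>x\<^sub>i\<close>, because increasing
  the exponent of \<open>i\<close> is injective and costs the same sign on coefficients and on monomials.
\<close>

lemma monomial_expansion:
  fixes f :: "'n::finite skew_pol"
  shows "finite {e. mono_coeff f e \<noteq> 0} \<and> f = (\<Sum>e | mono_coeff f e \<noteq> 0. of_int (mono_coeff f e) * monomial e)"
proof (induction f rule: skew_pol_induct)
  case zero
  show ?case by (simp add: mono_coeff_simps)
next
  case one
  have "{e. mono_coeff (1 :: 'n skew_pol) e \<noteq> 0} = {\<lambda>_. 0}" by (auto simp: mono_coeff_simps)
  moreover have "monomial (\<lambda>_. 0) = (1 :: 'n skew_pol)"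
    unfolding monomial_def by (induction "[1..<CARD('n) + 1]") (simp_all add: map_replicate_const)
  ultimately show ?case by (simp add: mono_coeff_simps)
next
  case (uminus f)
  then have "- f = - (\<Sum>e | mono_coeff f e \<noteq> 0. of_int (mono_coeff f e) * monomial e)" by simp
  with uminus show ?case by (simp add: mono_coeff_simps sum_negf)
next
  case (add f g)
  let ?E = "{e. mono_coeff f e \<noteq> 0} \<union> {e. mono_coeff g e \<noteq> 0}"
  have fin: "finite ?E" using add by auto
  have sub: "{e. mono_coeff (f + g) e \<noteq> 0} \<subseteq> ?E" by (auto simp: mono_coeff_simps)
  have ext: "(\<Sum>e | mono_coeff h e \<noteq> 0. of_int (mono_coeff h e) * monomial e) =
      (\<Sum>e\<in>?E. of_int (mono_coeff h e) * monomial e :: 'n skew_pol)"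
    if "{e. mono_coeff h e \<noteq> 0} \<subseteq> ?E" for h :: "'n skew_pol"
    using that fin by (intro sum.mono_neutral_left) auto
  have "f + g = (\<Sum>e\<in>?E. of_int (mono_coeff f e) * monomial e) + (\<Sum>e\<in>?E. of_int (mono_coeff g e) * monomial e)"
    using add ext[of f] ext[of g] by auto
  also have "\<dots> = (\<Sum>e\<in>?E. of_int (mono_coeff (f + g) e) * monomial e)"
    by (simp add: mono_coeff_simps semiring_class.distrib_right sum.distrib)
  finally show ?case using ext[OF sub] finite_subset[OF sub fin] by simp
next
  case (X_mult i f)
  define up where "up e = e(i := Suc (e i))" for e :: "nat \<Rightarrow> nat"
  have mono_coeff_up: "mono_coeff (X i * f) (up e) = koszul_sign i e * mono_coeff f e" for e
    using X_mult by (simp add: mono_coeff_simps monomial_shift_def up_def koszul_sign_upd_ge)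
  have inj: "inj up"
    by (rule inj_on_inverseI[of _ "\<lambda>e. e(i := e i - 1)"]) (simp add: up_def)
  have supp: "{e. mono_coeff (X i * f) e \<noteq> 0} = up ` {e. mono_coeff f e \<noteq> 0}"
  proof (intro equalityI subsetI)
    fix e assume e: "e \<in> {e. mono_coeff (X i * f) e \<noteq> 0}"
    then have "e i \<noteq> 0" "mono_coeff f (e(i := e i - 1)) \<noteq> 0"
      using X_mult by (auto simp: mono_coeff_simps monomial_shift_def split: if_splits)
    then show "e \<in> up ` {e. mono_coeff f e \<noteq> 0}"
      by (intro image_eqI[of _ _ "e(i := e i - 1)"]) (auto simp: up_def)
  qed (auto simp: mono_coeff_up koszul_sign_def)
  have "X i * f = X i * (\<Sum>e | mono_coeff f e \<noteq> 0. of_int (mono_coeff f e) * monomial e)"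
    using X_mult by simp
  also have "\<dots> = (\<Sum>e | mono_coeff f e \<noteq> 0. of_int (mono_coeff (X i * f) (up e)) * monomial (up e))"
    unfolding sum_distrib_left
  proof (rule sum.cong)
    fix e
    have "X i * (of_int (mono_coeff f e) * monomial e) =
        of_int (mono_coeff f e) * (X i * monomial e :: 'n skew_pol)"
      by (metis mult.assoc mult_of_int_commute)
    also have "\<dots> = of_int (mono_coeff f e) * of_int (koszul_sign i e) * monomial (up e)"
      using X_mult_monomial[OF X_mult(1), of e] by (simp add: up_def mult.assoc)
    also have "\<dots> = of_int (mono_coeff (X i * f) (up e)) * monomial (up e)"
      by (simp add: mono_coeff_up mult.commute flip: of_int_mult)
    finally show "X i * (of_int (mono_coeff f e) * monomial e) =
        of_int (mono_coeff (X i * f) (up e)) * (monomial (up e) :: 'n skew_pol)" .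
  qed simp
  also have "\<dots> = (\<Sum>e\<in>up ` {e. mono_coeff f e \<noteq> 0}. of_int (mono_coeff (X i * f) e) * monomial e)"
    using inj by (subst sum.reindex) (auto intro: inj_on_subset)
  finally show ?case using X_mult supp by simp
qed

lemma mono_coeff_eq_0_imp_eq_0: "(\<And>e. mono_coeff f e = 0) \<Longrightarrow> f = 0"
  using monomial_expansion[of f] by simp

lemma torsion_free:
  assumes "of_nat m * f = (0 :: 'n::finite skew_pol)" "m \<noteq> 0"
  shows "f = 0"
proof (rule mono_coeff_eq_0_imp_eq_0)
  fix e
  have "mono_coeff (of_nat k * f) e = int k * mono_coeff f e" for k
    by (induction k) (simp_all add: mono_coeff_simps algebra_simps)
  from this[of m] show "mono_coeff f e = 0" using assms by (simp add: mono_coeff_simps)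
qed

lemma X_left_regular:
  assumes j: "j \<in> {1..CARD('n)}" and eq: "X j * f = (0 :: 'n::finite skew_pol)"
  shows "f = 0"
proof (rule mono_coeff_eq_0_imp_eq_0)
  fix e
  have "monomial_shift j (mono_coeff f) (e(j := Suc (e j))) = 0"
    using mono_coeff_simps(5)[OF j, of f] eq by (simp add: mono_coeff_simps)
  then show "mono_coeff f e = 0" by (simp add: monomial_shift_def koszul_sign_def)
qed

text \<open>
  If the product vanishes, trading two factors \<open>x\<^sub>i\<close> of a monomial for two factors \<open>x\<^sub>j\<close> does not change
  its coefficient, and a coefficient is zero as soon as fewer than two factors \<open>x\<^sub>i\<close> are left.
\<close>

lemma X_square_diff_left_regular:
  assumes i: "i \<in> {1..CARD('n)}" and j: "j \<in> {1..CARD('n)}" and "i \<noteq> j"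
    and eq: "(X i * X i - X j * X j) * f = (0 :: 'n::finite skew_pol)"
  shows "f = 0"
proof (rule mono_coeff_eq_0_imp_eq_0)
  have sq: "mono_coeff (X l * (X l * f)) e = (if e l < 2 then 0 else mono_coeff f (e(l := e l - 2)))"
    if "l \<in> {1..CARD('n)}" for l e
  proof -
    have "mono_coeff (X l * (X l * f)) e = monomial_shift l (mono_coeff (X l * f)) e"
      using that by (rule mono_coeff_simps)
    also have "mono_coeff (X l * f) = monomial_shift l (mono_coeff f)"
      using that by (auto simp: mono_coeff_simps)
    finally show ?thesis
      by (auto simp: monomial_shift_def koszul_sign_upd_ge numeral_2_eq_2 simp flip: mult.assoc)
  qed
  have "X i * (X i * f) = X j * (X j * f)" using eq by (simp add: algebra_simps)
  then have step: "mono_coeff f e = (if e i < 2 then 0 else mono_coeff f (e(j := e j + 2, i := e i - 2)))" for e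
    using sq[OF i, of "e(j := e j + 2)"] sq[OF j, of "e(j := e j + 2)"] \<open>i \<noteq> j\<close>
    by (simp split: if_splits)
  fix e
  show "mono_coeff f e = 0"
  proof (induction "e i" arbitrary: e rule: less_induct)
    case less
    show ?case using step[of e] less[of "e(j := e j + 2, i := e i - 2)"] by (cases "e i < 2") auto
  qed
qed

section \<open>The odd Demazure operators\<close>

definition twist :: "nat \<Rightarrow> 'n::finite skew_pol \<Rightarrow> 'n skew_pol" where
  "twist i = (if i < CARD('n) then endo_A i else endo_B)"

lemma X_anticommute_sum:
  assumes "i \<in> {1..CARD('n)}" "j \<in> {1..CARD('n)}" "i \<noteq> j"
  shows "X i * X j + X j * X i = (0 :: 'n::finite skew_pol)"
  using X_anticommute[OF assms] by simp

lemma endo_A: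
  assumes "i \<in> {1..<CARD('n)}"
  shows "alg_endo (endo_A i :: 'n::finite skew_pol \<Rightarrow> 'n skew_pol)" (is ?A)
    and "j \<in> {1..CARD('n)} \<Longrightarrow> endo_A i (X j :: 'n skew_pol) =
      (if j = i then - X (i + 1) else if j = i + 1 then - X i else - X j)" (is "PROP ?B")
proof -
  let ?P = "\<lambda>h. alg_endo h \<and> (\<forall>j\<in>{1..CARD('n)}. h (X j :: 'n skew_pol) =
     (if j = i then - X (i + 1) else if j = i + 1 then - X i else - X j))"
  have "\<exists>!h. ?P h"
    using assms by (intro alg_endo_ex1) (auto intro!: X_anticommute simp: X_anticommute_sum)
  then have "?P (endo_A i)" unfolding endo_A_def by (rule theI')
  then show ?A and "PROP ?B" by blast+
qed

lemma endo_B: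
  shows "alg_endo (endo_B :: 'n::finite skew_pol \<Rightarrow> 'n skew_pol)" (is ?A)
    and "j \<in> {1..CARD('n)} \<Longrightarrow> endo_B (X j :: 'n skew_pol) = - X j" (is "PROP ?B")
proof -
  let ?P = "\<lambda>h. alg_endo h \<and> (\<forall>j\<in>{1..CARD('n)}. h (X j :: 'n skew_pol) = - X j)"
  have "\<exists>!h. ?P h"
    by (intro alg_endo_ex1) (auto intro!: X_anticommute simp: X_anticommute_sum)
  then have "?P endo_B" unfolding endo_B_def by (rule theI')
  then show ?A and "PROP ?B" by blast+
qed

lemma twist_X:
  assumes "i \<in> {1..CARD('n)}" "j \<in> {1..CARD('n)}"
  shows "twist i (X j :: 'n::finite skew_pol) =
    - X (if i < CARD('n) then transpose i (i + 1) j else j)"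
  using assms by (auto simp: twist_def endo_A endo_B Transposition.transpose_def)

lemma demazure_A:
  assumes "i \<in> {1..<CARD('n)}"
  shows "twisted_derivation (endo_A i) (demazure_A i :: 'n::finite skew_pol \<Rightarrow> 'n skew_pol)" (is ?A)
    and "j \<in> {1..CARD('n)} \<Longrightarrow> demazure_A i (X j :: 'n skew_pol) = (if j \<in> {i, i + 1} then 1 else 0)"
      (is "PROP ?B")
proof -
  let ?P = "\<lambda>D. twisted_derivation (endo_A i) D \<and> (\<forall>j\<in>{1..CARD('n)}.
     D (X j :: 'n skew_pol) = (if j \<in> {i, i + 1} then 1 else 0))"
  have "\<exists>!D. ?P D"
    using assms by (intro twisted_derivation_ex1) (auto simp: endo_A)
  then have "?P (demazure_A i)" unfolding demazure_A_def by (rule theI')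
  then show ?A and "PROP ?B" by blast+
qed

lemma demazure_B:
  shows "twisted_derivation endo_B (demazure_B :: 'n::finite skew_pol \<Rightarrow> 'n skew_pol)" (is ?A)
    and "j \<in> {1..CARD('n)} \<Longrightarrow> demazure_B (X j :: 'n skew_pol) = (if j = CARD('n) then 1 else 0)"
      (is "PROP ?B")
proof -
  let ?P = "\<lambda>D. twisted_derivation endo_B D \<and> (\<forall>j\<in>{1..CARD('n)}.
     D (X j :: 'n skew_pol) = (if j = CARD('n) then 1 else 0))"
  have "\<exists>!D. ?P D"
    by (intro twisted_derivation_ex1) (auto simp: endo_B)
  then have "?P demazure_B" unfolding demazure_B_def by (rule theI')
  then show ?A and "PROP ?B" by blast+
qed

lemma twisted_derivation_demazure:
  assumes "i \<in> {1..CARD('n)}"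
  shows "twisted_derivation (twist i) (demazure i :: 'n::finite skew_pol \<Rightarrow> 'n skew_pol)"
  using assms demazure_A(1)[of i] demazure_B(1) by (auto simp: twist_def demazure_def)

lemmas demazure_mult = twisted_derivationD(3)[OF twisted_derivation_demazure]

lemmas demazure_additive = twisted_derivationD(1,2,4-6)[OF twisted_derivation_demazure]

lemma demazure_X:
  assumes "i \<in> {1..CARD('n)}" "j \<in> {1..CARD('n)}"
  shows "demazure i (X j :: 'n::finite skew_pol) = (if j = i \<or> i < CARD('n) \<and> j = i + 1 then 1 else 0)"
  using assms by (auto simp: demazure_def demazure_A demazure_B)

lemma demazure_X_mult:
  assumes "i \<in> {1..CARD('n)}" "j \<in> {1..CARD('n)}"
  shows "demazure i (X j * f :: 'n::finite skew_pol) =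
    (if j = i \<or> i < CARD('n) \<and> j = i + 1 then f else 0) -
    X (if i < CARD('n) then transpose i (i + 1) j else j) * demazure i f"
  using assms by (simp add: demazure_mult twist_X demazure_X)

lemma demazure_A_X_mult:
  fixes f :: "'n::finite skew_pol"
  assumes "1 \<le> i" "i < CARD('n)"
  shows "demazure i (X i * f) = f - X (Suc i) * demazure i f"
    "demazure i (X (Suc i) * f) = f - X i * demazure i f"
    "j \<in> {1..CARD('n)} \<Longrightarrow> j \<noteq> i \<Longrightarrow> j \<noteq> Suc i \<Longrightarrow> demazure i (X j * f) = - (X j * demazure i f)"
  using assms demazure_X_mult[of i _ f] by auto

lemma demazure_B_X_mult:
  fixes f :: "'n::finite skew_pol"
  shows "demazure CARD('n) (X CARD('n) * f) = f - X CARD('n) * demazure CARD('n) f"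
    "j \<in> {1..CARD('n)} \<Longrightarrow> j \<noteq> CARD('n) \<Longrightarrow>
      demazure CARD('n) (X j * f) = - (X j * demazure CARD('n) f)"
  using demazure_X_mult[of "CARD('n)" _ f] by auto

section \<open>The nilHecke relations\<close>

text \<open>
  Every relation between Demazure operators below is verified in this way: the Leibniz rule shows that
  the difference \<open>T\<close> of the two sides can be moved past a generator, after which only \<open>T 1\<close> matters.
\<close>

lemma semilinear_operator_eq_0:
  fixes T :: "'n::finite skew_pol \<Rightarrow> 'n skew_pol"
  assumes add: "\<And>f g. T (f + g) = T f + T g" and one: "T 1 = 0"
    and X: "\<And>k f. k \<in> {1..CARD('n)} \<Longrightarrow> \<exists>g. T (X k * f) = g * T f"
  shows "T f = 0"
proof (induction f rule: skew_pol_induct)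
  case zero
  show ?case using add[of 0 0] by simp
next
  case (uminus f)
  have "T 0 = 0" using add[of 0 0] by simp
  then show ?case using add[of f "- f"] uminus by simp
next
  case (X_mult i f)
  then show ?case using X[of i f] by auto
qed (simp_all add: add one)

lemma demazure_square:
  assumes i: "i \<in> {1..CARD('n)}"
  shows "demazure i (demazure i f) = (0 :: 'n::finite skew_pol)"
proof (rule semilinear_operator_eq_0[of "\<lambda>f. demazure i (demazure i f)"])
  fix k and f :: "'n skew_pol"
  assume k: "k \<in> {1..CARD('n)}"
  have "demazure i (demazure i (X k * f)) = X k * demazure i (demazure i f)"
  proof (cases "i < CARD('n)")
    case True
    then show ?thesis using i k
      by (cases "k = i"; cases "k = Suc i") (simp_all add: demazure_A_X_mult demazure_additive)
  next
    case False
    then have "i = CARD('n)" using i by simp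
    then show ?thesis using k
      by (cases "k = CARD('n)") (simp_all add: demazure_B_X_mult demazure_additive)
  qed
  then show "\<exists>g. demazure i (demazure i (X k * f)) = g * demazure i (demazure i f)" ..
qed (use i in \<open>simp_all add: demazure_additive\<close>)

lemma demazure_far_commute:
  assumes i: "1 \<le> i" and ij: "i + 2 \<le> j" and j: "j \<le> CARD('n)"
  shows "demazure i (demazure j f) = - demazure j (demazure i f :: 'n::finite skew_pol)"
proof -
  let ?T = "\<lambda>f :: 'n skew_pol. demazure i (demazure j f) + demazure j (demazure i f)"
  have "?T f = 0"
  proof (rule semilinear_operator_eq_0[of ?T])
    fix k and f :: "'n skew_pol"
    assume k: "k \<in> {1..CARD('n)}"
    \<comment> \<open>the index to which the product of the two transpositions moves \<open>k\<close>\<close>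
    define k' where "k' = (if k = i then Suc i else if k = Suc i then i else
      if j < CARD('n) \<and> k = j then Suc j else if j < CARD('n) \<and> k = Suc j then j else k)"
    have "?T (X k * f) = X k' * ?T f"
    proof (cases "j < CARD('n)")
      case True
      consider "k = i" | "k = Suc i" | "k = j" | "k = Suc j" | "k \<notin> {i, Suc i, j, Suc j}" by auto
      then show ?thesis using k i ij j True
        by cases (simp_all add: k'_def demazure_A_X_mult demazure_additive algebra_simps)
    next
      case False
      then have j: "j = CARD('n)" using j by simp
      consider "k = i" | "k = Suc i" | "k = CARD('n)" | "k \<notin> {i, Suc i, CARD('n)}" by auto
      then show ?thesis using k i ij unfolding j
        by cases (simp_all add: k'_def j demazure_A_X_mult demazure_B_X_mult demazure_additive algebra_simps)
    qed
    then show "\<exists>g. ?T (X k * f) = g * ?T f" ..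
  qed (use i ij j in \<open>simp_all add: demazure_additive\<close>)
  then show ?thesis by (simp add: eq_neg_iff_add_eq_0)
qed

lemma demazure_braid_3:
  assumes i: "1 \<le> i" "Suc i < CARD('n)"
  shows "demazure i (demazure (Suc i) (demazure i f)) =
    demazure (Suc i) (demazure i (demazure (Suc i) f) :: 'n::finite skew_pol)"
proof -
  let ?T = "\<lambda>f :: 'n skew_pol. demazure i (demazure (Suc i) (demazure i f)) -
    demazure (Suc i) (demazure i (demazure (Suc i) f))"
  have "?T f = 0"
  proof (rule semilinear_operator_eq_0[of ?T])
    fix k and f :: "'n skew_pol"
    assume k: "k \<in> {1..CARD('n)}"
    define k' where "k' = (if k = i then Suc (Suc i) else if k = Suc (Suc i) then i else k)"
    consider "k = i" | "k = Suc i" | "k = Suc (Suc i)" | "k \<notin> {i, Suc i, Suc (Suc i)}" by auto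
    then have "?T (X k * f) = - X k' * ?T f" using k i
      by cases (simp_all add: k'_def demazure_A_X_mult demazure_additive demazure_square algebra_simps)
    then show "\<exists>g. ?T (X k * f) = g * ?T f" ..
  qed (use i in \<open>simp_all add: demazure_additive\<close>)
  then show ?thesis by simp
qed

text \<open>
  The sign is forced: on \<open>x\<^sub>m\<^sup>3 x\<^sub>m\<^sub>+\<^sub>1\<close> the product with the last operator as its rightmost factor gives \<open>1\<close>,
  the other one gives \<open>-1\<close>.
\<close>

lemma demazure_braid_4:
  assumes m: "1 \<le> m" "Suc m = CARD('n)"
  shows "demazure m (demazure (Suc m) (demazure m (demazure (Suc m) f))) =
    - demazure (Suc m) (demazure m (demazure (Suc m) (demazure m f)) :: 'n::finite skew_pol)"
proof -
  let ?T = "\<lambda>f :: 'n skew_pol. demazure m (demazure (Suc m) (demazure m (demazure (Suc m) f))) +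
    demazure (Suc m) (demazure m (demazure (Suc m) (demazure m f)))"
  have B: "demazure (Suc m) (X (Suc m) * f) = f - X (Suc m) * demazure (Suc m) f"
    "j \<in> {1..CARD('n)} \<Longrightarrow> j \<noteq> Suc m \<Longrightarrow> demazure (Suc m) (X j * f) = - (X j * demazure (Suc m) f)"
    for j and f :: "'n skew_pol"
    unfolding m(2) by (rule demazure_B_X_mult; simp)+
  have less: "m < CARD('n)" using m by simp
  have "?T f = 0"
  proof (rule semilinear_operator_eq_0[of ?T])
    fix k and f :: "'n skew_pol"
    assume k: "k \<in> {1..CARD('n)}"
    consider "k = m" | "k = Suc m" | "k \<notin> {m, Suc m}" by auto
    then have "?T (X k * f) = X k * ?T f" using k m(1) less
      by cases (simp_all add: demazure_A_X_mult B demazure_additive demazure_square algebra_simps)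
    then show "\<exists>g. ?T (X k * f) = g * ?T f" ..
  qed (use m(1) less in \<open>simp_all add: demazure_additive\<close>)
  then show ?thesis by (simp add: eq_neg_iff_add_eq_0)
qed

section \<open>Sign changes and the centre\<close>

text \<open>
  The elements fixed by \<open>sign_change {j}\<close> are those that are even in \<open>x\<^sub>j\<close>.
\<close>

definition sign_change :: "nat set \<Rightarrow> 'n::finite skew_pol \<Rightarrow> 'n skew_pol" where
  "sign_change S = (THE h. alg_endo h \<and> (\<forall>j\<in>{1..CARD('n)}. h (X j) = (if j \<in> S then - X j else X j)))"

lemma sign_change:
  shows "alg_endo (sign_change S :: 'n::finite skew_pol \<Rightarrow> 'n skew_pol)" (is ?A)
    and "j \<in> {1..CARD('n)} \<Longrightarrow> sign_change S (X j :: 'n skew_pol) = (if j \<in> S then - X j else X j)"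
      (is "PROP ?B")
proof -
  let ?P = "\<lambda>h. alg_endo h \<and> (\<forall>j\<in>{1..CARD('n)}. h (X j :: 'n skew_pol) = (if j \<in> S then - X j else X j))"
  have "\<exists>!h. ?P h"
  proof (rule alg_endo_ex1)
    fix i j assume "i \<in> {1..CARD('n)}" "j \<in> {1..CARD('n)}" "i \<noteq> j"
    from X_anticommute[OF this]
    show "(if i \<in> S then - X i else X i) * (if j \<in> S then - X j else X j) +
        (if j \<in> S then - X j else X j) * (if i \<in> S then - X i else X i) = (0 :: 'n skew_pol)"
      by simp
  qed
  then have "?P (sign_change S)" unfolding sign_change_def by (rule theI')
  then show ?A and "PROP ?B" by blast+
qed

lemma alg_endo_comp: "alg_endo h \<Longrightarrow> alg_endo k \<Longrightarrow> alg_endo (\<lambda>f. h (k f))"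
  by (simp add: alg_endo_def)

lemma alg_endo_id: "alg_endo (\<lambda>f. f)"
  by (simp add: alg_endo_def)

lemmas endo_simps = alg_endoD[OF sign_change(1)] alg_endoD[OF endo_B(1)] alg_endoD[OF endo_A(1)]
  sign_change(2) endo_B(2) endo_A(2)

lemma sign_change_involution: "sign_change S (sign_change S f) = (f :: 'n::finite skew_pol)"
proof -
  have "(\<lambda>f. sign_change S (sign_change S f)) = (\<lambda>f :: 'n skew_pol. f)"
    by (rule alg_endo_unique[OF alg_endo_comp[OF sign_change(1) sign_change(1)] alg_endo_id])
      (simp add: endo_simps)
  then show ?thesis by metis
qed

lemma sign_change_commute:
  "sign_change S (sign_change S' f) = sign_change S' (sign_change S f :: 'n::finite skew_pol)"
proof -
  have "(\<lambda>f. sign_change S (sign_change S' f)) = (\<lambda>f :: 'n skew_pol. sign_change S' (sign_change S f))"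
    by (rule alg_endo_unique[OF alg_endo_comp[OF sign_change(1) sign_change(1)]
          alg_endo_comp[OF sign_change(1) sign_change(1)]])
      (simp add: endo_simps)
  then show ?thesis by metis
qed

lemma sign_change_insert:
  assumes "j \<notin> S"
  shows "sign_change (insert j S) f = sign_change {j} (sign_change S f :: 'n::finite skew_pol)"
proof -
  have "sign_change (insert j S) = (\<lambda>f :: 'n skew_pol. sign_change {j} (sign_change S f))"
    using assms by (intro alg_endo_unique[OF sign_change(1) alg_endo_comp[OF sign_change(1) sign_change(1)]])
      (auto simp: endo_simps)
  then show ?thesis by metis
qed

lemma endo_B_eq_sign_change: "endo_B = (sign_change {1..CARD('n)} :: 'n::finite skew_pol \<Rightarrow> 'n skew_pol)"
  by (intro alg_endo_unique[OF endo_B(1) sign_change(1)]) (simp add: endo_simps)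

text \<open>
  The total parity automorphism is the composition of the sign changes of the single variables.
\<close>

lemma endo_B_fixed:
  assumes "\<And>j. j \<in> {1..CARD('n)} \<Longrightarrow> sign_change {j} f = f"
  shows "endo_B f = (f :: 'n::finite skew_pol)"
proof -
  have "S \<subseteq> {1..CARD('n)} \<Longrightarrow> sign_change S f = f" if "finite S" for S
    using that
  proof (induction S)
    case empty
    have "sign_change {} = (\<lambda>f :: 'n skew_pol. f)"
      by (rule alg_endo_unique[OF sign_change(1) alg_endo_id]) (simp add: endo_simps)
    then show ?case by metis
  next
    case (insert j S)
    then show ?case using assms sign_change_insert[OF insert.hyps(2), of f] by simp
  qed
  then show ?thesis by (simp add: endo_B_eq_sign_change)
qed

text \<open>
  Moving \<open>x\<^sub>j\<close> through a monomial costs one sign for each letter other than \<open>x\<^sub>j\<close>.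
\<close>

lemma X_conjugation:
  assumes j: "j \<in> {1..CARD('n)}"
  shows "X j * f = endo_B (sign_change {j} f) * (X j :: 'n::finite skew_pol)"
proof (induction f rule: skew_pol_induct)
  case (add f g)
  then show ?case by (simp add: endo_simps algebra_simps)
next
  case (X_mult i f)
  show ?case
  proof (cases "i = j")
    case True
    have "endo_B (sign_change {j} (X j * f)) = X j * endo_B (sign_change {j} f)"
      using j by (simp add: endo_simps)
    then show ?thesis by (simp only: True X_mult(2) mult.assoc)
  next
    case False
    have "X j * (X i * f) = X j * X i * f" by (simp add: mult.assoc)
    also have "X j * X i = (- (X i * X j) :: 'n skew_pol)"
      using X_anticommute[of j i] X_mult(1) j False by auto
    also have "- (X i * X j) * f = - X i * (X j * f)" by (simp add: mult.assoc)
    finally show ?thesis using X_mult False by (simp add: endo_simps mult.assoc)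
  qed
qed (simp_all add: endo_simps)

lemma X_right_regular:
  assumes j: "j \<in> {1..CARD('n)}" and eq: "f * X j = (0 :: 'n::finite skew_pol)"
  shows "f = 0"
proof -
  have "endo_B (sign_change {j} (endo_B (sign_change {j} f))) = f"
    unfolding endo_B_eq_sign_change
    by (simp add: sign_change_commute[of "{j}"] sign_change_involution)
  then have "X j * endo_B (sign_change {j} f) = 0"
    using X_conjugation[OF j, of "endo_B (sign_change {j} f)"] eq by simp
  then have "endo_B (sign_change {j} f) = 0" using X_left_regular[OF j] by blast
  then show ?thesis
    using \<open>endo_B (sign_change {j} (endo_B (sign_change {j} f))) = f\<close> by (simp add: endo_simps)
qed

lemma X_square_central:
  assumes j: "j \<in> {1..CARD('n)}"
  shows "X j * X j * f = f * (X j * X j :: 'n::finite skew_pol)"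
proof -
  have "X j * (X j * f) = X j * (endo_B (sign_change {j} f) * X j)"
    by (subst X_conjugation[OF j, of f]) simp
  also have "\<dots> = endo_B (sign_change {j} (endo_B (sign_change {j} f))) * X j * X j"
    by (subst mult.assoc[symmetric], subst X_conjugation[OF j]) simp
  also have "endo_B (sign_change {j} (endo_B (sign_change {j} f))) = f"
    unfolding endo_B_eq_sign_change
    by (simp add: sign_change_commute[of "{j}"] sign_change_involution)
  finally show ?thesis by (simp add: mult.assoc)
qed

text \<open>
  For every element \<open>a\<close>, the map \<open>f \<mapsto> a f - s(f) a\<close> is a derivation twisted by \<open>s\<close>. For
  \<open>a = x\<^sub>i\<^sub>+\<^sub>1 - x\<^sub>i\<close> it takes the same values on the generators as the Demazure operator multiplied by
  the central element \<open>x\<^sub>i\<^sub>+\<^sub>1\<^sup>2 - x\<^sub>i\<^sup>2\<close>.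
\<close>

lemma demazure_A_inner:
  assumes i: "i \<in> {1..<CARD('n)}"
  shows "(X (i + 1) * X (i + 1) - X i * X i) * demazure_A i f =
    (X (i + 1) - X i) * f - endo_A i f * (X (i + 1) - X i :: 'n::finite skew_pol)"
proof (induction f rule: skew_pol_induct)
  case zero
  then show ?case using i by (simp add: twisted_derivationD[OF demazure_A(1)] endo_simps)
next
  case one
  then show ?case using i by (simp add: twisted_derivationD[OF demazure_A(1)] endo_simps)
next
  case (uminus f)
  then show ?case using i by (simp add: twisted_derivationD[OF demazure_A(1)] endo_simps)
next
  case (add f g)
  have "c * demazure_A i (f + g) = c * demazure_A i f + c * demazure_A i g" for c
    using i by (simp add: twisted_derivationD[OF demazure_A(1)] semiring_class.distrib_left)
  then show ?case using i by (simp only: add) (simp add: endo_simps algebra_simps)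
next
  case (X_mult k f)
  let ?a = "X (i + 1) - X i :: 'n skew_pol" and ?z = "X (i + 1) * X (i + 1) - X i * X i :: 'n skew_pol"
  have central: "?z * g = g * ?z" for g
    using i X_square_central[of i g] X_square_central[of "i + 1" g] by (simp add: algebra_simps)
  have gen: "?a * X k - endo_A i (X k) * ?a = ?z * demazure_A i (X k)"
    using X_mult(1) i X_anticommute[of i "i + 1", where 'n = 'n]
      X_anticommute[of k "i + 1", where 'n = 'n] X_anticommute[of k i, where 'n = 'n]
    by (auto simp: demazure_A(2) endo_simps algebra_simps)
  have "?z * demazure_A i (X k * f) = ?z * demazure_A i (X k) * f + ?z * endo_A i (X k) * demazure_A i f"
    using i by (simp add: twisted_derivationD[OF demazure_A(1)] algebra_simps)
  also have "\<dots> = (?a * X k - endo_A i (X k) * ?a) * f + endo_A i (X k) * (?z * demazure_A i f)"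
    unfolding gen central[of "endo_A i (X k)"] by (simp only: mult.assoc)
  also have "\<dots> = ?a * (X k * f) - endo_A i (X k * f) * ?a"
    unfolding X_mult(2) using i by (simp add: endo_simps algebra_simps)
  finally show ?case .
qed

text \<open>
  The same comparison for \<open>a = x\<^sub>n\<close>, where the central element is \<open>2 x\<^sub>n\<^sup>2\<close>.
\<close>

lemma demazure_B_inner:
  "(X CARD('n) * X CARD('n) + X CARD('n) * X CARD('n)) * demazure_B f =
    X CARD('n) * f - endo_B f * (X CARD('n) :: 'n::finite skew_pol)"
proof (induction f rule: skew_pol_induct)
  case (X_mult k f)
  let ?a = "X CARD('n) :: 'n skew_pol"
  have central: "(?a * ?a + ?a * ?a) * g = g * (?a * ?a + ?a * ?a)" for g
    using X_square_central[of "CARD('n)" g] by (simp add: algebra_simps)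
  have gen: "?a * X k - endo_B (X k) * ?a = (?a * ?a + ?a * ?a) * demazure_B (X k)"
    using X_mult(1) X_anticommute[of k "CARD('n)", where 'n = 'n]
    by (auto simp: demazure_B(2) endo_simps algebra_simps)
  have "(?a * ?a + ?a * ?a) * demazure_B (X k * f) = (?a * ?a + ?a * ?a) * demazure_B (X k) * f +
      (?a * ?a + ?a * ?a) * endo_B (X k) * demazure_B f"
    by (simp add: twisted_derivationD[OF demazure_B(1)] algebra_simps)
  also have "\<dots> = (?a * X k - endo_B (X k) * ?a) * f + endo_B (X k) * ((?a * ?a + ?a * ?a) * demazure_B f)"
    unfolding gen central[of "endo_B (X k)"] by (simp only: mult.assoc)
  also have "\<dots> = ?a * (X k * f) - endo_B (X k * f) * ?a"
    unfolding X_mult(2) by (simp add: endo_simps algebra_simps)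
  finally show ?case .
next
  case (add f g)
  have "c * demazure_B (f + g) = c * demazure_B f + c * demazure_B g" for c :: "'n skew_pol"
    by (simp add: twisted_derivationD[OF demazure_B(1)] semiring_class.distrib_left)
  then show ?case by (simp only: add) (simp add: endo_simps algebra_simps)
qed (simp_all add: twisted_derivationD[OF demazure_B(1)] endo_simps)

text \<open>
  For \<open>f\<close> in the kernel, the inner form of the operator and the conjugation rule are two ways to move
  \<open>x\<^sub>n\<close> to the right of \<open>f\<close>; they differ by the sign change of \<open>x\<^sub>n\<close>.
\<close>

lemma demazure_B_kernel_even:
  assumes "demazure_B f = (0 :: 'n::finite skew_pol)"
  shows "sign_change {CARD('n)} f = f"
proof -
  have "X CARD('n) * f = endo_B f * X CARD('n)"
    using demazure_B_inner[of f] assms by simp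
  then have "(endo_B (sign_change {CARD('n)} f) - endo_B f) * X CARD('n) = 0"
    using X_conjugation[of "CARD('n)" f] by (simp add: algebra_simps)
  then have "endo_B (sign_change {CARD('n)} f) - endo_B f = 0"
    by (rule X_right_regular[rotated]) simp
  then show ?thesis
    unfolding endo_B_eq_sign_change by (metis right_minus_eq sign_change_involution)
qed

text \<open>
  Put \<open>x = x\<^sub>i\<close>, \<open>y = x\<^sub>i\<^sub>+\<^sub>1\<close>, let \<open>\<epsilon>\<close> be the sign change of \<open>x\<close>, and let \<open>A\<close> and \<open>B\<close> be the images of
  \<open>f\<close> and \<open>\<epsilon> f\<close> under the total parity. For \<open>f\<close> in the kernel, \<open>(y - x) f = g (y - x)\<close> with \<open>g = s\<^sub>i f\<close>;
  as \<open>f\<close> is even in \<open>y\<close>, the element \<open>g\<close> is even in \<open>x\<close>, so that applying \<open>\<epsilon>\<close> yields a second equation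
  \<open>(y + x) \<epsilon> f = g (y + x)\<close>. After \<open>x\<close> and \<open>y\<close> are moved to the right, the two equations force
  \<open>A = g = B\<close>.
\<close>

lemma demazure_A_kernel_even:
  fixes f :: "'n::finite skew_pol"
  assumes i: "i \<in> {1..<CARD('n)}" and ker: "demazure_A i f = 0"
    and even: "sign_change {i + 1} f = f"
  shows "sign_change {i} f = f"
proof -
  define x y where "x = (X i :: 'n skew_pol)" and "y = (X (i + 1) :: 'n skew_pol)"
  define g A B where "g = endo_A i f" and "A = endo_B f" and "B = endo_B (sign_change {i} f)"
  have i1: "i \<in> {1..CARD('n)}" "i + 1 \<in> {1..CARD('n)}" using i by auto
  have rel: "(y - x) * f = g * (y - x)"
    using demazure_A_inner[OF i, of f] ker by (simp add: x_def y_def g_def)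
  have g: "sign_change {i} g = g"
  proof -
    have "(\<lambda>h. sign_change {i} (endo_A i h)) = (\<lambda>h :: 'n skew_pol. endo_A i (sign_change {i + 1} h))"
      using i by (intro alg_endo_unique[OF alg_endo_comp[OF sign_change(1) endo_A(1)]
            alg_endo_comp[OF endo_A(1) sign_change(1)]]) (auto simp: endo_simps)
    then show ?thesis unfolding g_def by (metis even)
  qed
  have yf: "y * f = A * y" and xf: "x * f = B * x"
    using X_conjugation[OF i1(1), of f] X_conjugation[OF i1(2), of f] even
    by (simp_all add: x_def y_def A_def B_def)
  have yf': "y * sign_change {i} f = B * y" and xf': "x * sign_change {i} f = A * x"
    using X_conjugation[OF i1(1), of "sign_change {i} f"]
      X_conjugation[OF i1(2), of "sign_change {i} f"] even
    by (simp_all add: x_def y_def A_def B_def sign_change_involution sign_change_commute[of "{Suc i}"])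
  have "sign_change {i} ((y - x) * f) = sign_change {i} (g * (y - x))" by (simp only: rel)
  then have rel': "(y + x) * sign_change {i} f = g * (y + x)"
    using i g by (simp add: endo_simps x_def y_def)
  \<comment> \<open>both equations with \<open>x\<close> and \<open>y\<close> moved to the right\<close>
  have 1: "(A - g) * y = (B - g) * x" using rel by (simp add: algebra_simps yf xf)
  have 2: "(B - g) * y = (g - A) * x" using rel' by (simp add: algebra_simps yf' xf')
  have xy: "x * y = - (y * x)" using i1 X_anticommute[of i "i + 1", where 'n = 'n] by (simp add: x_def y_def)
  \<comment> \<open>eliminating \<open>B - g\<close> leaves \<open>A - g\<close> times \<open>y\<^sup>2 - x\<^sup>2\<close>\<close>
  have "(A - g) * (y * y) = (B - g) * (x * y)" using 1 by (simp flip: mult.assoc)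
  also have "\<dots> = - ((B - g) * y) * x" by (simp add: xy mult.assoc)
  also have "\<dots> = (A - g) * (x * x)" unfolding 2 by (simp add: algebra_simps)
  finally have eq: "(A - g) * (y * y) = (A - g) * (x * x)" .
  have "(y * y - x * x) * h = h * (y * y) - h * (x * x)" for h
    using X_square_central[OF i1(1), of h] X_square_central[OF i1(2), of h]
    by (simp add: x_def y_def left_diff_distrib)
  then have "(y * y - x * x) * (A - g) = 0" by (simp only: eq) simp
  then have A: "A - g = 0"
    unfolding x_def y_def by (rule X_square_diff_left_regular[rotated 3]) (use i in auto)
  then have "(B - g) * X i = 0" using 1 by (simp add: x_def)
  then have "B - g = 0" by (rule X_right_regular[OF i1(1)])
  with A have "endo_B (sign_change {i} f) = endo_B f" by (simp add: A_def B_def)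
  then show ?thesis
    unfolding endo_B_eq_sign_change by (metis sign_change_involution)
qed

text \<open>
  The last operator makes \<open>f\<close> even in \<open>x\<^sub>n\<close>, and the other operators carry this down to \<open>x\<^sub>k\<close>.
\<close>

lemma demazure_kernel_even:
  fixes f :: "'n::finite skew_pol"
  assumes ker: "\<And>i. i \<in> {k..CARD('n)} \<Longrightarrow> demazure i f = 0" and k: "1 \<le> k"
    and j: "j \<in> {k..CARD('n)}"
  shows "sign_change {j} f = f"
proof -
  have "j \<le> CARD('n)" using j by simp
  then have "k \<le> j \<longrightarrow> sign_change {j} f = f"
  proof (induction rule: inc_induct)
    case base
    then show ?case using demazure_B_kernel_even[of f] ker[of "CARD('n)"] by (simp add: demazure_def)
  next
    case (step i)
    then show ?case using demazure_A_kernel_even[of i f] ker[of i] k by (simp add: demazure_def)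
  qed
  then show ?thesis using j by simp
qed

lemma sym_B_eq: "sym_B = {f :: 'n::finite skew_pol. \<forall>i\<in>{1..CARD('n)}. demazure i f = 0}"
proof -
  have "{1..CARD('n)} = insert CARD('n) {1..<CARD('n)}" by (auto simp: Suc_le_eq)
  then show ?thesis by (auto simp: sym_B_def demazure_def)
qed

text \<open>
  A symmetric polynomial is even in every variable, hence of even total parity, and then the two signs
  in the conjugation rule both disappear.
\<close>

lemma sym_B_central:
  assumes f: "f \<in> (sym_B :: 'n::finite skew_pol set)"
  shows "g * f = f * g"
proof -
  have even: "sign_change {j} f = f" if "j \<in> {1..CARD('n)}" for j
    using f that by (intro demazure_kernel_even[of 1]) (auto simp: sym_B_eq)
  then have "endo_B f = f" by (rule endo_B_fixed)
  with even have X: "X j * f = f * X j" if "j \<in> {1..CARD('n)}" for j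
    using X_conjugation[OF that, of f] that by simp
  show ?thesis
  proof (induction g rule: skew_pol_induct)
    case (X_mult j g)
    then show ?case using X by (simp add: mult.assoc) (simp flip: mult.assoc)
  qed (simp_all add: algebra_simps)
qed

section \<open>Homogeneous components\<close>

lemma homog_one: "1 \<in> homog 0"
  using homog.monom[of "[]" 0] by simp

lemma homog_X: "j \<in> {1..CARD('n)} \<Longrightarrow> (X j :: 'n::finite skew_pol) \<in> homog 2"
  using homog.monom[of "[j]" 2, where 'n = 'n] by simp

lemma homog_diff: "f \<in> homog d \<Longrightarrow> g \<in> homog d \<Longrightarrow> f - g \<in> homog d"
  using homog.add[of f d "- g"] homog.uminus[of g d] by simp

lemma homog_mult:
  assumes "f \<in> homog d" "g \<in> (homog d' :: 'n::finite skew_pol set)"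
  shows "f * g \<in> homog (d + d')"
  using assms(1)
proof (induction f rule: homog.induct)
  case (monom js)
  show ?case using assms(2)
  proof (induction g rule: homog.induct)
    case (monom ks)
    then show ?case
      using homog.monom[of "js @ ks" "d + d'", where 'n = 'n] \<open>set js \<subseteq> _\<close> \<open>d = _\<close> by simp
  qed (auto simp: semiring_class.distrib_left intro: homog.intros)
qed (auto simp: semiring_class.distrib_right intro: homog.intros)

lemma homog_power: "f \<in> homog d \<Longrightarrow> f ^ k \<in> homog (k * d)"
  by (induction k) (auto simp: homog_one intro: homog_mult)

lemma demazure_homog:
  assumes i: "i \<in> {1..CARD('n)}" and f: "f \<in> (homog d :: 'n::finite skew_pol set)"
  shows "demazure i f \<in> homog (d - 2)" "d = 0 \<Longrightarrow> demazure i f = 0"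
proof -
  have "demazure i f \<in> homog (d - 2) \<and> (d = 0 \<longrightarrow> demazure i f = 0)"
    using f
  proof (induction f rule: homog.induct)
    case (monom js)
    then show ?case
    proof (induction js arbitrary: d)
      case Nil
      then show ?case using i by (simp add: demazure_additive homog.zero)
    next
      case (Cons j js)
      let ?p = "prod_list (map X js) :: 'n skew_pol"
        and ?j = "if i < CARD('n) then transpose i (i + 1) j else j"
      have j: "j \<in> {1..CARD('n)}" "?j \<in> {1..CARD('n)}"
        using Cons.prems i by (auto simp: Transposition.transpose_def)
      have p: "?p \<in> homog (d - 2)" using Cons.prems by (intro homog.monom) auto
      have dp: "demazure i ?p \<in> homog (d - 2 - 2) \<and> (d - 2 = 0 \<longrightarrow> demazure i ?p = 0)"
        using Cons.prems by (intro Cons.IH) auto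
      then have "X ?j * demazure i ?p \<in> homog (d - 2)"
      proof (cases js)
        case Nil
        then have "demazure i ?p = 0" using i by (simp add: demazure_additive)
        then show ?thesis by (simp add: homog.zero)
      next
        case (Cons _ _)
        then have "2 + (d - 2 - 2) = d - 2" using Cons.prems \<open>d = 2 * length (j # js)\<close> by simp
        then show ?thesis using homog_mult[OF homog_X[OF j(2)], of "demazure i ?p" "d - 2 - 2"] dp by simp
      qed
      then show ?case
        using p Cons.prems demazure_X_mult[OF i j(1), of ?p] by (auto intro: homog_diff homog.intros)
    qed
  qed (use i in \<open>auto simp: demazure_additive intro: homog.intros\<close>)
  then show "demazure i f \<in> homog (d - 2)" "d = 0 \<Longrightarrow> demazure i f = 0" by auto
qed

text \<open>
  The endomorphism that doubles every variable multiplies the component of degree \<open>2k\<close> by \<open>2\<^sup>k\<close>,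
  and the algebra has no torsion. Components of odd degree are zero.
\<close>

lemma homog_degree_unique:
  assumes f: "f \<in> (homog d :: 'n::finite skew_pol set)" "f \<in> homog d'" and "f \<noteq> 0"
  shows "d = d'"
proof -
  have "\<exists>!h. alg_endo h \<and> (\<forall>j\<in>{1..CARD('n)}. h (X j) = (2 * X j :: 'n skew_pol))"
  proof (rule alg_endo_ex1)
    fix i j assume ij: "i \<in> {1..CARD('n)}" "j \<in> {1..CARD('n)}" "i \<noteq> j"
    show "2 * X i * (2 * X j) + 2 * X j * (2 * X i) = (0 :: 'n skew_pol)"
      using X_anticommute[OF ij] by (simp add: mult_2 semiring_class.distrib_left semiring_class.distrib_right)
  qed
  then obtain h where h: "alg_endo h" and hX: "\<And>j. j \<in> {1..CARD('n)} \<Longrightarrow> h (X j) = (2 * X j :: 'n skew_pol)"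
    by blast
  note h = alg_endoD[OF h]
  have scale: "even e \<and> h g = of_nat (2 ^ (e div 2)) * g \<or> g = 0" if "g \<in> homog e" for g e
    using that
  proof (induction g rule: homog.induct)
    case (monom js)
    have "h (prod_list (map X js)) = of_nat (2 ^ length js) * (prod_list (map X js) :: 'n skew_pol)"
      using monom(1)
    proof (induction js)
      case (Cons j js)
      then have "h (prod_list (map X (j # js))) = 2 * (X j * of_nat (2 ^ length js)) * prod_list (map X js)"
        using hX by (simp add: h mult.assoc)
      also have "X j * of_nat (2 ^ length js) = of_nat (2 ^ length js) * (X j :: 'n skew_pol)"
        by (rule mult_of_nat_commute[symmetric])
      finally show ?case by (simp add: mult.assoc)
    qed (simp add: h)
    with monom show ?case by simp
  next
    case (add g g')
    then show ?case by (auto simp: h algebra_simps)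
  qed (auto simp: h)
  from scale[OF f(1)] scale[OF f(2)] \<open>f \<noteq> 0\<close>
  have even: "even d" "even d'" and eq: "of_nat (2 ^ (d div 2)) * f = of_nat (2 ^ (d' div 2)) * f" by auto
  have "2 ^ (d div 2) = (2 ^ (d' div 2) :: nat)"
  proof (rule ccontr)
    assume neq: "2 ^ (d div 2) \<noteq> (2 ^ (d' div 2) :: nat)"
    have *: "f = 0" if "of_nat m * f = of_nat m' * f" "m' < m" for m m' :: nat
    proof (rule torsion_free)
      show "of_nat (m - m') * f = 0" using that by (simp add: of_nat_diff left_diff_distrib)
      show "m - m' \<noteq> 0" using that by simp
    qed
    from neq consider "2 ^ (d' div 2) < (2 ^ (d div 2) :: nat)" | "2 ^ (d div 2) < (2 ^ (d' div 2) :: nat)"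
      by linarith
    then show False using *[OF eq] *[OF eq[symmetric]] \<open>f \<noteq> 0\<close> by cases blast+
  qed
  then have "d div 2 = d' div 2" by (simp add: power_inject_exp)
  with even show ?thesis by (metis dvd_mult_div_cancel)
qed

lemma hdeg_eq: "f \<in> homog d \<Longrightarrow> f \<noteq> 0 \<Longrightarrow> hdeg f = d"
  unfolding hdeg_def by (rule the_equality) (auto intro: homog_degree_unique)

section \<open>Signed permutations\<close>

lemma weyl_BD:
  assumes "w \<in> weyl_B n"
  shows "w (- k) = - w k" "w 0 = 0" "w k = w l \<longleftrightarrow> k = l" "w k = 0 \<longleftrightarrow> k = 0"
    "\<bar>k\<bar> \<le> int n \<Longrightarrow> \<bar>w k\<bar> \<le> int n" "int n < \<bar>k\<bar> \<Longrightarrow> w k = k"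
proof -
  from assms have w: "w permutes {- int n..int n}" and odd: "\<And>k. w (- k) = - w k"
    by (auto simp: weyl_B_def)
  show "w (- k) = - w k" by (rule odd)
  show "w 0 = 0" using odd[of 0] by simp
  show inj: "w k = w l \<longleftrightarrow> k = l" for k l using permutes_inj[OF w] by (auto dest: injD)
  show "w k = 0 \<longleftrightarrow> k = 0" using inj[of k 0] \<open>w 0 = 0\<close> by simp
  show "\<bar>w k\<bar> \<le> int n" if "\<bar>k\<bar> \<le> int n" using permutes_in_image[OF w, of k] that by (auto simp: abs_le_iff)
  show "w k = k" if "int n < \<bar>k\<bar>" 
    by (rule permutes_not_in[OF w]) (use that in auto)
qed

lemma weyl_B_ext:
  assumes "w \<in> weyl_B n" "u \<in> weyl_B n" "\<And>i. i \<in> {1..n} \<Longrightarrow> w (int i) = u (int i)"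
  shows "w = u"
proof
  fix k
  consider "k = 0" | "int n < \<bar>k\<bar>" | "nat k \<in> {1..n}" "k > 0" | "nat (- k) \<in> {1..n}" "k < 0" by fastforce
  then show "w k = u k"
  proof cases
    case 3
    then show ?thesis using assms(3)[of "nat k"] by simp
  next
    case 4
    then show ?thesis using assms(3)[of "nat (- k)"] weyl_BD(1)[OF assms(1), of k] weyl_BD(1)[OF assms(2), of k]
      by simp
  qed (simp_all add: weyl_BD(2,6)[OF assms(1)] weyl_BD(2,6)[OF assms(2)])
qed

lemma weyl_B_comp: "w \<in> weyl_B n \<Longrightarrow> u \<in> weyl_B n \<Longrightarrow> w \<circ> u \<in> weyl_B n"
  by (auto simp: weyl_B_def intro: permutes_compose)

lemma weyl_B_id: "id \<in> weyl_B n"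
  by (simp add: weyl_B_def permutes_id)

lemma weyl_B_inv:
  assumes "w \<in> weyl_B n"
  shows "inv w \<in> weyl_B n"
proof -
  have bij: "bij w" using assms by (auto simp: weyl_B_def permutes_bij)
  have "inv w (- k) = - inv w k" for k
    using weyl_BD(1)[OF assms, of "inv w k"] bij by (simp add: inv_f_eq bij_is_inj surj_f_inv_f bij_is_surj)
  then show ?thesis using assms by (auto simp: weyl_B_def intro: permutes_inv)
qed

lemma inv_comp_weyl_B:
  assumes "w \<in> weyl_B n"
  shows "w \<circ> inv w = id" "inv w \<circ> w = id"
proof -
  have "bij w" using assms by (auto simp: weyl_B_def permutes_bij)
  then show "w \<circ> inv w = id" "inv w \<circ> w = id"
    by (simp_all add: surj_iff[symmetric] inj_iff[symmetric] bij_is_inj bij_is_surj)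
qed

lemma finite_weyl_B: "finite (weyl_B n)"
  by (rule finite_subset[OF _ finite_permutations[of "{- int n..int n}"]]) (auto simp: weyl_B_def)

lemma simple_refl_weyl_B:
  assumes "i \<in> {1..n}"
  shows "simple_refl n i \<in> weyl_B n"
proof -
  have "simple_refl n i permutes {- int n..int n}"
    using assms by (auto simp: simple_refl_def intro!: permutes_compose permutes_swap_id)
  moreover have "simple_refl n i (- k) = - simple_refl n i k" for k
    using assms by (auto simp: simple_refl_def Transposition.transpose_def)
  ultimately show ?thesis by (simp add: weyl_B_def)
qed

lemma simple_refl_involution: "i \<in> {1..n} \<Longrightarrow> simple_refl n i \<circ> simple_refl n i = id"
  by (auto simp: fun_eq_iff simple_refl_def Transposition.transpose_def)

lemma simple_refl_at:
  assumes "1 \<le> i" "j \<in> {1..n}"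
  shows "simple_refl n i (int j) =
    (if i < n then if j = i then int (Suc i) else if j = Suc i then int i else int j
     else if j = n then - int n else int j)"
  using assms by (auto simp: simple_refl_def Transposition.transpose_def)

lemma simple_refl_far_commute:
  assumes "1 \<le> i" "i + 2 \<le> j" "j \<le> n"
  shows "simple_refl n i \<circ> simple_refl n j = simple_refl n j \<circ> simple_refl n i"
  using assms by (intro weyl_B_ext[of _ n] weyl_B_comp simple_refl_weyl_B)
    (auto simp: simple_refl_at weyl_BD(1)[OF simple_refl_weyl_B] simp del: of_nat_Suc)

lemma simple_refl_braid_3:
  assumes "1 \<le> i" "Suc i < n"
  shows "simple_refl n i \<circ> simple_refl n (Suc i) \<circ> simple_refl n i =
    simple_refl n (Suc i) \<circ> simple_refl n i \<circ> simple_refl n (Suc i)"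
  using assms by (intro weyl_B_ext[of _ n] weyl_B_comp simple_refl_weyl_B)
    (auto simp: simple_refl_at weyl_BD(1)[OF simple_refl_weyl_B] simp del: of_nat_Suc)

lemma simple_refl_braid_4:
  assumes "1 \<le> m" "n = Suc m"
  shows "simple_refl n m \<circ> simple_refl n n \<circ> simple_refl n m \<circ> simple_refl n n =
    simple_refl n n \<circ> simple_refl n m \<circ> simple_refl n n \<circ> simple_refl n m"
proof (intro weyl_B_ext[of _ n] weyl_B_comp simple_refl_weyl_B)
  note odd = weyl_BD(1)[OF simple_refl_weyl_B]
  fix j assume "j \<in> {1..n}"
  then consider "j = m" | "j = n" | "j \<in> {1..n}" "j \<noteq> m" "j \<noteq> n" by blast
  then show "(simple_refl n m \<circ> simple_refl n n \<circ> simple_refl n m \<circ> simple_refl n n) (int j) =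
    (simple_refl n n \<circ> simple_refl n m \<circ> simple_refl n n \<circ> simple_refl n m) (int j)"
    using assms(1) unfolding assms(2)
    by cases (simp_all add: simple_refl_at odd del: of_nat_Suc)
qed (use assms in auto)

section \<open>Length as an inversion count\<close>

text \<open>
  In the coordinate \<open>height\<close> the positive roots \<open>e\<^sub>a - e\<^sub>b\<close>, \<open>e\<^sub>a + e\<^sub>b\<close> (\<open>a < b\<close>) and \<open>e\<^sub>a\<close>, with
  \<open>e\<^sub>-\<^sub>a = - e\<^sub>a\<close>, are recognised by the sign of a sum of heights, and the identity has the decreasing
  window \<open>n, \<dots>, 1\<close>.
\<close>

definition height :: "nat \<Rightarrow> int \<Rightarrow> int" where
  "height n k = sgn k * (int n + 1 - \<bar>k\<bar>)"

lemma height_minus [simp]: "height n (- k) = - height n k"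
  by (simp add: height_def)

lemma height_bounds: "k \<noteq> 0 \<Longrightarrow> \<bar>k\<bar> \<le> int n \<Longrightarrow> 1 \<le> \<bar>height n k\<bar> \<and> \<bar>height n k\<bar> \<le> int n"
  by (auto simp: height_def abs_mult abs_sgn_eq)

lemma height_height: "\<bar>k\<bar> \<le> int n \<Longrightarrow> height n (height n k) = k"
  by (cases k "0 :: int" rule: linorder_cases) (auto simp: height_def sgn_if)

lemma height_eq_iff: "\<bar>k\<bar> \<le> int n \<Longrightarrow> \<bar>l\<bar> \<le> int n \<Longrightarrow> height n k = height n l \<longleftrightarrow> k = l"
  by (metis height_height)

definition window :: "nat \<Rightarrow> (int \<Rightarrow> int) \<Rightarrow> int list" where
  "window n w = map (\<lambda>i. height n (w (int i))) [1..<n + 1]"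

text \<open>
  The number of positive roots made negative: a letter \<open>a < 0\<close> stands for \<open>e\<^sub>i\<close>, and a pair of letters
  \<open>a\<close>, \<open>b\<close> at positions \<open>i < j\<close> for \<open>e\<^sub>i - e\<^sub>j\<close> if \<open>a < b\<close> and for \<open>e\<^sub>i + e\<^sub>j\<close> if \<open>a < - b\<close>.
\<close>

fun inversions :: "int list \<Rightarrow> nat" where
  "inversions [] = 0"
| "inversions (a # as) = of_bool (a < 0) + (\<Sum>b\<leftarrow>as. of_bool (a < b) + of_bool (a < - b)) + inversions as"

definition inv_length :: "nat \<Rightarrow> (int \<Rightarrow> int) \<Rightarrow> nat" where
  "inv_length n w = inversions (window n w)"

lemma inversions_swap:
  "inversions (as @ a # b # bs) + of_bool (b < a) = inversions (as @ b # a # bs) + of_bool (a < b)"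
  by (induction as) auto

lemma inversions_negate_last:
  "inversions (as @ [a]) + of_bool (0 < a) = inversions (as @ [- a]) + of_bool (a < 0)"
  by (induction as) auto

text \<open>
  There is one positive root for each letter and there are two for each pair of letters; each of these
  roots is inverted by exactly one of a list and its negative.
\<close>

lemma inversions_uminus:
  assumes "distinct (map abs as)" "0 \<notin> set as"
  shows "inversions (map uminus as) + inversions as = (length as)\<^sup>2"
  using assms
proof (induction as)
  case (Cons a as)
  have "(\<Sum>b\<leftarrow>map uminus as. of_bool (- a < b) + of_bool (- a < - b)) +
      (\<Sum>b\<leftarrow>as. of_bool (a < b) + of_bool (a < - b)) = (2 * length as :: nat)"
    using Cons.prems by (induction as) (auto simp: abs_eq_iff)
  then show ?case using Cons by (auto simp: power2_eq_square algebra_simps)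
qed simp

definition descent :: "nat \<Rightarrow> (int \<Rightarrow> int) \<Rightarrow> nat \<Rightarrow> bool" where
  "descent n w i \<longleftrightarrow> (if i < n then height n (w (int i)) < height n (w (int (Suc i)))
     else height n (w (int n)) < 0)"

text \<open>
  Right multiplication by a simple reflection exchanges two adjacent entries of the window or negates the last entry.
  All counts are symmetric under this, apart from the contribution of the corresponding simple root.
\<close>

lemma inv_length_simple_refl:
  assumes w: "w \<in> weyl_B n" and i: "i \<in> {1..n}"
  shows "descent n w i \<Longrightarrow> inv_length n w = Suc (inv_length n (w \<circ> simple_refl n i))"
    and "\<not> descent n w i \<Longrightarrow> inv_length n (w \<circ> simple_refl n i) = Suc (inv_length n w)"
proof -
  let ?h = "\<lambda>i. height n (w (int i))" and ?u = "w \<circ> simple_refl n i"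
  have "(descent n w i \<longrightarrow> inv_length n w = Suc (inv_length n ?u)) \<and>
    (\<not> descent n w i \<longrightarrow> inv_length n ?u = Suc (inv_length n w))"
  proof (cases "i < n")
    case True
    let ?A = "map ?h [1..<i]" and ?B = "map ?h [i + 2..<n + 1]"
    have s: "[1..<n + 1] = [1..<i] @ i # Suc i # [i + 2..<n + 1]"
      using i True upt_split3[of i n] by (simp add: upt_conv_Cons)
    have "window n w = ?A @ ?h i # ?h (Suc i) # ?B"
      unfolding window_def s by simp
    moreover have "window n ?u = ?A @ ?h (Suc i) # ?h i # ?B"
      unfolding window_def s using i True by (auto simp: simple_refl_at simp del: of_nat_Suc upt_Suc)
    moreover have "?h i \<noteq> ?h (Suc i)"
      using i True weyl_BD[OF w] by (subst height_eq_iff) auto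
    ultimately show ?thesis
      using True inversions_swap[of ?A "?h i" "?h (Suc i)" ?B]
      by (auto simp: descent_def inv_length_def)
  next
    case False
    then have i: "i = n" "1 \<le> n" using i by auto
    let ?A = "map ?h [1..<n]"
    have "window n w = ?A @ [?h n]"
      unfolding window_def using i by simp
    moreover have "window n ?u = ?A @ [- ?h n]"
      unfolding window_def using i by (simp add: simple_refl_at weyl_BD(1)[OF w])
    moreover have "?h n \<noteq> 0"
      using i weyl_BD[OF w] height_bounds[of "w (int n)" n] by auto
    ultimately show ?thesis
      using i inversions_negate_last[of ?A "?h n"] by (auto simp: descent_def inv_length_def)
  qed
  then show "descent n w i \<Longrightarrow> inv_length n w = Suc (inv_length n ?u)"
    and "\<not> descent n w i \<Longrightarrow> inv_length n ?u = Suc (inv_length n w)" by auto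
qed

text \<open>
  The window then consists of \<open>n\<close> strictly decreasing positive numbers that are at most \<open>n\<close>.
\<close>

lemma no_descent_imp_id:
  assumes w: "w \<in> weyl_B n" and no: "\<And>i. i \<in> {1..n} \<Longrightarrow> \<not> descent n w i"
  shows "w = id"
proof (rule weyl_B_ext[OF w weyl_B_id])
  let ?h = "\<lambda>i. height n (w (int i))"
  have bound: "1 \<le> \<bar>?h i\<bar> \<and> \<bar>?h i\<bar> \<le> int n" if "i \<in> {1..n}" for i
    using that weyl_BD[OF w] by (intro height_bounds) auto
  have dec: "?h (Suc i) < ?h i" if "1 \<le> i" "i < n" for i
  proof -
    have "?h i \<noteq> ?h (Suc i)" using that weyl_BD[OF w] by (subst height_eq_iff) auto
    then show ?thesis using no[of i] that by (auto simp: descent_def)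
  qed
  fix i assume i: "i \<in> {1..n}"
  then have "i \<le> n" "1 \<le> i" by auto
  from this(1) have "1 \<le> i \<longrightarrow> ?h i \<ge> int n + 1 - int i"
  proof (induction rule: inc_induct)
    case base
    then show ?case using no[of n] bound[of n] by (auto simp: descent_def)
  next
    case (step i)
    then show ?case using dec[of i] by auto
  qed
  moreover from \<open>1 \<le> i\<close> have "i \<le> n \<longrightarrow> ?h i \<le> int n + 1 - int i"
  proof (induction rule: dec_induct)
    case base
    then show ?case using bound[of 1] by auto
  next
    case (step i)
    then show ?case using dec[of i] by auto
  qed
  ultimately have "?h i = int n + 1 - int i" using i by auto
  also have "\<dots> = height n (int i)" using i by (simp add: height_def)
  finally show "w (int i) = id (int i)"
    using i weyl_BD[OF w] height_eq_iff[of "w (int i)" n "int i"] by auto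
qed

lemma descent_exists:
  assumes "w \<in> weyl_B n" "w \<noteq> id"
  obtains i where "i \<in> {1..n}" "descent n w i"
  using no_descent_imp_id[OF assms(1)] assms(2) by blast

lemma inv_length_id: "inv_length n id = 0"
proof -
  have "inversions (map (\<lambda>i. int n + 1 - int i) [k..<n + 1]) = 0" for k
  proof (induction "n + 1 - k" arbitrary: k)
    case (Suc d)
    then have "[k..<n + 1] = k # [Suc k..<n + 1]" by (intro upt_conv_Cons) simp
    then show ?case using Suc(1)[of "Suc k"] Suc(2) by (auto simp del: upt_Suc)
  qed simp
  moreover have "window n id = map (\<lambda>i. int n + 1 - int i) [1..<n + 1]"
    unfolding window_def by (rule map_cong) (auto simp: height_def)
  ultimately show ?thesis by (simp add: inv_length_def)
qed

section \<open>Words in the simple reflections\<close>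

definition word_value :: "nat \<Rightarrow> nat list \<Rightarrow> int \<Rightarrow> int" where
  "word_value n js = foldr (\<lambda>i v. simple_refl n i \<circ> v) js id"

lemma word_value_simps [simp]:
  "word_value n [] = id" "word_value n (j # js) = simple_refl n j \<circ> word_value n js"
  by (simp_all add: word_value_def)

lemma word_value_append: "word_value n (js @ ks) = word_value n js \<circ> word_value n ks"
  by (induction js) (auto simp: comp_assoc)

lemma expression_iff: "expression n w js \<longleftrightarrow> set js \<subseteq> {1..n} \<and> w = word_value n js"
  by (simp add: expression_def word_value_def)

lemma word_value_weyl_B: "set js \<subseteq> {1..n} \<Longrightarrow> word_value n js \<in> weyl_B n"
  by (induction js) (auto intro!: weyl_B_id weyl_B_comp simple_refl_weyl_B)

lemma comp_simple_refl_cancel: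
  "i \<in> {1..n} \<Longrightarrow> w \<circ> simple_refl n i \<circ> simple_refl n i = w"
  using simple_refl_involution[of i n] by (simp add: comp_assoc)

lemma inv_length_word_value: "set js \<subseteq> {1..n} \<Longrightarrow> inv_length n (word_value n js) \<le> length js"
proof (induction js rule: rev_induct)
  case (snoc i js)
  then have "word_value n js \<in> weyl_B n" "i \<in> {1..n}" "inv_length n (word_value n js) \<le> length js"
    by (auto intro!: word_value_weyl_B)
  with inv_length_simple_refl[OF this(1,2)]
  have "inv_length n (word_value n js \<circ> simple_refl n i) \<le> Suc (length js)"
    by (cases "descent n (word_value n js) i") auto
  then show ?case unfolding word_value_append by (simp del: comp_apply)
qed (simp add: inv_length_id)

lemma reduced_word_exists:
  assumes "w \<in> weyl_B n"
  obtains js where "set js \<subseteq> {1..n}" "word_value n js = w" "length js = inv_length n w"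
proof -
  have "\<exists>js. set js \<subseteq> {1..n} \<and> word_value n js = w \<and> length js = inv_length n w"
    using assms
  proof (induction "inv_length n w" arbitrary: w rule: less_induct)
    case less
    show ?case
    proof (cases "w = id")
      case True
      then show ?thesis by (intro exI[of _ "[]"]) (simp add: inv_length_id)
    next
      case False
      then obtain i where i: "i \<in> {1..n}" "descent n w i"
        using descent_exists[OF less.prems] by blast
      let ?u = "w \<circ> simple_refl n i"
      have l: "inv_length n w = Suc (inv_length n ?u)"
        using inv_length_simple_refl(1)[OF less.prems i] .
      moreover have "?u \<in> weyl_B n" using i less.prems by (intro weyl_B_comp simple_refl_weyl_B)
      ultimately obtain js where js: "set js \<subseteq> {1..n}" "word_value n js = ?u" "length js = inv_length n ?u"
        using less.hyps[of ?u] by auto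
      then show ?thesis
        using i l comp_simple_refl_cancel[OF i(1), of w]
        by (intro exI[of _ "js @ [i]"]) (simp add: word_value_append)
    qed
  qed
  then show ?thesis using that by blast
qed

lemma weyl_length_eq:
  assumes "w \<in> weyl_B n"
  shows "weyl_length n w = inv_length n w"
proof -
  obtain js where "set js \<subseteq> {1..n}" "word_value n js = w" "length js = inv_length n w"
    using reduced_word_exists[OF assms] .
  then show ?thesis unfolding weyl_length_def
    by (intro Least_equality) (auto simp: expression_iff inv_length_word_value)
qed

lemma inv_length_inv:
  assumes "w \<in> weyl_B n"
  shows "inv_length n (inv w) = inv_length n w"
proof -
  have rev: "word_value n (rev js) \<circ> word_value n js = id" if "set js \<subseteq> {1..n}" for js
    using that
  proof (induction js)
    case (Cons j js)
    then have "word_value n (rev js) \<circ> simple_refl n j \<circ> simple_refl n j = word_value n (rev js)"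
      by (intro comp_simple_refl_cancel) auto
    then have eq: "word_value n (rev (j # js)) \<circ> word_value n (j # js) = word_value n (rev js) \<circ> word_value n js"
      by (simp add: word_value_append comp_id flip: comp_assoc)
    have "set js \<subseteq> {1..n}" using Cons.prems by simp
    then show ?case unfolding eq by (rule Cons.IH)
  qed simp
  have le: "inv_length n (inv w) \<le> inv_length n w" if w: "w \<in> weyl_B n" for w
  proof -
    obtain js where js: "set js \<subseteq> {1..n}" "word_value n js = w" "length js = inv_length n w"
      using reduced_word_exists[OF w] .
    have "inv w = (word_value n (rev js) \<circ> w) \<circ> inv w" using rev[OF js(1)] js(2) by simp
    also have "\<dots> = word_value n (rev js)"
      using inv_comp_weyl_B(1)[OF w] by (simp add: comp_assoc)
    finally show ?thesis using inv_length_word_value[of "rev js" n] js by simp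
  qed
  have "inv (inv w) = w" using assms by (auto simp: weyl_B_def permutes_inv_inv)
  then show ?thesis using le[OF assms] le[OF weyl_B_inv[OF assms]] by simp
qed

section \<open>The longest element\<close>

definition negation :: "nat \<Rightarrow> int \<Rightarrow> int" where
  "negation n k = (if \<bar>k\<bar> \<le> int n then - k else k)"

lemma negation_weyl_B: "negation n \<in> weyl_B n"
proof -
  have "negation n permutes {- int n..int n}"
    by (rule bij_imp_permutes) (auto simp: negation_def intro!: bij_betwI[of _ _ _ "negation n"])
  then show ?thesis by (auto simp: weyl_B_def negation_def)
qed

lemma negation_involution: "negation n \<circ> negation n = id"
  by (auto simp: negation_def fun_eq_iff)

lemma window_weyl_B:
  assumes w: "w \<in> weyl_B n"
  shows "distinct (map abs (window n w))" "0 \<notin> set (window n w)" "length (window n w) = n"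
    "abs ` set (window n w) = {1..int n}"
proof -
  let ?h = "\<lambda>i. height n (w (int i))"
  have bound: "1 \<le> \<bar>?h i\<bar> \<and> \<bar>?h i\<bar> \<le> int n" if "i \<in> {1..n}" for i
    using that weyl_BD[OF w] by (intro height_bounds) auto
  have "inj_on (\<lambda>i. \<bar>?h i\<bar>) {1..n}"
  proof (rule inj_onI)
    fix i j assume ij: "i \<in> {1..n}" "j \<in> {1..n}" "\<bar>?h i\<bar> = \<bar>?h j\<bar>"
    then have "?h i = ?h j \<or> ?h i = height n (w (- int j))"
      by (auto simp: abs_eq_iff weyl_BD(1)[OF w])
    then have "w (int i) = w (int j) \<or> w (int i) = w (- int j)"
      using ij weyl_BD(5)[OF w] by (subst (asm) (1 2) height_eq_iff) auto
    then show "i = j" using ij by (auto simp: weyl_BD(3)[OF w])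
  qed
  moreover have "set [1..<n + 1] = {1..n}" by auto
  ultimately show dist: "distinct (map abs (window n w))"
    by (simp add: window_def distinct_map comp_def del: upt_Suc)
  show "0 \<notin> set (window n w)"
  proof
    assume "0 \<in> set (window n w)"
    then obtain i where "i \<in> {1..n}" "?h i = 0" by (force simp: window_def simp del: upt_Suc)
    then show False using bound[of i] by simp
  qed
  show len: "length (window n w) = n" by (simp add: window_def)
  show "abs ` set (window n w) = {1..int n}"
  proof (rule card_subset_eq)
    show "abs ` set (window n w) \<subseteq> {1..int n}"
      using bound by (auto simp: window_def simp del: upt_Suc)
    show "card (abs ` set (window n w)) = card {1..int n}"
      using distinct_card[OF dist] len by simp
  qed simp
qed

lemma inv_length_negation:
  assumes w: "w \<in> weyl_B n"
  shows "inv_length n (w \<circ> negation n) + inv_length n w = n\<^sup>2"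
proof -
  have "window n (w \<circ> negation n) = map uminus (window n w)"
    unfolding window_def map_map by (rule map_cong) (auto simp: negation_def weyl_BD(1)[OF w])
  then show ?thesis
    using inversions_uminus[of "window n w"] window_weyl_B[OF w] by (simp add: inv_length_def)
qed

lemma inv_length_eq_square:
  assumes w: "w \<in> weyl_B n" and "inv_length n w = n\<^sup>2"
  shows "w = negation n"
proof -
  let ?u = "w \<circ> negation n"
  have u: "?u \<in> weyl_B n" using w by (intro weyl_B_comp negation_weyl_B)
  have "inv_length n ?u = 0" using inv_length_negation[OF w] assms(2) by simp
  then have "?u = id" using descent_exists[OF u] inv_length_simple_refl(1)[OF u] by (metis nat.distinct(1))
  moreover have "?u \<circ> negation n = w" by (simp add: comp_assoc negation_involution)
  ultimately show ?thesis by simp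
qed

lemma longest_eq: "longest n = negation n"
proof -
  have len: "weyl_length n w \<le> n\<^sup>2" if "w \<in> weyl_B n" for w
    using inv_length_negation[OF that] by (simp add: weyl_length_eq[OF that])
  have neg: "weyl_length n (negation n) = n\<^sup>2"
    using inv_length_negation[OF weyl_B_id] by (simp add: weyl_length_eq negation_weyl_B inv_length_id)
  show ?thesis unfolding longest_def
  proof (rule the_equality)
    show "negation n \<in> weyl_B n \<and> (\<forall>v\<in>weyl_B n. weyl_length n v \<le> weyl_length n (negation n))"
      using len neg by (simp add: negation_weyl_B)
    fix w assume w: "w \<in> weyl_B n \<and> (\<forall>v\<in>weyl_B n. weyl_length n v \<le> weyl_length n w)"
    then have "weyl_length n w = n\<^sup>2" using len[of w] neg negation_weyl_B by (metis le_antisym)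
    with w show "w = negation n" by (intro inv_length_eq_square) (auto simp: weyl_length_eq)
  qed
qed

section \<open>The length generating function\<close>

definition signed_arrangements :: "int set \<Rightarrow> int list set" where
  "signed_arrangements S = {as. distinct (map abs as) \<and> abs ` set as = S}"

lemma sum_power_rank:
  fixes q :: "'a::comm_semiring_1" and S :: "'b::linorder set"
  assumes "finite S"
  shows "(\<Sum>v\<in>S. q ^ card {u\<in>S. v < u}) = (\<Sum>j<card S. q ^ j)"
    and "(\<Sum>v\<in>S. q ^ card {u\<in>S. u < v}) = (\<Sum>j<card S. q ^ j)"
proof -
  have "(\<Sum>v\<in>S. q ^ card {u\<in>S. v < u}) = (\<Sum>j<card S. q ^ j) \<and>
    (\<Sum>v\<in>S. q ^ card {u\<in>S. u < v}) = (\<Sum>j<card S. q ^ j)"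
    using assms
  proof (induction rule: finite_linorder_max_induct)
    case (insert b A)
    \<comment> \<open>the new element is the maximum: it raises the upper rank of all others and has upper rank \<open>0\<close>\<close>
    have b: "b \<notin> A" using insert.hyps by auto
    have up: "card {u \<in> insert b A. v < u} = Suc (card {u \<in> A. v < u})"
      and down: "{u \<in> insert b A. u < v} = {u \<in> A. u < v}" if "v \<in> A" for v
    proof -
      have "{u \<in> insert b A. v < u} = insert b {u \<in> A. v < u}" using insert.hyps that by auto
      then show "card {u \<in> insert b A. v < u} = Suc (card {u \<in> A. v < u})"
        using insert.hyps(1) b by simp
      show "{u \<in> insert b A. u < v} = {u \<in> A. u < v}" using insert.hyps that by auto
    qed
    have ends: "{u \<in> insert b A. b < u} = {}" "{u \<in> insert b A. u < b} = A"
      using insert.hyps by auto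
    have "(\<Sum>v\<in>insert b A. q ^ card {u\<in>insert b A. v < u}) =
        1 + (\<Sum>v\<in>A. q ^ card {u\<in>insert b A. v < u})"
      unfolding sum.insert[OF insert.hyps(1) b] ends by simp
    also have "(\<Sum>v\<in>A. q ^ card {u\<in>insert b A. v < u}) = (\<Sum>v\<in>A. q * q ^ card {u\<in>A. v < u})"
      by (rule sum.cong) (simp_all only: up power_Suc)
    also have "\<dots> = (\<Sum>j<card A. q ^ Suc j)"
      using insert.IH by (simp flip: sum_distrib_left)
    also have "1 + \<dots> = (\<Sum>j<card (insert b A). q ^ j)"
      using insert.hyps(1) b by (simp add: sum.lessThan_Suc_shift del: sum.lessThan_Suc)
    finally have 1: "(\<Sum>v\<in>insert b A. q ^ card {u\<in>insert b A. v < u}) =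
        (\<Sum>j<card (insert b A). q ^ j)" .
    have "(\<Sum>v\<in>insert b A. q ^ card {u\<in>insert b A. u < v}) =
        q ^ card A + (\<Sum>v\<in>A. q ^ card {u\<in>insert b A. u < v})"
      unfolding sum.insert[OF insert.hyps(1) b] ends by simp
    also have "(\<Sum>v\<in>A. q ^ card {u\<in>insert b A. u < v}) = (\<Sum>v\<in>A. q ^ card {u\<in>A. u < v})"
      by (rule sum.cong) (simp_all only: down)
    also have "q ^ card A + \<dots> = (\<Sum>j<card (insert b A). q ^ j)"
      using insert.hyps(1) b insert.IH by (simp add: add.commute)
    finally show ?case using 1 by blast
  qed simp
  then show "(\<Sum>v\<in>S. q ^ card {u\<in>S. v < u}) = (\<Sum>j<card S. q ^ j)"
    and "(\<Sum>v\<in>S. q ^ card {u\<in>S. u < v}) = (\<Sum>j<card S. q ^ j)" by auto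
qed

lemma inversions_Cons_signed:
  assumes S: "finite S" "\<And>s. s \<in> S \<Longrightarrow> 0 < s" and a: "\<bar>a\<bar> \<in> S"
    and as: "as \<in> signed_arrangements (S - {\<bar>a\<bar>})"
  shows "inversions (a # as) =
    (if 0 < a then card {u\<in>S. a < u} else card S + card {u\<in>S. u < - a}) + inversions as"
proof -
  define g :: "int \<Rightarrow> nat" where "g u = (if 0 < a then of_bool (a < u) else 1 + of_bool (u < - a))" for u
  have abs: "\<bar>b\<bar> \<in> S - {\<bar>a\<bar>}" if "b \<in> set as" for b
    using as that by (auto simp: signed_arrangements_def)
  have "a \<noteq> 0" using S a by force
  have "(\<Sum>b\<leftarrow>as. of_bool (a < b) + of_bool (a < - b)) = (\<Sum>b\<leftarrow>as. g \<bar>b\<bar>)"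
  proof (intro arg_cong[where f = sum_list] map_cong refl)
    fix b assume "b \<in> set as"
    then have "\<bar>b\<bar> \<noteq> \<bar>a\<bar>" "b \<noteq> 0" using abs[of b] S by force+
    then show "of_bool (a < b) + of_bool (a < - b) = g \<bar>b\<bar>"
      using \<open>a \<noteq> 0\<close> by (auto simp: g_def)
  qed
  also have "\<dots> = (\<Sum>u\<leftarrow>map abs as. g u)" by (simp add: comp_def)
  also have "\<dots> = (\<Sum>u\<in>S - {\<bar>a\<bar>}. g u)"
    using as by (subst sum_list_distinct_conv_sum_set) (auto simp: signed_arrangements_def)
  also have "\<dots> = (if 0 < a then card {u\<in>S. a < u} else card S - 1 + card {u\<in>S. u < - a})"
  proof (cases "0 < a")
    case True
    then have "(S - {\<bar>a\<bar>}) \<inter> {u. a < u} = {u\<in>S. a < u}" by auto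
    then show ?thesis using True S(1) by (simp add: g_def sum.If_cases of_bool_def)
  next
    case False
    then have "(S - {\<bar>a\<bar>}) \<inter> {u. u < - a} = {u\<in>S. u < - a}" by auto
    then show ?thesis using False S(1) a
      by (simp add: g_def sum_Suc sum.If_cases of_bool_def)
  qed
  finally show ?thesis
    using \<open>a \<noteq> 0\<close> S a card_gt_0_iff[of S] by auto
qed

text \<open>
  How many inversions the first letter causes depends only on that letter and on the set \<open>S\<close> of
  absolute values. The \<open>2 |S|\<close> possible first letters cause \<open>0, 1, \<dots>, 2 |S| - 1\<close> inversions, each number once.
\<close>

lemma sum_signed_inversions:
  fixes q :: "'a::comm_semiring_1"
  assumes "finite S" "\<And>s. s \<in> S \<Longrightarrow> 0 < s"
  shows "(\<Sum>as\<in>signed_arrangements S. q ^ inversions as) = (\<Prod>k\<in>{1..card S}. \<Sum>j<2 * k. q ^ j)"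
    and "finite (signed_arrangements S)"
proof -
  have "finite (signed_arrangements S) \<and>
    (\<Sum>as\<in>signed_arrangements S. q ^ inversions as) = (\<Prod>k\<in>{1..card S}. \<Sum>j<2 * k. q ^ j)"
    using assms
  proof (induction "card S" arbitrary: S)
    case 0
    then have "signed_arrangements S = {[]}" by (auto simp: signed_arrangements_def)
    then show ?case using 0 by simp
  next
    case (Suc m)
    let ?A = "S \<union> uminus ` S" and ?P = "\<Prod>k\<in>{1..m}. \<Sum>j<2 * k. q ^ j"
    let ?e = "\<lambda>a. if 0 < a then card {u\<in>S. a < u} else card S + card {u\<in>S. u < - a}"
    have A: "\<bar>a\<bar> \<in> S" if "a \<in> ?A" for a using that Suc.prems(2) by force
    have IH: "finite (signed_arrangements (S - {\<bar>a\<bar>})) \<and>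
        (\<Sum>as\<in>signed_arrangements (S - {\<bar>a\<bar>}). q ^ inversions as) = ?P" if "a \<in> ?A" for a
    proof -
      have card: "card (S - {\<bar>a\<bar>}) = m" using Suc.hyps(2) Suc.prems(1) A[OF that] by simp
      show ?thesis using Suc.hyps(1)[OF card[symmetric]] Suc.prems unfolding card by auto
    qed
    have bij: "bij_betw (\<lambda>(a, as). a # as) (SIGMA a:?A. signed_arrangements (S - {\<bar>a\<bar>})) (signed_arrangements S)"
    proof (rule bij_betw_imageI)
      show "inj_on (\<lambda>(a, as). a # as) (SIGMA a:?A. signed_arrangements (S - {\<bar>a\<bar>}))"
        by (auto simp: inj_on_def)
      show "(\<lambda>(a, as). a # as) ` (SIGMA a:?A. signed_arrangements (S - {\<bar>a\<bar>})) = signed_arrangements S"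
      proof (intro equalityI subsetI)
        fix bs assume "bs \<in> (\<lambda>(a, as). a # as) ` (SIGMA a:?A. signed_arrangements (S - {\<bar>a\<bar>}))"
        then obtain a as where bs: "bs = a # as" "a \<in> ?A" "as \<in> signed_arrangements (S - {\<bar>a\<bar>})" by auto
        then show "bs \<in> signed_arrangements S"
          using A[OF bs(2)] by (auto simp: signed_arrangements_def)
      next
        fix bs assume bs: "bs \<in> signed_arrangements S"
        with Suc obtain a as where [simp]: "bs = a # as"
          by (cases bs) (auto simp: signed_arrangements_def)
        have "a \<in> ?A" using bs by (cases "0 \<le> a") (auto simp: signed_arrangements_def image_iff)
        moreover have "as \<in> signed_arrangements (S - {\<bar>a\<bar>})"
        proof -
          have "\<bar>a\<bar> \<notin> abs ` set as" "S = insert \<bar>a\<bar> (abs ` set as)" "distinct (map abs as)"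
            using bs by (simp_all add: signed_arrangements_def)
          then show ?thesis by (simp add: signed_arrangements_def)
        qed
        ultimately show "bs \<in> (\<lambda>(a, as). a # as) ` (SIGMA a:?A. signed_arrangements (S - {\<bar>a\<bar>}))" by auto
      qed
    qed
    have fin: "finite ?A" using Suc.prems by auto
    have finite: "finite (signed_arrangements S)"
      using bij_betw_finite[OF bij] fin IH by auto
    have "(\<Sum>as\<in>signed_arrangements S. q ^ inversions as) =
        (\<Sum>(a, as)\<in>(SIGMA a:?A. signed_arrangements (S - {\<bar>a\<bar>})). q ^ inversions (a # as))"
      by (subst sum.reindex_bij_betw[OF bij, symmetric]) (simp add: case_prod_unfold)
    also have "\<dots> = (\<Sum>a\<in>?A. \<Sum>as\<in>signed_arrangements (S - {\<bar>a\<bar>}). q ^ inversions (a # as))"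
      using fin IH by (subst sum.Sigma) auto
    also have "\<dots> = (\<Sum>a\<in>?A. q ^ ?e a * ?P)"
    proof (rule sum.cong[OF refl])
      fix a assume a: "a \<in> ?A"
      have "(\<Sum>as\<in>signed_arrangements (S - {\<bar>a\<bar>}). q ^ inversions (a # as)) =
          (\<Sum>as\<in>signed_arrangements (S - {\<bar>a\<bar>}). q ^ ?e a * q ^ inversions as)"
        using inversions_Cons_signed[OF Suc.prems A[OF a]]
        by (intro sum.cong) (simp_all add: power_add del: inversions.simps)
      then show "(\<Sum>as\<in>signed_arrangements (S - {\<bar>a\<bar>}). q ^ inversions (a # as)) = q ^ ?e a * ?P"
        using IH[OF a] by (simp flip: sum_distrib_left)
    qed
    also have "\<dots> = (\<Sum>a\<in>?A. q ^ ?e a) * ?P" by (simp add: sum_distrib_right)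
    also have "(\<Sum>a\<in>?A. q ^ ?e a) = (\<Sum>a\<in>S. q ^ ?e a) + (\<Sum>a\<in>uminus ` S. q ^ ?e a)"
      using Suc.prems(1) by (intro sum.union_disjoint) (auto dest!: Suc.prems(2))
    also have "(\<Sum>a\<in>S. q ^ ?e a) = (\<Sum>a\<in>S. q ^ card {u\<in>S. a < u})"
      using Suc.prems(2) by (intro sum.cong) auto
    also have "(\<Sum>a\<in>uminus ` S. q ^ ?e a) = (\<Sum>a\<in>S. q ^ (card S + card {u\<in>S. u < a}))"
      using Suc.prems(2) by (subst sum.reindex) (force simp: inj_on_def intro!: sum.cong)+
    also have "\<dots> = q ^ card S * (\<Sum>a\<in>S. q ^ card {u\<in>S. u < a})"
      by (simp add: power_add sum_distrib_left)
    also have "(\<Sum>a\<in>S. q ^ card {u\<in>S. a < u}) + q ^ card S * (\<Sum>a\<in>S. q ^ card {u\<in>S. u < a}) =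
        (\<Sum>j<card S. q ^ j) + (\<Sum>j<card S. q ^ (j + card S))"
      using Suc.prems by (simp add: sum_power_rank sum_distrib_left power_add mult.commute)
    also have "\<dots> = (\<Sum>j<2 * card S. q ^ j)"
      using sum.shift_bounds_nat_ivl[of "\<lambda>j. q ^ j" 0 "card S" "card S"]
        sum.atLeastLessThan_concat[of 0 "card S" "card S + card S" "\<lambda>j. q ^ j"]
      by (simp add: lessThan_atLeast0 mult_2)
    also have "\<dots> * ?P = (\<Prod>k\<in>{1..card S}. \<Sum>j<2 * k. q ^ j)"
      unfolding Suc.hyps(2)[symmetric] by (simp add: mult.commute)
    finally show ?case using finite by blast
  qed
  then show "(\<Sum>as\<in>signed_arrangements S. q ^ inversions as) = (\<Prod>k\<in>{1..card S}. \<Sum>j<2 * k. q ^ j)"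
    and "finite (signed_arrangements S)" by auto
qed

lemma abs_height: "k \<noteq> 0 \<Longrightarrow> \<bar>k\<bar> \<le> int n \<Longrightarrow> \<bar>height n k\<bar> = int n + 1 - \<bar>k\<bar>"
  by (simp add: height_def abs_mult abs_sgn_eq)

lemma window_bij: "bij_betw (window n) (weyl_B n) (signed_arrangements {1..int n})"
proof (rule bij_betw_imageI)
  show "inj_on (window n) (weyl_B n)"
  proof (rule inj_onI)
    fix w u assume w: "w \<in> weyl_B n" and u: "u \<in> weyl_B n" and eq: "window n w = window n u"
    show "w = u"
    proof (rule weyl_B_ext[OF w u])
      fix i assume i: "i \<in> {1..n}"
      have "height n (w (int i)) = height n (u (int i))"
        using eq i unfolding window_def map_eq_conv by (auto simp del: upt_Suc)
      then show "w (int i) = u (int i)"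
        using i weyl_BD(5)[OF w] weyl_BD(5)[OF u] by (subst (asm) height_eq_iff) auto
    qed
  qed
  show "window n ` weyl_B n = signed_arrangements {1..int n}"
  proof (intro equalityI subsetI)
    fix as assume "as \<in> window n ` weyl_B n"
    then obtain w where w: "w \<in> weyl_B n" and "as = window n w" by blast
    then show "as \<in> signed_arrangements {1..int n}"
      using window_weyl_B[OF w] by (simp add: signed_arrangements_def)
  next
    fix as assume "as \<in> signed_arrangements {1..int n}"
    then have dist: "distinct (map abs as)" and set: "abs ` set as = {1..int n}"
      by (auto simp: signed_arrangements_def)
    have len: "length as = n" using distinct_card[OF dist] set by simp
    define p where "p k = nat (\<bar>k\<bar> - 1)" for k
    define w where "w k = (if 1 \<le> \<bar>k\<bar> \<and> \<bar>k\<bar> \<le> int n then sgn k * height n (as ! p k) else k)" for k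
    have p: "p k < n" if "1 \<le> \<bar>k\<bar>" "\<bar>k\<bar> \<le> int n" for k
      using that by (simp add: p_def nat_less_iff)
    have as: "1 \<le> \<bar>as ! l\<bar> \<and> \<bar>as ! l\<bar> \<le> int n" if "l < n" for l
    proof -
      have "\<bar>as ! l\<bar> \<in> {1..int n}" using nth_mem[of l as] len that unfolding set[symmetric] by blast
      then show ?thesis by simp
    qed
    have abs_w: "\<bar>w k\<bar> = int n + 1 - \<bar>as ! p k\<bar>" if "1 \<le> \<bar>k\<bar>" "\<bar>k\<bar> \<le> int n" for k
    proof -
      have "as ! p k \<noteq> 0" using as[OF p[OF that]] by auto
      with abs_height[of "as ! p k" n] as[OF p[OF that]] that show ?thesis
        by (auto simp: w_def abs_mult abs_sgn_eq)
    qed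
    have w_sgn: "w k = sgn k * height n (as ! p k)" if "1 \<le> \<bar>k\<bar>" "\<bar>k\<bar> \<le> int n" for k
      using that by (simp add: w_def)
    have inj: "k = l" if k: "k \<in> {- int n..int n}" and l: "l \<in> {- int n..int n}" and eq: "w k = w l" for k l
    proof (cases "k = 0 \<or> l = 0")
      case True
      have "w j = 0 \<longleftrightarrow> j = 0" if "j \<in> {- int n..int n}" for j
      proof (cases "j = 0")
        case False
        then have "1 \<le> \<bar>j\<bar>" "\<bar>j\<bar> \<le> int n" using that by auto
        from abs_w[OF this] as[OF p[OF this]] show ?thesis using False by auto
      qed (simp add: w_def)
      from this[OF k] this[OF l] show ?thesis using True eq by metis
    next
      case False
      then have kl: "1 \<le> \<bar>k\<bar>" "\<bar>k\<bar> \<le> int n" "1 \<le> \<bar>l\<bar>" "\<bar>l\<bar> \<le> int n" using k l by auto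
      then have "\<bar>as ! p k\<bar> = \<bar>as ! p l\<bar>" using abs_w[of k] abs_w[of l] eq by simp
      then have "p k = p l"
        using nth_eq_iff_index_eq[OF dist, of "p k" "p l"] p kl len by simp
      then have abs: "\<bar>k\<bar> = \<bar>l\<bar>" using kl by (simp add: p_def eq_nat_nat_iff)
      have "as ! p k \<noteq> 0" using as[OF p[OF kl(1,2)]] by auto
      then have "height n (as ! p k) \<noteq> 0"
        using height_bounds[of "as ! p k" n] as[OF p[OF kl(1,2)]] by auto
      then have "sgn k = sgn l" using eq w_sgn[OF kl(1,2)] w_sgn[OF kl(3,4)] \<open>p k = p l\<close> by simp
      then show ?thesis using abs by (metis mult_sgn_abs)
    qed
    have into: "w ` {- int n..int n} \<subseteq> {- int n..int n}"
    proof
      fix y assume "y \<in> w ` {- int n..int n}"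
      then obtain k where k: "k \<in> {- int n..int n}" "y = w k" by auto
      show "y \<in> {- int n..int n}"
      proof (cases "1 \<le> \<bar>k\<bar>")
        case True
        have "\<bar>k\<bar> \<le> int n" using k by auto
        from abs_w[OF True this] as[OF p[OF True this]] have "\<bar>y\<bar> \<le> int n" using k(2) by simp
        then show ?thesis by (simp add: abs_le_iff)
      next
        case False
        then show ?thesis using k by (auto simp: w_def)
      qed
    qed
    have "w permutes {- int n..int n}"
    proof (rule bij_imp_permutes)
      have "inj_on w {- int n..int n}" using inj by (auto simp: inj_on_def)
      then show "bij_betw w {- int n..int n} {- int n..int n}"
        using endo_inj_surj[OF _ into] by (simp add: bij_betw_def)
    qed (auto simp: w_def)
    moreover have "w (- k) = - w k" for k by (simp add: w_def p_def)
    ultimately have "w \<in> weyl_B n" by (simp add: weyl_B_def)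
    moreover have "window n w = as"
    proof (rule nth_equalityI)
      show "length (window n w) = length as" by (simp add: window_def len)
      fix l assume "l < length (window n w)"
      then have l: "l < n" by (simp add: window_def del: upt_Suc)
      then have "window n w ! l = height n (w (int (Suc l)))"
        by (simp add: window_def del: upt_Suc)
      also have "w (int (Suc l)) = height n (as ! l)" using l by (simp add: w_def p_def nat_add_distrib)
      finally show "window n w ! l = as ! l" using as[OF l] by (simp add: height_height)
    qed
    ultimately show "as \<in> window n ` weyl_B n" by blast
  qed
qed

lemma weyl_B_length_generating_function:
  fixes q :: "'a::comm_semiring_1"
  shows "(\<Sum>w\<in>weyl_B n. q ^ inv_length n w) = (\<Prod>k\<in>{1..n}. \<Sum>j<2 * k. q ^ j)"
proof -
  have "(\<Sum>w\<in>weyl_B n. q ^ inv_length n w) = (\<Sum>as\<in>signed_arrangements {1..int n}. q ^ inversions as)"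
    unfolding inv_length_def by (rule sum.reindex_bij_betw[OF window_bij])
  then show ?thesis using sum_signed_inversions(1)[of "{1..int n}" q] by simp
qed

section \<open>The word property\<close>

definition reduced_word :: "nat \<Rightarrow> nat list \<Rightarrow> bool" where
  "reduced_word n js \<longleftrightarrow> set js \<subseteq> {1..n} \<and> length js = inv_length n (word_value n js)"

text \<open>
  A congruence on words that contains the braid relations. The relation of interest identifies two words
  if the corresponding products of Demazure operators agree up to sign.
\<close>

locale word_congruence =
  fixes n :: nat and R :: "nat list \<Rightarrow> nat list \<Rightarrow> bool"
  assumes R_refl: "R js js"
    and R_sym: "R js ks \<Longrightarrow> R ks js"
    and R_trans: "R js ks \<Longrightarrow> R ks ls \<Longrightarrow> R js ls"
    and R_context: "set (p @ js @ ks @ r) \<subseteq> {1..n} \<Longrightarrow> R js ks \<Longrightarrow> R (p @ js @ r) (p @ ks @ r)"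
    and R_far: "1 \<le> i \<Longrightarrow> i + 2 \<le> j \<Longrightarrow> j \<le> n \<Longrightarrow> R [i, j] [j, i]"
    and R_braid_3: "1 \<le> i \<Longrightarrow> Suc i < n \<Longrightarrow> R [i, Suc i, i] [Suc i, i, Suc i]"
    and R_braid_4: "1 \<le> i \<Longrightarrow> Suc i = n \<Longrightarrow> R [i, n, i, n] [n, i, n, i]"
begin

text \<open>
  If \<open>i\<close> and \<open>j\<close> are both right descents of \<open>w\<close>, then \<open>w\<close> is a product, with lengths adding, of some
  element and the longest element of the dihedral group of \<open>s\<^sub>i\<close> and \<open>s\<^sub>j\<close>: reading the window shows that
  multiplying \<open>w\<close> alternately by \<open>s\<^sub>i\<close> and \<open>s\<^sub>j\<close> keeps decreasing the length. The two reduced words of that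
  dihedral element are the two sides of a braid relation.
\<close>

lemma braid_witness:
  assumes w: "w \<in> weyl_B n" and "1 \<le> i" "i < j" "j \<le> n"
    and di: "descent n w i" and dj: "descent n w j"
  shows "\<exists>ps qs. set (ps @ qs) \<subseteq> {1..n} \<and> word_value n (ps @ [i]) = w \<and> word_value n (qs @ [j]) = w \<and>
    Suc (length ps) = inv_length n w \<and> Suc (length qs) = inv_length n w \<and> R (ps @ [i]) (qs @ [j])"
proof -
  let ?s = "simple_refl n" and ?l = "inv_length n"
  have ij: "i \<in> {1..n}" "j \<in> {1..n}" "i < n" using assms by auto
  have W: "u \<circ> ?s k \<in> weyl_B n" if "u \<in> weyl_B n" "k \<in> {1..n}" for u k
    using that by (intro weyl_B_comp simple_refl_weyl_B)
  note down = inv_length_simple_refl(1)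
  have cancel: "u \<circ> ?s k \<circ> ?s k = u" if "k \<in> {1..n}" for u k
    by (rule comp_simple_refl_cancel[OF that])
  let ?h = "\<lambda>u k. height n (u (int k))"
  have at: "?h (u \<circ> ?s k) l = (if k < n then if l = k then ?h u (Suc k) else if l = Suc k then ?h u k else ?h u l
      else if l = n then - ?h u n else ?h u l)" if "u \<in> weyl_B n" "k \<in> {1..n}" "l \<in> {1..n}" for u k l
    using that by (auto simp: simple_refl_at weyl_BD(1) simp del: of_nat_Suc)
  have lw: "?l w = Suc (?l (w \<circ> ?s i))" by (rule down[OF w ij(1) di])
  consider (far) "i + 2 \<le> j" | (braid3) "j = Suc i" "Suc i < n" | (braid4) "j = n" "Suc i = n"
    using assms by linarith
  then show ?thesis
  proof cases
    case far
    let ?u = "w \<circ> ?s i \<circ> ?s j"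
    have "descent n (w \<circ> ?s i) j"
      using dj far ij at[OF w ij(1)] by (auto simp: descent_def simp del: comp_apply of_nat_Suc)
    from down[OF W[OF w ij(1)] ij(2) this] have lu: "?l w = Suc (Suc (?l ?u))" using lw by simp
    obtain ms where ms: "set ms \<subseteq> {1..n}" "word_value n ms = ?u" "length ms = ?l ?u"
      using reduced_word_exists[OF W[OF W[OF w ij(1)] ij(2)]] .
    have c: "?s i \<circ> ?s j = ?s j \<circ> ?s i" using assms far by (intro simple_refl_far_commute) auto
    have "word_value n ((ms @ [j]) @ [i]) = w \<circ> ?s i \<circ> ?s j \<circ> ?s j \<circ> ?s i"
      using ms by (simp add: word_value_append flip: comp_assoc)
    then have "word_value n ((ms @ [j]) @ [i]) = w" unfolding cancel[OF ij(2)] cancel[OF ij(1)] .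
    moreover have "word_value n ((ms @ [i]) @ [j]) = w \<circ> ?s i \<circ> ?s j \<circ> (?s i \<circ> ?s j)"
      using ms by (simp add: word_value_append flip: comp_assoc)
    then have "word_value n ((ms @ [i]) @ [j]) = w"
      unfolding c by (simp only: comp_assoc[symmetric] cancel[OF ij(2)] cancel[OF ij(1)])
    moreover have "R (ms @ [j, i] @ []) (ms @ [i, j] @ [])"
      using ms ij assms far by (intro R_context R_sym[OF R_far]) auto
    ultimately show ?thesis
      using ms ij lu by (intro exI[of _ "ms @ [j]"] exI[of _ "ms @ [i]"]) auto
  next
    case braid3
    let ?u1 = "w \<circ> ?s i" and ?u2 = "w \<circ> ?s i \<circ> ?s j" and ?u = "w \<circ> ?s i \<circ> ?s j \<circ> ?s i"
    note W1 = W[OF w ij(1)] and W2 = W[OF W[OF w ij(1)] ij(2)] and W3 = W[OF W[OF W[OF w ij(1)] ij(2)] ij(1)]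
    have k: "Suc (Suc i) \<in> {1..n}" "Suc i \<in> {1..n}" using braid3 by auto
    have "descent n ?u1 j"
      using di dj braid3 ij k at[OF w ij(1)] by (auto simp: descent_def simp del: comp_apply of_nat_Suc)
    note l1 = down[OF W1 ij(2) this]
    have "descent n ?u2 i"
      using di dj braid3 ij k at[OF w ij(1)] at[OF W1 ij(2)]
      by (auto simp: descent_def simp del: comp_apply of_nat_Suc)
    note l2 = down[OF W2 ij(1) this]
    have lu: "?l w = Suc (Suc (Suc (?l ?u)))" using lw l1 l2 by simp
    obtain ms where ms: "set ms \<subseteq> {1..n}" "word_value n ms = ?u" "length ms = ?l ?u"
      using reduced_word_exists[OF W3] .
    have c: "?s i \<circ> ?s j \<circ> ?s i = ?s j \<circ> ?s i \<circ> ?s j"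
      unfolding braid3(1) using assms braid3 by (intro simple_refl_braid_3) auto
    have "word_value n ((ms @ [i, j]) @ [i]) = ?u \<circ> ?s i \<circ> ?s j \<circ> ?s i"
      using ms by (simp add: word_value_append flip: comp_assoc)
    then have 1: "word_value n ((ms @ [i, j]) @ [i]) = w" unfolding cancel[OF ij(1)] cancel[OF ij(2)] .
    have "word_value n ((ms @ [j, i]) @ [j]) = w \<circ> (?s i \<circ> ?s j \<circ> ?s i) \<circ> ?s j \<circ> ?s i \<circ> ?s j"
      using ms by (simp add: word_value_append flip: comp_assoc)
    then have 2: "word_value n ((ms @ [j, i]) @ [j]) = w"
      unfolding c by (simp only: comp_assoc[symmetric] cancel[OF ij(2)] cancel[OF ij(1)])
    have "R (ms @ [i, j, i] @ []) (ms @ [j, i, j] @ [])"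
      using ms ij assms braid3 by (intro R_context) (auto intro: R_braid_3)
    with 1 2 show ?thesis
      using ms ij lu by (intro exI[of _ "ms @ [i, j]"] exI[of _ "ms @ [j, i]"]) auto
  next
    case braid4
    let ?u1 = "w \<circ> ?s i" and ?u2 = "w \<circ> ?s i \<circ> ?s j" and ?u3 = "w \<circ> ?s i \<circ> ?s j \<circ> ?s i"
      and ?u = "w \<circ> ?s i \<circ> ?s j \<circ> ?s i \<circ> ?s j"
    note W1 = W[OF w ij(1)] and W2 = W[OF W[OF w ij(1)] ij(2)] and W3 = W[OF W[OF W[OF w ij(1)] ij(2)] ij(1)]
      and W4 = W[OF W[OF W[OF W[OF w ij(1)] ij(2)] ij(1)] ij(2)]
    have k: "Suc i \<in> {1..n}" using braid4 by auto
    have h: "?h w i < ?h w n" "?h w n < 0" using di dj braid4 by (auto simp: descent_def simp del: of_nat_Suc)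
    have h1: "?h ?u1 i = ?h w n" "?h ?u1 n = ?h w i"
      using at[OF w ij(1), of i] at[OF w ij(1), of n] ij braid4 by (auto simp del: comp_apply)
    have h2: "?h ?u2 i = ?h w n" "?h ?u2 n = - ?h w i"
      using at[OF W1 ij(2), of i] at[OF W1 ij(2), of n] ij braid4 h1 by (auto simp del: comp_apply)
    have h3: "?h ?u3 n = ?h w n"
      using at[OF W2 ij(1), of n] ij braid4 h2 by (auto simp del: comp_apply)
    have l1: "?l ?u1 = Suc (?l ?u2)"
      using h h1 braid4 by (intro down[OF W1 ij(2)]) (auto simp: descent_def simp del: comp_apply)
    have l2: "?l ?u2 = Suc (?l ?u3)"
      using h h2 braid4 by (intro down[OF W2 ij(1)]) (auto simp: descent_def simp del: comp_apply of_nat_Suc)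
    have l3: "?l ?u3 = Suc (?l ?u)"
      using h h3 braid4 by (intro down[OF W3 ij(2)]) (auto simp: descent_def simp del: comp_apply)
    have lu: "?l w = Suc (Suc (Suc (Suc (?l ?u))))" using lw l1 l2 l3 by simp
    obtain ms where ms: "set ms \<subseteq> {1..n}" "word_value n ms = ?u" "length ms = ?l ?u"
      using reduced_word_exists[OF W4] .
    have c: "?s i \<circ> ?s j \<circ> ?s i \<circ> ?s j = ?s j \<circ> ?s i \<circ> ?s j \<circ> ?s i"
      unfolding braid4(1) using assms braid4 by (intro simple_refl_braid_4) auto
    have "word_value n ((ms @ [j, i, j]) @ [i]) = ?u \<circ> ?s j \<circ> ?s i \<circ> ?s j \<circ> ?s i"
      using ms by (simp add: word_value_append flip: comp_assoc)
    then have 1: "word_value n ((ms @ [j, i, j]) @ [i]) = w" unfolding cancel[OF ij(1)] cancel[OF ij(2)] .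
    have "word_value n ((ms @ [i, j, i]) @ [j]) = w \<circ> (?s i \<circ> ?s j \<circ> ?s i \<circ> ?s j) \<circ> ?s i \<circ> ?s j \<circ> ?s i \<circ> ?s j"
      using ms by (simp add: word_value_append flip: comp_assoc)
    then have 2: "word_value n ((ms @ [i, j, i]) @ [j]) = w"
      unfolding c by (simp only: comp_assoc[symmetric] cancel[OF ij(2)] cancel[OF ij(1)])
    have "R [j, i, j, i] [i, j, i, j]"
      using R_sym[OF R_braid_4] assms braid4 by auto
    then have "R (ms @ [j, i, j, i] @ []) (ms @ [i, j, i, j] @ [])"
      using ms ij by (intro R_context) auto
    with 1 2 show ?thesis
      using ms ij lu by (intro exI[of _ "ms @ [j, i, j]"] exI[of _ "ms @ [i, j, i]"]) auto
  qed
qed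

lemma reduced_last:
  assumes "reduced_word n (js @ [i])"
  shows "reduced_word n js" "descent n (word_value n (js @ [i])) i" "i \<in> {1..n}"
    "word_value n js = word_value n (js @ [i]) \<circ> simple_refl n i"
proof -
  from assms have i: "i \<in> {1..n}" and js: "set js \<subseteq> {1..n}"
    and len: "Suc (length js) = inv_length n (word_value n (js @ [i]))" by (auto simp: reduced_word_def)
  show "i \<in> {1..n}" by (rule i)
  have v: "word_value n (js @ [i]) = word_value n js \<circ> simple_refl n i" by (simp add: word_value_append)
  show eq: "word_value n js = word_value n (js @ [i]) \<circ> simple_refl n i"
    unfolding v comp_simple_refl_cancel[OF i] ..
  have W: "word_value n (js @ [i]) \<in> weyl_B n" using js i by (intro word_value_weyl_B) auto
  have le: "inv_length n (word_value n js) \<le> length js" by (rule inv_length_word_value[OF js])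
  show d: "descent n (word_value n (js @ [i])) i"
    using inv_length_simple_refl(2)[OF W i] le len unfolding eq[symmetric] by fastforce
  show "reduced_word n js"
    using inv_length_simple_refl(1)[OF W i d] len js unfolding eq[symmetric] by (simp add: reduced_word_def)
qed

text \<open>
  The word property of Matsumoto and Tits, by induction on the length. Words with the same last letter
  are compared by removing it; otherwise both are compared with the two words of a braid witness.
\<close>

theorem reduced_words_congruent:
  assumes "reduced_word n js" "reduced_word n ks" "word_value n js = word_value n ks"
  shows "R js ks"
  using assms
proof (induction "length js" arbitrary: js ks)
  case 0
  then have "length ks = length js" unfolding reduced_word_def by metis
  then have "js = []" "ks = []" using 0 by auto
  then show ?case by (simp add: R_refl)
next
  case (Suc m)
  have len: "length ks = Suc m" using Suc by (simp add: reduced_word_def)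
  obtain js' i where js: "js = js' @ [i]" using Suc.hyps(2) by (metis length_Suc_conv_rev)
  obtain ks' j where ks: "ks = ks' @ [j]" using len by (metis length_Suc_conv_rev)
  note rj = reduced_last[OF Suc.prems(1)[unfolded js], folded js]
    and rk = reduced_last[OF Suc.prems(2)[unfolded ks], folded ks]
  have IH: "R ps qs" if "reduced_word n ps" "reduced_word n qs" "word_value n ps = word_value n qs" "length ps = m"
    for ps qs using Suc.hyps(1)[of ps qs] that by simp
  have append: "R (ps @ [k]) (qs @ [k])" if "R ps qs" "set (ps @ qs) \<subseteq> {1..n}" "k \<in> {1..n}" for ps qs k
    using R_context[of "[]" ps qs "[k]"] that by auto
  have sub: "set js' \<subseteq> {1..n}" "set ks' \<subseteq> {1..n}" using rj(1) rk(1) by (auto simp: reduced_word_def)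
  let ?w = "word_value n js"
  have W: "?w \<in> weyl_B n" using Suc.prems(1) unfolding reduced_word_def by (blast intro: word_value_weyl_B)
  have lw: "inv_length n ?w = Suc m" using Suc by (simp add: reduced_word_def)
  have tail: "R us ps" if "us @ [k] = js \<or> us @ [k] = ks" "reduced_word n us" "set ps \<subseteq> {1..n}"
    "word_value n (ps @ [k]) = ?w" "Suc (length ps) = inv_length n ?w" for us ps k
  proof (rule IH)
    have "reduced_word n (ps @ [k])"
      using that Suc.prems len lw by (auto simp: reduced_word_def)
    note rp = reduced_last[OF this]
    show "reduced_word n us" by (rule that)
    show "reduced_word n ps" by (rule rp)
    have "word_value n us = ?w \<circ> simple_refl n k"
      using that(1) rj(4) rk(4) Suc.prems(3) js ks by auto
    then show "word_value n us = word_value n ps" using rp(4) that(4) by simp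
    show "length us = m" using that(1) len Suc.hyps(2) by auto
  qed
  show ?case
  proof (cases i j rule: linorder_cases)
    case equal
    have "R js' ks'"
      using rj rk Suc.prems(3) Suc.hyps(2) equal by (intro IH) (auto simp: js)
    then show ?thesis unfolding js ks equal using sub rk(3) by (intro append) auto
  next
    case less
    from braid_witness[OF W _ this] rj rk Suc.prems(3) obtain ps qs where
      pq: "set (ps @ qs) \<subseteq> {1..n}" "word_value n (ps @ [i]) = ?w" "word_value n (qs @ [j]) = ?w"
        "Suc (length ps) = inv_length n ?w" "Suc (length qs) = inv_length n ?w" "R (ps @ [i]) (qs @ [j])"
      by auto
    have "R js' ps" using pq rj js by (intro tail[of _ i]) auto
    then have 1: "R js (ps @ [i])" unfolding js using sub pq rj(3) by (intro append) auto
    have "R ks' qs" using pq rk ks by (intro tail[of _ j]) auto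
    then have 2: "R ks (qs @ [j])" unfolding ks using sub pq rk(3) by (intro append) auto
    show ?thesis by (rule R_trans[OF R_trans[OF 1 pq(6)] R_sym[OF 2]])
  next
    case greater
    from braid_witness[OF W _ this] rj rk Suc.prems(3) obtain ps qs where
      pq: "set (ps @ qs) \<subseteq> {1..n}" "word_value n (ps @ [j]) = ?w" "word_value n (qs @ [i]) = ?w"
        "Suc (length ps) = inv_length n ?w" "Suc (length qs) = inv_length n ?w" "R (ps @ [j]) (qs @ [i])"
      by auto
    have "R js' qs" using pq rj js by (intro tail[of _ i]) auto
    then have 1: "R js (qs @ [i])" unfolding js using sub pq rj(3) by (intro append) auto
    have "R ks' ps" using pq rk ks by (intro tail[of _ j]) auto
    then have 2: "R ks (ps @ [j])" unfolding ks using sub pq rk(3) by (intro append) auto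
    show ?thesis by (rule R_trans[OF R_trans[OF 1 R_sym[OF pq(6)]] R_sym[OF 2]])
  qed
qed

text \<open>
  At the first letter where a word stops being reduced, that letter is a right descent of the prefix, which
  is thus congruent to a reduced word ending in the same letter.
\<close>

lemma nonreduced_word_repeats:
  assumes "set js \<subseteq> {1..n}" "\<not> reduced_word n js"
  shows "\<exists>ps i qs. set (ps @ i # qs) \<subseteq> {1..n} \<and> R js (ps @ [i, i] @ qs)"
  using assms
proof (induction js rule: rev_induct)
  case Nil
  then show ?case by (simp add: reduced_word_def inv_length_id)
next
  case (snoc i js)
  then have i: "i \<in> {1..n}" and js: "set js \<subseteq> {1..n}" by auto
  show ?case
  proof (cases "reduced_word n js")
    case False
    then obtain ps k qs where *: "set (ps @ k # qs) \<subseteq> {1..n}" "R js (ps @ [k, k] @ qs)"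
      using snoc.IH js by auto
    then have "R ([] @ js @ [i]) ([] @ (ps @ [k, k] @ qs) @ [i])"
      using js i by (intro R_context) auto
    then show ?thesis using * i by (intro exI[of _ ps] exI[of _ k] exI[of _ "qs @ [i]"]) auto
  next
    case True
    let ?w = "word_value n js"
    have W: "?w \<in> weyl_B n" using js by (rule word_value_weyl_B)
    have v: "word_value n (js @ [i]) = ?w \<circ> simple_refl n i" by (simp add: word_value_append)
    have lw: "length js = inv_length n ?w" using True by (simp add: reduced_word_def)
    have "descent n ?w i"
    proof (rule ccontr)
      assume "\<not> descent n ?w i"
      then have "inv_length n (word_value n (js @ [i])) = Suc (length js)"
        using inv_length_simple_refl(2)[OF W i] lw unfolding v by simp
      then show False using snoc.prems by (simp add: reduced_word_def del: word_value_simps)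
    qed
    then have l: "inv_length n ?w = Suc (inv_length n (?w \<circ> simple_refl n i))"
      by (rule inv_length_simple_refl(1)[OF W i])
    have "?w \<circ> simple_refl n i \<in> weyl_B n" using W i by (intro weyl_B_comp simple_refl_weyl_B)
    then obtain ps where ps: "set ps \<subseteq> {1..n}" "word_value n ps = ?w \<circ> simple_refl n i"
      "length ps = inv_length n (?w \<circ> simple_refl n i)" by (rule reduced_word_exists)
    have "word_value n (ps @ [i]) = ?w"
      using comp_simple_refl_cancel[OF i, of ?w] ps(2) by (simp add: word_value_append)
    then have "R js (ps @ [i])"
      using True ps i l by (intro reduced_words_congruent) (auto simp: reduced_word_def)
    then have "R ([] @ js @ [i]) ([] @ (ps @ [i]) @ [i])"
      using js i ps by (intro R_context) auto
    then show ?thesis using ps i by (intro exI[of _ ps] exI[of _ i] exI[of _ "[]"]) auto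
  qed
qed

end

section \<open>Products of Demazure operators\<close>

definition demazure_word :: "nat list \<Rightarrow> 'n::finite skew_pol \<Rightarrow> 'n skew_pol" where
  "demazure_word js = foldr (\<lambda>i D. demazure i \<circ> D) js id"

lemma demazure_word_simps [simp]:
  "demazure_word [] f = f" "demazure_word (j # js) f = demazure j (demazure_word js f)"
  by (simp_all add: demazure_word_def)

lemma demazure_word_append [simp]:
  "demazure_word (js @ ks) f = demazure_word js (demazure_word ks f)"
  by (induction js) simp_all

lemma demazure_word_additive:
  fixes f g :: "'n::finite skew_pol"
  assumes "set js \<subseteq> {1..CARD('n)}"
  shows "demazure_word js (0 :: 'n skew_pol) = 0"
    "demazure_word js (f + g) = demazure_word js f + demazure_word js g"
    "demazure_word js (- f) = - demazure_word js f"
    "demazure_word js (f - g) = demazure_word js f - demazure_word js g"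
  using assms by (induction js) (simp_all add: demazure_additive)

lemma demazure_word_sum:
  fixes g :: "'i \<Rightarrow> 'n::finite skew_pol"
  assumes "set js \<subseteq> {1..CARD('n)}"
  shows "demazure_word js (\<Sum>i\<in>I. g i) = (\<Sum>i\<in>I. demazure_word js (g i))"
  by (induction I rule: infinite_finite_induct) (simp_all add: demazure_word_additive[OF assms])

lemma demazure_word_minus_one_power:
  fixes f :: "'n::finite skew_pol"
  assumes "set js \<subseteq> {1..CARD('n)}"
  shows "demazure_word js ((- 1) ^ s * f) = (- 1) ^ s * demazure_word js f"
  by (cases "even s") (simp_all add: demazure_word_additive[OF assms])

lemma demazure_word_homog:
  assumes "set js \<subseteq> {1..CARD('n)}" "f \<in> (homog d :: 'n::finite skew_pol set)"
  shows "demazure_word js f \<in> homog (d - 2 * length js)"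
    and "d < 2 * length js \<Longrightarrow> demazure_word js f = 0"
proof -
  have "demazure_word js f \<in> homog (d - 2 * length js) \<and> (d < 2 * length js \<longrightarrow> demazure_word js f = 0)"
    using assms(1)
  proof (induction js)
    case (Cons j js)
    then have j: "j \<in> {1..CARD('n)}" and IH: "demazure_word js f \<in> homog (d - 2 * length js)"
      "d < 2 * length js \<Longrightarrow> demazure_word js f = 0" by auto
    have vanish: "demazure j (demazure_word js f) = 0" if "d < 2 * length (j # js)"
    proof (cases "d \<le> 2 * length js")
      case True
      then show ?thesis using demazure_homog(2)[OF j IH(1)] by simp
    next
      case False
      then have "d - 2 * length js = 1" using that by simp
      then have "demazure_word js f \<in> homog 1" using IH(1) by (simp only:)
      moreover have "g = 0" if "g \<in> homog 1" for g :: "'n skew_pol"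
        using that by (induction g rule: homog.induct) auto
      ultimately have "demazure_word js f = 0" by blast
      then show ?thesis using j by (simp add: demazure_additive)
    qed
    then show ?case using demazure_homog(1)[OF j IH(1)] by (simp add: diff_diff_left add.commute)
  qed (use assms in simp)
  then show "demazure_word js f \<in> homog (d - 2 * length js)"
    and "d < 2 * length js \<Longrightarrow> demazure_word js f = 0" by auto
qed

lemma demazure_word_mult_right:
  fixes f g :: "'n::finite skew_pol"
  assumes "set js \<subseteq> {1..CARD('n)}" "\<And>j. j \<in> set js \<Longrightarrow> demazure j g = 0"
  shows "demazure_word js (f * g) = demazure_word js f * g"
  using assms by (induction js) (simp_all add: demazure_mult)

definition demazure_equiv :: "'n::finite itself \<Rightarrow> nat list \<Rightarrow> nat list \<Rightarrow> bool" where
  "demazure_equiv _ js ks \<longleftrightarrow> (\<forall>f :: 'n skew_pol. demazure_word js f = demazure_word ks f) \<or>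
     (\<forall>f :: 'n skew_pol. demazure_word js f = - demazure_word ks f)"

lemma word_congruence_demazure: "word_congruence CARD('n) (demazure_equiv TYPE('n::finite))"
proof
  fix js ks ls p r i j
  show "demazure_equiv TYPE('n) js js" by (simp add: demazure_equiv_def)
  show "demazure_equiv TYPE('n) ks js" if "demazure_equiv TYPE('n) js ks"
    using that by (auto simp: demazure_equiv_def)
  show "demazure_equiv TYPE('n) js ls" if "demazure_equiv TYPE('n) js ks" "demazure_equiv TYPE('n) ks ls"
    using that by (auto simp: demazure_equiv_def)
  show "demazure_equiv TYPE('n) (p @ js @ r) (p @ ks @ r)"
    if "set (p @ js @ ks @ r) \<subseteq> {1..CARD('n)}" "demazure_equiv TYPE('n) js ks"
  proof -
    have "set p \<subseteq> {1..CARD('n)}" using that by simp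
    with that(2) show ?thesis by (auto simp: demazure_equiv_def demazure_word_additive)
  qed
  show "demazure_equiv TYPE('n) [i, j] [j, i]" if "1 \<le> i" "i + 2 \<le> j" "j \<le> CARD('n)"
    using demazure_far_commute[OF that] by (simp add: demazure_equiv_def)
  show "demazure_equiv TYPE('n) [i, Suc i, i] [Suc i, i, Suc i]" if "1 \<le> i" "Suc i < CARD('n)"
    using demazure_braid_3[OF that] by (simp add: demazure_equiv_def)
  show "demazure_equiv TYPE('n) [i, CARD('n), i, CARD('n)] [CARD('n), i, CARD('n), i]"
    if "1 \<le> i" "Suc i = CARD('n)"
    using demazure_braid_4[OF that] unfolding that(2) by (simp add: demazure_equiv_def)
qed

lemma demazure_word_nonreduced:
  fixes f :: "'n::finite skew_pol"
  assumes "set js \<subseteq> {1..CARD('n)}" "\<not> reduced_word CARD('n) js"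
  shows "demazure_word js f = 0"
proof -
  from word_congruence.nonreduced_word_repeats[OF word_congruence_demazure assms]
  obtain ps i qs where *: "set (ps @ i # qs) \<subseteq> {1..CARD('n)}"
    "demazure_equiv TYPE('n) js (ps @ [i, i] @ qs)" by blast
  then have "demazure_word (ps @ [i, i] @ qs) f = 0"
    by (simp add: demazure_square demazure_word_additive)
  then show ?thesis using *(2) unfolding demazure_equiv_def by (metis neg_equal_0_iff_equal)
qed

text \<open>
  Words of equal value and length are both reduced, and then the word property applies, or both
  non-reduced, and then both products vanish.
\<close>

lemma demazure_word_same_value:
  fixes f :: "'n::finite skew_pol"
  assumes "set js \<subseteq> {1..CARD('n)}" "set ks \<subseteq> {1..CARD('n)}"
    and "word_value CARD('n) js = word_value CARD('n) ks" "length js = length ks"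
  shows "demazure_word js f = demazure_word ks f \<or> demazure_word js f = - demazure_word ks f"
proof (cases "reduced_word CARD('n) js")
  case True
  then have "reduced_word CARD('n) ks" using assms by (simp add: reduced_word_def)
  from word_congruence.reduced_words_congruent[OF word_congruence_demazure True this assms(3)]
  show ?thesis by (auto simp: demazure_equiv_def)
next
  case False
  moreover from this have "\<not> reduced_word CARD('n) ks" using assms by (simp add: reduced_word_def)
  ultimately show ?thesis using assms by (simp add: demazure_word_nonreduced)
qed

section \<open>The top-degree evaluation\<close>

text \<open>
  The word \<open>k, k + 1, \<dots>, n, \<dots>, k + 1, k\<close> of the reflection that negates the coordinate \<open>k\<close>.
\<close>

definition hook :: "nat \<Rightarrow> nat \<Rightarrow> nat list" where
  "hook n k = [k..<n] @ n # rev [k..<n]"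

lemma hook_last: "hook n n = [n]"
  by (simp add: hook_def)

lemma hook_rec: "k < n \<Longrightarrow> hook n k = k # hook n (Suc k) @ [k]"
  by (simp add: hook_def upt_conv_Cons)

lemma set_hook: "k \<le> n \<Longrightarrow> set (hook n k) = {k..n}"
  by (auto simp: hook_def)

lemma length_hook: "length (hook n k) = 2 * (n - k) + 1"
  by (simp add: hook_def)

lemma transpose_negative_weyl_B: "k \<in> {1..n} \<Longrightarrow> transpose (int k) (- int k) \<in> weyl_B n"
  by (auto simp: weyl_B_def Transposition.transpose_def intro!: permutes_swap_id)

lemma word_value_hook:
  assumes "1 \<le> k" "k \<le> n"
  shows "word_value n (hook n k) = transpose (int k) (- int k)"
proof -
  have "1 \<le> k \<longrightarrow> word_value n (hook n k) = transpose (int k) (- int k)"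
    using assms(2)
  proof (induction rule: inc_induct)
    case base
    then show ?case by (simp add: hook_last simple_refl_def)
  next
    case (step k)
    show ?case
    proof
      assume k: "1 \<le> k"
      have "word_value n (hook n k) = simple_refl n k \<circ> transpose (int (Suc k)) (- int (Suc k)) \<circ> simple_refl n k"
        using step k by (simp add: hook_rec word_value_append comp_assoc)
      also have "\<dots> = transpose (int k) (- int k)"
        using step k by (intro weyl_B_ext[of _ n] weyl_B_comp simple_refl_weyl_B transpose_negative_weyl_B)
          (auto simp: simple_refl_at weyl_BD(1)[OF simple_refl_weyl_B] Transposition.transpose_def
            simp del: of_nat_Suc)
      finally show "word_value n (hook n k) = transpose (int k) (- int k)" .
    qed
  qed
  then show ?thesis using assms by simp
qed

text \<open>
  Negating the coordinate \<open>k\<close> commutes with a simple reflection that leaves this coordinate alone, so that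
  the hook followed or preceded by \<open>j\<close> gives two words of the same value and length.
\<close>

lemma hook_commute:
  fixes f :: "'n::finite skew_pol"
  assumes "1 \<le> k" "k < j" "j \<le> CARD('n)"
  shows "demazure j (demazure_word (hook CARD('n) k) f) = demazure_word (hook CARD('n) k) (demazure j f) \<or>
    demazure j (demazure_word (hook CARD('n) k) f) = - demazure_word (hook CARD('n) k) (demazure j f)"
proof -
  let ?n = "CARD('n)" and ?t = "transpose (int k) (- int k)"
  have v: "word_value ?n (hook ?n k) = ?t" using assms by (intro word_value_hook) auto
  have "simple_refl ?n j \<circ> ?t = ?t \<circ> simple_refl ?n j"
    using assms by (intro weyl_B_ext[of _ ?n] weyl_B_comp simple_refl_weyl_B transpose_negative_weyl_B)
      (auto simp: simple_refl_at weyl_BD(1)[OF simple_refl_weyl_B] Transposition.transpose_def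
        simp del: of_nat_Suc)
  then have "word_value ?n (j # hook ?n k) = word_value ?n (hook ?n k @ [j])"
    by (simp add: word_value_append v)
  then show ?thesis
    using demazure_word_same_value[of "j # hook ?n k" "hook ?n k @ [j]" f] assms
    by (simp add: set_hook)
qed

lemma demazure_power_other:
  assumes "i \<in> {1..CARD('n)}" "j \<in> {1..CARD('n)}" "j \<noteq> i" "i < CARD('n) \<Longrightarrow> j \<noteq> Suc i"
  shows "demazure i (X j ^ m) = (0 :: 'n::finite skew_pol)"
  using assms by (induction m) (auto simp: demazure_additive demazure_X_mult)

lemma demazure_power:
  assumes "1 \<le> k" "k < CARD('n)"
  shows "demazure k (X k ^ m) = (\<Sum>a<m. (- 1) ^ a * X (Suc k) ^ a * X k ^ (m - 1 - a) :: 'n::finite skew_pol)"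
proof (induction m)
  case 0
  show ?case using assms by (simp add: demazure_additive)
next
  case (Suc m)
  have "demazure k (X k ^ Suc m) = X k ^ m - X (Suc k) * demazure k (X k ^ m :: 'n skew_pol)"
    using assms by (simp add: demazure_A_X_mult)
  also have "\<dots> = X k ^ m + (\<Sum>a<m. (- 1) ^ Suc a * X (Suc k) ^ Suc a * X k ^ (m - 1 - a))"
    unfolding Suc sum_distrib_left
    by (simp add: minus_one_power_commute mult.assoc sum_negf flip: mult.assoc)
  also have "\<dots> = (\<Sum>a<Suc m. (- 1) ^ a * X (Suc k) ^ a * X k ^ (Suc m - 1 - a))"
    by (subst sum.lessThan_Suc_shift) simp
  finally show ?case .
qed

lemma sign_change_demazure:
  assumes i: "i \<in> {1..CARD('n)}" and j: "j < i"
  shows "sign_change {j} (demazure i f) = demazure i (sign_change {j} f :: 'n::finite skew_pol)"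
proof (induction f rule: skew_pol_induct)
  case (X_mult l f)
  let ?l = "if i < CARD('n) then transpose i (i + 1) l else l"
  have l: "?l \<in> {1..CARD('n)}" "?l = j \<longleftrightarrow> l = j"
    using X_mult(1) i j by (auto simp: Transposition.transpose_def)
  have "sign_change {j} (X ?l :: 'n skew_pol) = (if l = j then - X ?l else X ?l)"
    using l(2) by (subst sign_change(2)[OF l(1)]) simp
  then show ?case
    using X_mult i j by (simp add: demazure_X_mult endo_simps demazure_additive)
qed (use i in \<open>simp_all add: demazure_additive endo_simps\<close>)

lemma endo_B_demazure:
  assumes i: "i \<in> {1..CARD('n)}"
  shows "endo_B (demazure i f) = - demazure i (endo_B f :: 'n::finite skew_pol)"
proof (induction f rule: skew_pol_induct)
  case (X_mult l f)
  let ?l = "if i < CARD('n) then transpose i (i + 1) l else l"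
  have l: "?l \<in> {1..CARD('n)}"
    using X_mult(1) i by (auto simp: Transposition.transpose_def)
  then have "endo_B (X ?l :: 'n skew_pol) = - X ?l" by (rule endo_B(2))
  then show ?case
    using X_mult i by (simp add: demazure_X_mult endo_simps demazure_additive)
qed (use i in \<open>simp_all add: demazure_additive endo_simps\<close>)

lemma alg_endo_power: "alg_endo h \<Longrightarrow> h (f ^ m) = h f ^ m"
  by (induction m) (simp_all add: alg_endoD)

text \<open>
  The result \<open>p\<close> is killed by the operators \<open>k, \<dots>, n\<close>: by the operator \<open>k\<close> because the hook begins
  with \<open>k\<close>, and by a later one because it commutes past the hook and kills \<open>x\<^sub>k\<close>. Hence \<open>p\<close> is even in
  \<open>x\<^sub>k, \<dots>, x\<^sub>n\<close>, and it is even in the earlier variables since they do not occur. But a hook has an odd number of letters, each of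
  which reverses the total parity, so that \<open>p\<close> is odd as well.
\<close>

lemma hook_even_power:
  fixes k :: nat
  assumes k: "k \<in> {1..CARD('n)}"
  shows "demazure_word (hook CARD('n) k) (X k ^ (2 * m)) = (0 :: 'n::finite skew_pol)"
proof -
  let ?js = "hook CARD('n) k" and ?f = "X k ^ (2 * m) :: 'n skew_pol"
  let ?p = "demazure_word ?js ?f"
  have js: "set ?js = {k..CARD('n)}" using k by (intro set_hook) simp
  have kill: "demazure j ?p = 0" if j: "j \<in> {k..CARD('n)}" for j
  proof (cases "j = k")
    case True
    have "\<exists>ks. ?js = k # ks" using k hook_rec[of k "CARD('n)"] hook_last by (cases "k = CARD('n)") auto
    then obtain ks where "?js = k # ks" ..
    then show ?thesis using True k by (simp add: demazure_square)
  next
    case False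
    then have "demazure j ?f = 0" using j k by (intro demazure_power_other) auto
    moreover have "demazure_word ?js (0 :: 'n skew_pol) = 0" using js k by (intro demazure_word_additive) auto
    ultimately show ?thesis using hook_commute[of k j ?f] j k False by auto
  qed
  have "sign_change {j} ?p = ?p" if j: "j \<in> {1..CARD('n)}" for j
  proof (cases "k \<le> j")
    case True
    then show ?thesis using kill k j by (intro demazure_kernel_even[of k]) auto
  next
    case False
    have "sign_change {j} (demazure_word ks g) = demazure_word ks (sign_change {j} g :: 'n skew_pol)"
      if "set ks \<subseteq> {k..CARD('n)}" for ks g
      using that False k by (induction ks) (simp_all add: sign_change_demazure)
    moreover have "sign_change {j} ?f = ?f"
      using k False by (simp add: alg_endo_power[OF sign_change(1)] sign_change(2))
    ultimately show ?thesis using js by simp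
  qed
  then have even: "endo_B ?p = ?p" by (rule endo_B_fixed)
  \<comment> \<open>each operator anticommutes with the total parity\<close>
  have "endo_B (demazure_word ks g) = (- 1) ^ length ks * demazure_word ks (endo_B g :: 'n skew_pol)"
    if "set ks \<subseteq> {k..CARD('n)}" for ks g
    using that
  proof (induction ks)
    case (Cons j ks)
    then have j: "j \<in> {1..CARD('n)}" using k by auto
    have "demazure j ((- 1) ^ s * h) = (- 1) ^ s * demazure j (h :: 'n skew_pol)" for s h
      using j by (cases "even s") (simp_all add: demazure_additive)
    then show ?case using Cons j by (simp add: endo_B_demazure)
  qed simp
  moreover have "endo_B ?f = ?f"
    using k by (simp add: alg_endo_power[OF endo_B(1)] endo_B(2) power_mult)
  ultimately have "endo_B ?p = - ?p" using js by (simp add: length_hook)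
  with even have "?p = - ?p" by simp
  then have "?p + ?p = 0" by (metis add.right_inverse)
  then have "of_nat 2 * ?p = 0" by (simp add: mult_2)
  then show ?thesis by (rule torsion_free) simp
qed

text \<open>
  Let \<open>m = n - k\<close>. The first operator turns \<open>x\<^sub>k\<^bsup>2m+1\<^esup>\<close> into the sum over \<open>a \<le> 2m\<close> of the terms
  \<open>\<plusminus> x\<^sub>k\<^sub>+\<^sub>1\<^sup>a x\<^sub>k\<^bsup>2m-a\<^esup>\<close>. The hook of \<open>k + 1\<close> has \<open>2m - 1\<close> letters and acts only on the first factor: it kills the terms
  with \<open>a < 2m - 1\<close> for degree reasons and the term with \<open>a = 2m\<close> because this exponent is even. The remaining
  term \<open>a = 2m - 1\<close> becomes \<open>\<plusminus>x\<^sub>k\<close> by induction, and the last operator makes it \<open>\<plusminus>1\<close>.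
\<close>

lemma hook_odd_power:
  assumes "1 \<le> k" "k \<le> CARD('n)"
  shows "demazure_word (hook CARD('n) k) (X k ^ (2 * (CARD('n) - k) + 1)) \<in> {1, - 1 :: 'n::finite skew_pol}"
proof -
  let ?n = "CARD('n)"
  have "1 \<le> k \<longrightarrow> demazure_word (hook ?n k) (X k ^ (2 * (?n - k) + 1)) \<in> {1, - 1 :: 'n skew_pol}"
    using assms(2)
  proof (induction rule: inc_induct)
    case base
    then show ?case by (simp add: hook_last demazure_X)
  next
    case (step k)
    show ?case
    proof
      assume k1: "1 \<le> k"
      define m where "m = ?n - k"
      have m: "m \<ge> 1" and m': "?n - Suc k = m - 1" using step by (auto simp: m_def)
      let ?js = "hook ?n (Suc k)"
      let ?D = "\<lambda>a. demazure_word ?js (X (Suc k) ^ a :: 'n skew_pol)"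
      have js: "set ?js \<subseteq> {1..?n}" "set ?js = {Suc k..?n}" using step by (auto simp: set_hook)
      have e: "2 * (?n - Suc k) + 1 = 2 * m - 1" using m m' by simp
      have "?D (2 * (?n - Suc k) + 1) \<in> {1, - 1}" using step.IH by simp
      then have IH: "?D (2 * m - 1) \<in> {1, - 1}" unfolding e .
      have "demazure_word ?js (demazure k (X k ^ (2 * m + 1) :: 'n skew_pol)) =
          (\<Sum>a<2 * m + 1. demazure_word ?js ((- 1) ^ a * (X (Suc k) ^ a * X k ^ (2 * m - a))))"
        using k1 step by (simp only: demazure_power demazure_word_sum[OF js(1)]) (simp add: mult.assoc)
      also have "\<dots> = (\<Sum>a<2 * m + 1. (- 1) ^ a * (?D a * X k ^ (2 * m - a)))"
      proof (rule sum.cong[OF refl])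
        fix a
        have "demazure_word ?js (X (Suc k) ^ a * X k ^ (2 * m - a) :: 'n skew_pol) = ?D a * X k ^ (2 * m - a)"
          using k1 step js by (intro demazure_word_mult_right) (auto intro!: demazure_power_other)
        then show "demazure_word ?js ((- 1) ^ a * (X (Suc k) ^ a * X k ^ (2 * m - a))) =
            (- 1) ^ a * (?D a * X k ^ (2 * m - a))"
          by (simp only: demazure_word_minus_one_power[OF js(1)])
      qed
      also have "\<dots> = (\<Sum>a\<in>{2 * m - 1}. (- 1) ^ a * (?D a * X k ^ (2 * m - a)))"
      proof (rule sum.mono_neutral_right)
        show "\<forall>a\<in>{..<2 * m + 1} - {2 * m - 1}. (- 1) ^ a * (?D a * X k ^ (2 * m - a)) = 0"
        proof
          fix a assume a: "a \<in> {..<2 * m + 1} - {2 * m - 1}"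
          have "?D a = 0"
          proof (cases "a = 2 * m")
            case True
            then show ?thesis using step k1 by (simp only:) (intro hook_even_power, auto)
          next
            case False
            then have "a < 2 * m - 1" using a by auto
            moreover have "X (Suc k) ^ a \<in> (homog (a * 2) :: 'n skew_pol set)"
              using step by (intro homog_power homog_X) auto
            ultimately show ?thesis
              by (intro demazure_word_homog(2)[OF js(1)]) (auto simp: length_hook m')
          qed
          then show "(- 1) ^ a * (?D a * X k ^ (2 * m - a)) = 0" by simp
        qed
      qed auto
      also have "\<dots> = - (?D (2 * m - 1) * X k)" using m by simp
      finally have "demazure_word (hook ?n k) (X k ^ (2 * m + 1)) = - demazure k (?D (2 * m - 1) * X k)"
        using step k1 by (simp add: hook_rec demazure_additive)
      also have "\<dots> \<in> {1, - 1}"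
        using IH k1 step by (auto simp: demazure_additive demazure_X)
      finally show "demazure_word (hook ?n k) (X k ^ (2 * (?n - k) + 1)) \<in> {1, - 1 :: 'n skew_pol}"
        by (simp add: m_def)
    qed
  qed
  then show ?thesis using assms by simp
qed

text \<open>
  The operators \<open>k, \<dots>, n\<close> kill the variables before \<open>x\<^sub>k\<close>, and their twists only change the signs of these variables.
\<close>

lemma demazure_word_mult_left:
  assumes "1 \<le> k" "set is \<subseteq> {1..<k}" "set js \<subseteq> {k..CARD('n)}"
  shows "\<exists>s. demazure_word js ((\<Prod>i\<leftarrow>is. X i ^ e i) * f) =
    (- 1) ^ s * ((\<Prod>i\<leftarrow>is. X i ^ e i) * demazure_word js f :: 'n::finite skew_pol)"
proof -
  have one: "\<exists>s. \<forall>g. demazure j (X i ^ m * g) = (- 1) ^ s * (X i ^ m * demazure j g :: 'n skew_pol)"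
    if ij: "i \<in> {1..<k}" "j \<in> {k..CARD('n)}" for i j m
  proof (induction m)
    case 0
    show ?case by (intro exI[of _ 0]) simp
  next
    case (Suc m)
    then obtain s where s: "demazure j (X i ^ m * g) = (- 1) ^ s * (X i ^ m * demazure j g :: 'n skew_pol)" for g
      by blast
    have "demazure j (X i * h) = - (X i * demazure j h :: 'n skew_pol)" for h
      using ij by (subst demazure_X_mult) auto
    then have "demazure j (X i ^ Suc m * g) = (- 1) ^ Suc s * (X i ^ Suc m * demazure j g :: 'n skew_pol)" for g
      using s by (simp add: mult.assoc) (simp add: minus_one_power_commute flip: mult.assoc)
    then show ?case by blast
  qed
  have list: "\<exists>s. \<forall>g. demazure j ((\<Prod>i\<leftarrow>is. X i ^ e i) * g) =
      (- 1) ^ s * ((\<Prod>i\<leftarrow>is. X i ^ e i) * demazure j g :: 'n skew_pol)"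
    if j: "j \<in> {k..CARD('n)}" and "set is \<subseteq> {1..<k}" for j "is"
    using that(2)
  proof (induction "is")
    case Nil
    show ?case by (intro exI[of _ 0]) simp
  next
    case (Cons i "is")
    then obtain s where s: "demazure j ((\<Prod>i\<leftarrow>is. X i ^ e i) * g) =
      (- 1) ^ s * ((\<Prod>i\<leftarrow>is. X i ^ e i) * demazure j g :: 'n skew_pol)" for g by auto
    obtain t where t: "demazure j (X i ^ e i * g) = (- 1) ^ t * (X i ^ e i * demazure j g :: 'n skew_pol)" for g
      using one[of i j "e i"] Cons.prems j by auto
    have "demazure j ((\<Prod>i\<leftarrow>i # is. X i ^ e i) * g) =
        (- 1) ^ (t + s) * ((\<Prod>i\<leftarrow>i # is. X i ^ e i) * demazure j g :: 'n skew_pol)" for g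
      by (simp add: mult.assoc t s power_add)
        (simp add: minus_one_power_commute[of "X i ^ e i"] flip: mult.assoc)
    then show ?case by blast
  qed
  show ?thesis using assms(3)
  proof (induction js)
    case Nil
    show ?case by (intro exI[of _ 0]) simp
  next
    case (Cons j js)
    then obtain s where s: "demazure_word js ((\<Prod>i\<leftarrow>is. X i ^ e i) * f) =
      (- 1) ^ s * ((\<Prod>i\<leftarrow>is. X i ^ e i) * demazure_word js f :: 'n skew_pol)" by auto
    obtain t where t: "demazure j ((\<Prod>i\<leftarrow>is. X i ^ e i) * g) =
      (- 1) ^ t * ((\<Prod>i\<leftarrow>is. X i ^ e i) * demazure j g :: 'n skew_pol)" for g
      using list[of j "is"] Cons.prems assms(2) by auto
    have "j \<in> {1..CARD('n)}" using Cons.prems assms(1) by auto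
    then have "demazure j ((- 1) ^ s * h) = (- 1) ^ s * demazure j (h :: 'n skew_pol)" for h
      using demazure_word_minus_one_power[of "[j]" s h] by simp
    then have "demazure_word (j # js) ((\<Prod>i\<leftarrow>is. X i ^ e i) * f) =
      (- 1) ^ (s + t) * ((\<Prod>i\<leftarrow>is. X i ^ e i) * demazure_word (j # js) f :: 'n skew_pol)"
      by (simp add: s t power_add mult.assoc)
    then show ?case by blast
  qed
qed

text \<open>
  For \<open>k = n\<close> these are the monomial that defines the Schubert polynomials and a reduced word of the
  longest element; for smaller \<open>k\<close> they are the partial products in the induction.
\<close>

definition staircase :: "nat \<Rightarrow> 'n::finite skew_pol" where
  "staircase k = (\<Prod>i\<leftarrow>[1..<k + 1]. X i ^ (2 * (CARD('n) - i) + 1))"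

definition hooks :: "nat \<Rightarrow> nat \<Rightarrow> nat list" where
  "hooks n k = concat (map (hook n) [1..<k + 1])"

lemma staircase_Suc: "staircase (Suc k) = staircase k * (X (Suc k) ^ (2 * (CARD('n) - Suc k) + 1) :: 'n::finite skew_pol)"
  by (simp add: staircase_def)

lemma hooks_Suc: "hooks n (Suc k) = hooks n k @ hook n (Suc k)"
  by (simp add: hooks_def)

lemma hooks_0: "hooks n 0 = []" and staircase_0: "staircase 0 = 1"
  by (simp_all add: hooks_def staircase_def)

lemma set_hooks: "k \<le> n \<Longrightarrow> set (hooks n k) \<subseteq> {1..n}"
  by (induction k) (auto simp: hooks_0 hooks_Suc set_hook)

lemma length_hooks: "k \<le> n \<Longrightarrow> length (hooks n k) + k\<^sup>2 = 2 * n * k"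
proof (induction k)
  case (Suc k)
  then obtain d where "n = Suc k + d" by (metis le_iff_add)
  with Suc show ?case by (simp add: hooks_Suc length_hook power2_eq_square algebra_simps)
qed (simp add: hooks_0)

lemma word_value_hooks:
  "k \<le> n \<Longrightarrow> word_value n (hooks n k) = (\<lambda>x. if \<bar>x\<bar> \<le> int k then - x else x)"
proof (induction k)
  case 0
  show ?case by (auto simp: hooks_0 fun_eq_iff)
next
  case (Suc k)
  then have "word_value n (hooks n (Suc k)) =
    (\<lambda>x. if \<bar>x\<bar> \<le> int k then - x else x) \<circ> transpose (int (Suc k)) (- int (Suc k))"
    by (simp add: hooks_Suc word_value_append word_value_hook del: of_nat_Suc)
  also have "\<dots> = (\<lambda>x. if \<bar>x\<bar> \<le> int (Suc k) then - x else x)"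
    by (auto simp: fun_eq_iff Transposition.transpose_def)
  finally show ?case .
qed

lemma staircase_homog:
  "k \<le> CARD('n) \<Longrightarrow> staircase k \<in> (homog (2 * length (hooks CARD('n) k)) :: 'n::finite skew_pol set)"
proof (induction k)
  case 0
  show ?case by (simp add: hooks_0 staircase_0 homog_one)
next
  case (Suc k)
  then have "staircase (Suc k) \<in> (homog (2 * length (hooks CARD('n) k) +
      (2 * (CARD('n) - Suc k) + 1) * 2) :: 'n skew_pol set)"
    unfolding staircase_Suc by (intro homog_mult homog_power homog_X) auto
  then show ?case by (simp add: hooks_Suc length_hook algebra_simps)
qed

text \<open>
  The last hook acts only on the last factor, up to a sign, and turns it into \<open>\<plusminus>1\<close>.
\<close>

lemma hooks_staircase:
  "k \<le> CARD('n) \<Longrightarrow> demazure_word (hooks CARD('n) k) (staircase k) \<in> {1, - 1 :: 'n::finite skew_pol}"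
proof (induction k)
  case 0
  show ?case by (simp add: hooks_0 staircase_0)
next
  case (Suc k)
  let ?h = "hook CARD('n) (Suc k)" and ?f = "X (Suc k) ^ (2 * (CARD('n) - Suc k) + 1) :: 'n skew_pol"
  have sub: "set (hooks CARD('n) k) \<subseteq> {1..CARD('n)}" using Suc.prems by (intro set_hooks) simp
  have "set ?h \<subseteq> {Suc k..CARD('n)}" "set [1..<k + 1] \<subseteq> {1..<Suc k}" using Suc.prems by (auto simp: set_hook)
  from demazure_word_mult_left[OF _ this(2,1), of "\<lambda>i. 2 * (CARD('n) - i) + 1" ?f]
  obtain s where s: "demazure_word ?h (staircase k * ?f) = (- 1) ^ s * (staircase k * demazure_word ?h ?f)"
    unfolding staircase_def by auto
  have "demazure_word ?h ?f \<in> {1, - 1}" using Suc.prems by (intro hook_odd_power) auto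
  then have "demazure_word ?h (staircase k * ?f) \<in> {staircase k, - staircase k}"
    unfolding s by (cases "even s") auto
  then show ?case using Suc demazure_word_additive(3)[OF sub]
    by (auto simp: hooks_Suc staircase_Suc)
qed

lemma hooks_reduced:
  shows "word_value n (hooks n n) = negation n" "length (hooks n n) = n\<^sup>2" "set (hooks n n) \<subseteq> {1..n}"
  using word_value_hooks[of n n] length_hooks[of n n] set_hooks[of n n]
  by (auto simp: negation_def fun_eq_iff power2_eq_square)

lemma longest_demazure_staircase:
  assumes "set js \<subseteq> {1..CARD('n)}" "word_value CARD('n) js = negation CARD('n)" "length js = CARD('n)\<^sup>2"
  shows "demazure_word js (staircase CARD('n)) \<in> {1, - 1 :: 'n::finite skew_pol}"
  using demazure_word_same_value[of js "hooks CARD('n) CARD('n)" "staircase CARD('n) :: 'n skew_pol"]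
    hooks_reduced[of "CARD('n)"] hooks_staircase[of "CARD('n)", where 'n = 'n] assms by auto

section \<open>Schubert polynomials as a basis\<close>

lemma staircase_homog_top: "staircase CARD('n) \<in> (homog (2 * CARD('n)\<^sup>2) :: 'n::finite skew_pol set)"
  using staircase_homog[of "CARD('n)", where 'n = 'n] hooks_reduced(2)[of "CARD('n)"] by simp

lemma inv_length_le_square: "w \<in> weyl_B n \<Longrightarrow> inv_length n w \<le> n\<^sup>2"
  using inv_length_negation[of w n] by simp

lemma sym_B_closed:
  fixes f g :: "'n::finite skew_pol"
  shows "(0 :: 'n skew_pol) \<in> sym_B" "f \<in> sym_B \<Longrightarrow> g \<in> sym_B \<Longrightarrow> f + g \<in> sym_B"
    "f \<in> sym_B \<Longrightarrow> - f \<in> sym_B"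
  by (simp_all add: sym_B_eq demazure_additive)

context
  fixes red :: "(int \<Rightarrow> int) \<Rightarrow> nat list" and n :: nat
  assumes n: "n = CARD('n::finite)"
    and red: "\<And>w. w \<in> weyl_B n \<Longrightarrow> reduced_expression n w (red w)"
begin

lemma red_word:
  assumes "w \<in> weyl_B n"
  shows "set (red w) \<subseteq> {1..n}" "word_value n (red w) = w" "length (red w) = inv_length n w"
  using red[OF assms] weyl_length_eq[OF assms] by (auto simp: reduced_expression_def expression_iff)

abbreviation (input) D :: "(int \<Rightarrow> int) \<Rightarrow> 'n skew_pol \<Rightarrow> 'n skew_pol" where
  "D w \<equiv> demazure_word (red w)"

abbreviation (input) B :: "(int \<Rightarrow> int) \<Rightarrow> 'n skew_pol" where
  "B \<equiv> schubert_B red"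

lemma schubert_B_eq: "B w = D (inv w \<circ> negation n) (staircase n)"
  by (simp add: schubert_B_def demazure_elt_def demazure_word_def longest_eq staircase_def n)

lemma codual_element:
  assumes "w \<in> weyl_B n"
  shows "inv w \<circ> negation n \<in> weyl_B n" "inv_length n (inv w \<circ> negation n) + inv_length n w = n\<^sup>2"
  using inv_length_negation[OF weyl_B_inv[OF assms]] inv_length_inv[OF assms]
  by (simp_all add: assms weyl_B_comp weyl_B_inv negation_weyl_B)

text \<open>
  \<open>\<partial>\<^sub>u \<ss>\<^sub>w\<close> is the product along a word of length \<open>l u + n\<^sup>2 - l w \<ge> n\<^sup>2\<close> for \<open>u w\<inverse> w\<^sub>n\<close>. No
  element is longer than \<open>n\<^sup>2\<close> and only \<open>w\<^sub>n\<close> has this length, so that the word can be reduced only if \<open>u = w\<close>.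
\<close>

lemma schubert_pairing:
  assumes u: "u \<in> weyl_B n" and w: "w \<in> weyl_B n" and le: "inv_length n w \<le> inv_length n u"
  shows "u = w \<Longrightarrow> D u (B w) \<in> {1, - 1}" "u \<noteq> w \<Longrightarrow> D u (B w) = 0"
proof -
  let ?v = "inv w \<circ> negation n" and ?x = "u \<circ> inv w \<circ> negation n"
  let ?js = "red u @ red ?v"
  note v = codual_element[OF w]
  have js: "set ?js \<subseteq> {1..n}" "word_value n ?js = ?x" "length ?js = inv_length n u + inv_length n ?v"
    using red_word[OF u] red_word[OF v(1)] by (simp_all add: word_value_append comp_assoc)
  have eq: "D u (B w) = demazure_word ?js (staircase n)" by (simp add: schubert_B_eq)
  have x: "?x \<in> weyl_B n" using u w by (intro weyl_B_comp weyl_B_inv negation_weyl_B)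
  {
    assume "u = w"
    then have "?x = negation n" using inv_comp_weyl_B(1)[OF w] by (simp add: comp_assoc)
    then show "D u (B w) \<in> {1, - 1}"
      unfolding eq n using longest_demazure_staircase[of ?js, where 'n = 'n] js v(2) \<open>u = w\<close> unfolding n
      by (simp add: add.commute)
  }
  {
    assume "u \<noteq> w"
    have "\<not> reduced_word n ?js"
    proof
      assume "reduced_word n ?js"
      then have "inv_length n u + inv_length n ?v = inv_length n ?x" using js by (simp add: reduced_word_def)
      then have "inv_length n ?x = n\<^sup>2" using v(2) le inv_length_le_square[OF x] by simp
      then have "?x = negation n" by (rule inv_length_eq_square[OF x])
      then have "?x \<circ> negation n \<circ> w = negation n \<circ> negation n \<circ> w" by simp
      moreover have "?x \<circ> negation n \<circ> w = u \<circ> inv w \<circ> (negation n \<circ> negation n) \<circ> w"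
        by (simp only: comp_assoc)
      ultimately have "u \<circ> (inv w \<circ> w) = w" by (simp only: negation_involution comp_id id_comp comp_assoc)
      then show False using \<open>u \<noteq> w\<close> by (simp add: inv_comp_weyl_B(2)[OF w])
    qed
    then show "D u (B w) = 0"
      unfolding eq using demazure_word_nonreduced[of ?js, where 'n = 'n] js unfolding n by simp
  }
qed

lemma schubert_homog:
  assumes w: "w \<in> weyl_B n"
  shows "B w \<in> homog (2 * inv_length n w)" "B w \<noteq> 0"
proof -
  note v = codual_element[OF w]
  have "B w \<in> homog (2 * n\<^sup>2 - 2 * length (red (inv w \<circ> negation n)))"
    unfolding schubert_B_eq using red_word(1)[OF v(1)] staircase_homog_top[where 'n = 'n]
    unfolding n by (intro demazure_word_homog(1)) auto
  moreover have "2 * n\<^sup>2 - 2 * length (red (inv w \<circ> negation n)) = 2 * inv_length n w"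
    using v(2) red_word(3)[OF v(1)] by simp
  ultimately show "B w \<in> homog (2 * inv_length n w)" by simp
  have "D w (B w) \<in> {1, - 1}" by (rule schubert_pairing(1)[OF w w]) simp_all
  then show "B w \<noteq> 0" using demazure_word_additive(1)[of "red w", where 'n = 'n] red_word(1)[OF w] n by auto
qed

lemma D_mult_sym_B:
  assumes "w \<in> weyl_B n" "c \<in> sym_B"
  shows "D w (f * c) = D w f * c"
  using red_word(1)[OF assms(1)] assms(2) n
  by (intro demazure_word_mult_right) (auto simp: sym_B_eq)

text \<open>
  Apply \<open>\<partial>\<^sub>u\<close> for an element \<open>u\<close> of maximal length among those with nonzero coefficient.
\<close>

lemma schubert_right_independent:
  assumes c: "\<And>w. w \<in> weyl_B n \<Longrightarrow> c w \<in> sym_B" and zero: "(\<Sum>w\<in>weyl_B n. B w * c w) = 0"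
    and w: "w \<in> weyl_B n"
  shows "c w = 0"
proof (rule ccontr)
  let ?S = "{w \<in> weyl_B n. c w \<noteq> 0}"
  assume "c w \<noteq> 0"
  then have "w \<in> ?S" using w by simp
  have fin: "finite (inv_length n ` ?S)" using finite_weyl_B[of n] by simp
  have "Max (inv_length n ` ?S) \<in> inv_length n ` ?S"
    using fin \<open>w \<in> ?S\<close> by (intro Max_in) blast+
  then obtain u where u: "u \<in> ?S" and u_max: "Max (inv_length n ` ?S) = inv_length n u" by (rule imageE)
  have max: "inv_length n v \<le> inv_length n u" if "v \<in> ?S" for v
    unfolding u_max[symmetric] by (rule Max_ge[OF fin imageI[OF that]])
  have U: "u \<in> weyl_B n" using u by simp
  note Dsum = demazure_word_sum[OF red_word(1)[OF U, unfolded n]]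
  have "0 = D u (\<Sum>w\<in>weyl_B n. B w * c w)"
    unfolding zero using demazure_word_additive(1)[of "red u", where 'n = 'n] red_word(1)[OF U] n by simp
  also have "\<dots> = (\<Sum>w\<in>weyl_B n. D u (B w) * c w)"
    unfolding Dsum by (intro sum.cong D_mult_sym_B U c refl)
  also have "\<dots> = (\<Sum>w\<in>{u}. D u (B w) * c w)"
  proof (rule sum.mono_neutral_right)
    show "\<forall>w\<in>weyl_B n - {u}. D u (B w) * c w = 0"
    proof
      fix w assume w: "w \<in> weyl_B n - {u}"
      show "D u (B w) * c w = 0"
      proof (cases "c w = 0")
        case False
        then have "w \<in> ?S" using w by simp
        then have "D u (B w) = 0" using w max[of w] by (intro schubert_pairing(2)[OF U]) simp_all
        then show ?thesis by simp
      qed simp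
    qed
  qed (use U finite_weyl_B in auto)
  finally have "D u (B u) * c u = 0" by simp
  moreover have "D u (B u) \<in> {1, - 1}" by (rule schubert_pairing(1)[OF U U]) simp_all
  ultimately have "c u = 0" by auto
  then show False using u by simp
qed

text \<open>
  Applying one more operator \<open>i\<close> gives the product along the word \<open>i, u\<close>, which either is not reduced or
  represents an element longer than \<open>u\<close>.
\<close>

lemma D_top_layer_sym_B:
  assumes u: "u \<in> weyl_B n" and higher: "\<And>v. v \<in> weyl_B n \<Longrightarrow> inv_length n u < inv_length n v \<Longrightarrow> D v f = 0"
  shows "D u f \<in> sym_B"
  unfolding sym_B_eq
proof (intro CollectI ballI)
  fix i assume i: "i \<in> {1..CARD('n)}"
  let ?js = "i # red u"
  have js: "set ?js \<subseteq> {1..CARD('n)}" using red_word(1)[OF u] i n by simp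
  have "demazure_word ?js f = 0"
  proof (cases "reduced_word n ?js")
    case True
    let ?v = "word_value n ?js"
    have v: "?v \<in> weyl_B n" using js n by (intro word_value_weyl_B) simp
    have "length ?js = inv_length n ?v" using True by (simp add: reduced_word_def)
    moreover from this have "D ?v f = 0" using red_word(3)[OF u] by (intro higher v) simp
    ultimately show ?thesis
      using demazure_word_same_value[of ?js "red ?v" f] js red_word[OF v] n by auto
  next
    case False
    then show ?thesis using js n by (intro demazure_word_nonreduced) auto
  qed
  then show "demazure i (D u f) = 0" by simp
qed

text \<open>
  Coefficients are chosen by descending length \<open>k\<close> such that the remainder is killed by \<open>\<partial>\<^sub>u\<close> for all \<open>u\<close>
  of length at least \<open>k\<close>. At \<open>k = 0\<close> this includes \<open>u = 1\<close>, and the remainder is zero.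
\<close>

lemma schubert_right_spanning:
  "\<exists>c. (\<forall>w\<in>weyl_B n. c w \<in> sym_B) \<and> f = (\<Sum>w\<in>weyl_B n. B w * c w)"
proof -
  let ?W = "weyl_B n" and ?l = "inv_length n"
  let ?rest = "\<lambda>c. f - (\<Sum>w\<in>?W. B w * c w)"
  let ?P = "\<lambda>k. \<exists>c. (\<forall>w\<in>?W. c w \<in> sym_B) \<and> (\<forall>u\<in>?W. k \<le> ?l u \<longrightarrow> D u (?rest c) = 0)"
  have "0 \<le> Suc (n\<^sup>2)" by simp
  then have "?P 0"
  proof (induction rule: inc_induct)
    case base
    have "\<not> Suc (n\<^sup>2) \<le> ?l u" if "u \<in> ?W" for u using inv_length_le_square[OF that] by simp
    then show ?case by (intro exI[of _ "\<lambda>_. 0"]) (auto simp: sym_B_closed)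
  next
    case (step k)
    then obtain c where c: "\<And>w. w \<in> ?W \<Longrightarrow> c w \<in> sym_B"
      and kill: "\<And>u. u \<in> ?W \<Longrightarrow> Suc k \<le> ?l u \<Longrightarrow> D u (?rest c) = 0" by blast
    let ?r = "?rest c"
    \<comment> \<open>the factor \<open>D w (B w)\<close> is \<open>\<plusminus>1\<close>, its own inverse, and corrects the sign\<close>
    define d where "d w = (if ?l w = k then D w (B w) * D w ?r else 0)" for w
    have pm: "D w (B w) \<in> {1, - 1}" if "w \<in> ?W" for w
      by (rule schubert_pairing(1)[OF that that]) simp_all
    have d: "d w \<in> sym_B" if w: "w \<in> ?W" for w
    proof (cases "?l w = k")
      case True
      then have "D w ?r \<in> sym_B" using kill by (intro D_top_layer_sym_B[OF w]) auto
      then show ?thesis using pm[OF w] by (auto simp: d_def sym_B_closed)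
    qed (simp add: d_def sym_B_closed)
    have rest: "?rest (\<lambda>w. c w + d w) = ?r - (\<Sum>w\<in>?W. B w * d w)"
      by (simp add: semiring_class.distrib_left sum.distrib algebra_simps)
    have "D u (?rest (\<lambda>w. c w + d w)) = 0" if u: "u \<in> ?W" and k: "k \<le> ?l u" for u
    proof -
      note additive = demazure_word_additive[OF red_word(1)[OF u, unfolded n]]
        and Dsum = demazure_word_sum[OF red_word(1)[OF u, unfolded n]]
      have "D u (?rest (\<lambda>w. c w + d w)) = D u ?r - (\<Sum>w\<in>?W. D u (B w) * d w)"
        unfolding rest additive Dsum using D_mult_sym_B[OF u d]
        by (intro arg_cong2[where f = minus] sum.cong refl) (simp_all add: additive Dsum)
      also have "(\<Sum>w\<in>?W. D u (B w) * d w) = (\<Sum>w\<in>{u}. D u (B w) * d w)"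
      proof (rule sum.mono_neutral_right)
        show "\<forall>w\<in>?W - {u}. D u (B w) * d w = 0"
        proof
          fix w assume w: "w \<in> ?W - {u}"
          show "D u (B w) * d w = 0"
          proof (cases "?l w = k")
            case True
            then have "D u (B w) = 0" using w k by (intro schubert_pairing(2)[OF u]) auto
            then show ?thesis by simp
          qed (simp add: d_def)
        qed
      qed (use u finite_weyl_B in auto)
      also have "D u ?r - (\<Sum>w\<in>{u}. D u (B w) * d w) = 0"
      proof (cases "?l u = k")
        case True
        then show ?thesis using pm[OF u] by (auto simp: d_def)
      next
        case False
        then show ?thesis using kill[OF u] k by (simp add: d_def)
      qed
      finally show ?thesis .
    qed
    moreover have "c w + d w \<in> sym_B" if "w \<in> ?W" for w using c d that by (simp add: sym_B_closed)
    ultimately show ?case by (intro exI[of _ "\<lambda>w. c w + d w"]) blast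
  qed
  then obtain c where c: "\<forall>w\<in>?W. c w \<in> sym_B" "D id (?rest c) = 0" using weyl_B_id by blast
  have "red id = []" using red_word(3)[OF weyl_B_id] by (simp add: inv_length_id)
  with c show ?thesis by auto
qed

lemma schubert_right_basis: "right_basis sym_B (weyl_B n) B"
  unfolding right_basis_def
proof (intro conjI allI impI)
  show "finite (weyl_B n)" by (rule finite_weyl_B)
  show "\<exists>c. (\<forall>w\<in>weyl_B n. c w \<in> sym_B) \<and> f = (\<Sum>w\<in>weyl_B n. B w * c w)" for f
    by (rule schubert_right_spanning)
  fix c assume "(\<forall>w\<in>weyl_B n. c w \<in> sym_B) \<and> (\<Sum>w\<in>weyl_B n. B w * c w) = 0"
  then show "\<forall>w\<in>weyl_B n. c w = 0" using schubert_right_independent[of c] by simp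
qed

lemma schubert_left_basis: "left_basis sym_B (weyl_B n) B"
proof -
  have swap: "(\<Sum>w\<in>weyl_B n. c w * B w) = (\<Sum>w\<in>weyl_B n. B w * c w)"
    if "\<forall>w\<in>weyl_B n. c w \<in> sym_B" for c
    using that by (intro sum.cong refl sym_B_central[symmetric]) blast
  show ?thesis unfolding left_basis_def
  proof (intro conjI allI impI)
    show "finite (weyl_B n)" by (rule finite_weyl_B)
    show "\<exists>c. (\<forall>w\<in>weyl_B n. c w \<in> sym_B) \<and> f = (\<Sum>w\<in>weyl_B n. c w * B w)" for f
    proof -
      obtain c where c: "\<forall>w\<in>weyl_B n. c w \<in> sym_B" and f: "f = (\<Sum>w\<in>weyl_B n. B w * c w)"
        using schubert_right_spanning[of f] by blast
      have "f = (\<Sum>w\<in>weyl_B n. c w * B w)" unfolding swap[OF c] by (rule f)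
      with c show ?thesis by blast
    qed
    fix c assume c: "(\<forall>w\<in>weyl_B n. c w \<in> sym_B) \<and> (\<Sum>w\<in>weyl_B n. c w * B w) = 0"
    then have zero: "(\<Sum>w\<in>weyl_B n. B w * c w) = 0"
      unfolding swap[OF conjunct1[OF c]] by (rule conjunct2)
    show "\<forall>w\<in>weyl_B n. c w = 0"
    proof
      fix w assume w: "w \<in> weyl_B n"
      show "c w = 0"
        by (rule schubert_right_independent[where c = c, OF _ zero w]) (use c in blast)
    qed
  qed
qed

end

section \<open>The graded rank\<close>

lemma q_var_power: "q_var ^ m = Fract (monom 1 m) 1"
  by (induction m) (simp_all add: q_var_def One_fract_def monom_Suc)

lemma q_var_power_neq_1: "0 < m \<Longrightarrow> q_var ^ m \<noteq> 1"
  by (simp add: q_var_power One_fract_def eq_fract monom_eq_1_iff)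

lemma q_var_neq_0: "q_var \<noteq> 0"
  by (simp add: q_var_def Zero_fract_def eq_fract)

lemma quantum_int_geometric: "q_var ^ m * quantum_int (Suc m) = (\<Sum>j<Suc m. (q_var\<^sup>2) ^ j)"
proof -
  have q2: "q_var\<^sup>2 - 1 \<noteq> 0" using q_var_power_neq_1[of 2] by simp
  have "q_var - inverse q_var = (q_var\<^sup>2 - 1) / q_var"
    using q_var_neq_0 by (simp add: field_simps power2_eq_square)
  moreover have "q_var ^ Suc m - inverse q_var ^ Suc m = ((q_var\<^sup>2) ^ Suc m - 1) / q_var ^ Suc m"
    using q_var_neq_0 by (simp add: field_simps power_mult_distrib power2_eq_square)
  ultimately have "q_var ^ m * quantum_int (Suc m) = ((q_var\<^sup>2) ^ Suc m - 1) / (q_var\<^sup>2 - 1)"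
    unfolding quantum_int_def using q_var_neq_0 q2 by (simp add: field_simps)
  also have "\<dots> = (\<Sum>j<Suc m. (q_var\<^sup>2) ^ j)"
    using q2 by (subst geometric_sum) simp_all
  finally show ?thesis .
qed

text \<open>
  The factor \<open>q\<^bsup>n\<^sup>2\<^esup>\<close> is the product of the \<open>q\<^bsup>2k-1\<^esup>\<close> for \<open>k \<le> n\<close>, and each \<open>q\<^bsup>2k-1\<^esup>\<close> clears the negative powers
  of \<open>q\<close> in \<open>[2k]\<close>.
\<close>

lemma even_quantum_dfact_product:
  "q_var ^ n\<^sup>2 * even_quantum_dfact n = (\<Prod>k\<in>{1..n}. \<Sum>j<2 * k. (q_var\<^sup>2) ^ j)"
proof (induction n)
  case (Suc n)
  have "(Suc n)\<^sup>2 = n\<^sup>2 + Suc (2 * n)" by (simp add: power2_eq_square)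
  then have "q_var ^ (Suc n)\<^sup>2 = q_var ^ n\<^sup>2 * q_var ^ Suc (2 * n)" by (simp only: power_add)
  then have "q_var ^ (Suc n)\<^sup>2 * even_quantum_dfact (Suc n) =
      (q_var ^ n\<^sup>2 * even_quantum_dfact n) * (q_var ^ Suc (2 * n) * quantum_int (Suc (Suc (2 * n))))"
    by (simp add: even_quantum_dfact_def mult_ac)
  also have "\<dots> = (\<Prod>k\<in>{1..n}. \<Sum>j<2 * k. (q_var\<^sup>2) ^ j) * (\<Sum>j<2 * Suc n. (q_var\<^sup>2) ^ j)"
    unfolding Suc quantum_int_geometric by simp
  finally show ?case by (simp add: mult.commute)
qed (simp add: even_quantum_dfact_def)

theorem proposition5p3:
  fixes red :: "(int \<Rightarrow> int) \<Rightarrow> nat list"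
    and B :: "(int \<Rightarrow> int) \<Rightarrow> 'n::finite skew_pol"
  assumes red: "\<And>w. w \<in> weyl_B CARD('n) \<Longrightarrow> reduced_expression CARD('n) w (red w)"
    and B: "B = schubert_B red"
  shows "left_basis sym_B (weyl_B CARD('n)) B
    \<and> right_basis sym_B (weyl_B CARD('n)) B
    \<and> (\<forall>w\<in>weyl_B CARD('n). \<exists>d. B w \<in> homog d)
    \<and> graded_rank (weyl_B CARD('n)) B = q_var ^ (CARD('n)\<^sup>2) * even_quantum_dfact CARD('n)"
proof (intro conjI ballI)
  let ?W = "weyl_B CARD('n)"
  show "left_basis sym_B ?W B" "right_basis sym_B ?W B"
    unfolding B by (rule schubert_left_basis schubert_right_basis; use red in simp)+
  have homog: "B w \<in> homog (2 * inv_length CARD('n) w)" "B w \<noteq> 0" if "w \<in> ?W" for w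
    unfolding B by (rule schubert_homog[OF refl red that]; assumption)+
  then show "\<exists>d. B w \<in> homog d" if "w \<in> ?W" for w using that by blast
  have "graded_rank ?W B = (\<Sum>w\<in>?W. (q_var\<^sup>2) ^ inv_length CARD('n) w)"
    unfolding graded_rank_def
    by (intro sum.cong refl) (simp only: hdeg_eq[OF homog] power_mult)
  then show "graded_rank ?W B = q_var ^ (CARD('n)\<^sup>2) * even_quantum_dfact CARD('n)"
    by (simp only: weyl_B_length_generating_function even_quantum_dfact_product)
qed

end
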